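(* Let $k\ge 4$ and let $G=(V,E)$ be a simple undirected graph with $n=|V|$. Algorithm Approx1 on $G$ outputs a $k^-$-star partition of $G$ and runs in $O(n^3)$ time.
   Context: A star in $G$ is a subgraph of $G$ that is either a single vertex, a single edge, or a tree in which exactly one vertex has degree at least $2$ and all other vertices have degree $1$. An $\ell$-star is a star with exactly $\ell$ vertices; an $\ell^+$-star (resp. $\ell^-$-star) has at least (resp. at most) $\ell$ vertices. The center of a star is its vertex of maximum degree; in a $2$-star one of the two vertices is designated (arbitrarily but fixed) as the center; the other vertices are satellites. We write $v_1$-$v_2\ldots v_\ell$ for the $\ell$-star with center $v_1$ and satellites $v_2,\dots,v_\ell$. A $k^-$-star partition of $G$ is a collection of vertex-disjoint $k^-$-stars in $G$ whose vertex sets cover $V$. Given the current partition $\mathcal S$: a vertex is critical if it lies in a $2$-star of $\mathcal S$ or is the center of a $3$-star of $\mathcal S$; two critical vertices are separate if they lie in different stars of $\mathcal S$. The $2$- and $3$-stars of $\mathcal S$ are called tiny. Operation 1: if $\{u,v\}\in E$ where $u$ lies in a $2$-star of $\mathcal S$ and $v$ is a satellite of a $4^+$-star of $\mathcal S$ with center $c$, replace the edge $\{c,v\}$ by $\{u,v\}$. Operation 2: if $S=v_1$-$v_2\ldots v_\ell$ is a star of $\mathcal S$ with $\ell\in\{2,3,4\}$ and there are $\ell$ pairwise separate critical vertices $w_1,\dots,w_\ell\notin V(S)$ with $\{v_j,w_j\}\in E$ for all $j$, delete the edges of $S$ and add the edges $\{v_j,w_j\}$, $j=1,\dots,\ell$.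 Operation 3: let $S=v_1$-$v_2\ldots v_\ell$ be a tiny star of $\mathcal S$ and $W=w_1$-$w_2$ a $2$-star of $\mathcal S$, $W\neq S$, with $w_1,w_2$ both adjacent to $v_1$ in $G$. If $k\ge5$ or $\ell=2$, replace the edge $\{w_1,w_2\}$ by $\{w_1,v_1\},\{w_2,v_1\}$. Otherwise ($k=4$, $\ell=3$), if there is a critical vertex $w_3\notin V(S)\cup V(W)$ adjacent to $v_j$ for some $j\in\{2,3\}$, replace the edges $\{w_1,w_2\},\{v_1,v_j\}$ by $\{w_1,v_1\},\{w_2,v_1\},\{w_3,v_j\}$. Algorithm Approx1: compute a $k^-$-star partition $\mathcal S$ of $G$ having the minimum possible number of $1$-stars among all $k^-$-star partitions; then, while one of Operations 1–3 is applicable to $\mathcal S$, apply it; return $\mathcal S$. *)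

theory Defs
  imports Complex_Main "HOL-Library.Landau_Symbols"
begin

section \<open>Graphs and stars\<close>

type_synonym 'a ugraph = "'a set \<times> 'a set set"

abbreviation verts :: "'a ugraph \<Rightarrow> 'a set" where "verts \<equiv> fst"
abbreviation edges :: "'a ugraph \<Rightarrow> 'a set set" where "edges \<equiv> snd"

definition simple_graph :: "'a ugraph \<Rightarrow> bool" where
  "simple_graph G \<longleftrightarrow> finite (verts G) \<and> (\<forall>e\<in>edges G. e \<subseteq> verts G \<and> card e = 2)"

definition subgraph :: "'a ugraph \<Rightarrow> 'a ugraph \<Rightarrow> bool" where
  "subgraph H G \<longleftrightarrow> verts H \<subseteq> verts G \<and> edges H \<subseteq> edges G \<and> (\<forall>e\<in>edges H. e \<subseteq> verts H)"

definition vdegree :: "'a ugraph \<Rightarrow> 'a \<Rightarrow> nat" where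
  "vdegree G v = card {e \<in> edges G. v \<in> e}"

definition adj_rel :: "'a set set \<Rightarrow> ('a \<times> 'a) set" where
  "adj_rel F = {(u, v). {u, v} \<in> F}"

definition gconnected :: "'a ugraph \<Rightarrow> bool" where
  "gconnected G \<longleftrightarrow> verts G \<noteq> {} \<and> (\<forall>u\<in>verts G. \<forall>v\<in>verts G. (u, v) \<in> (adj_rel (edges G))\<^sup>*)"

definition gcycle :: "'a ugraph \<Rightarrow> 'a list \<Rightarrow> bool" where
  "gcycle G p \<longleftrightarrow> 3 \<le> length p \<and> distinct p \<and> set p \<subseteq> verts G \<and>
     (\<forall>i<length p. {p ! i, p ! (Suc i mod length p)} \<in> edges G)"

definition tree :: "'a ugraph \<Rightarrow> bool" where
  "tree G \<longleftrightarrow> gconnected G \<and> (\<nexists>p. gcycle G p)"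

definition is_star :: "'a ugraph \<Rightarrow> bool" where
  "is_star S \<longleftrightarrow>
     (\<exists>v. S = ({v}, {})) \<or>
     (\<exists>u v. u \<noteq> v \<and> S = ({u, v}, {{u, v}})) \<or>
     (tree S \<and> (\<exists>c\<in>verts S. 2 \<le> vdegree S c \<and> (\<forall>v\<in>verts S - {c}. vdegree S v = 1)))"

definition star_in :: "'a ugraph \<Rightarrow> 'a ugraph \<Rightarrow> bool" where
  "star_in G S \<longleftrightarrow> subgraph S G \<and> is_star S"

definition star_partition :: "nat \<Rightarrow> 'a ugraph \<Rightarrow> 'a ugraph set \<Rightarrow> bool" where
  "star_partition k G P \<longleftrightarrow>
     (\<forall>S\<in>P. star_in G S \<and> card (verts S) \<le> k) \<and>
     (\<forall>S\<in>P. \<forall>T\<in>P. S \<noteq> T \<longrightarrow> verts S \<inter> verts T = {}) \<and>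
     (\<Union>S\<in>P. verts S) = verts G"

definition num_1stars :: "'a ugraph set \<Rightarrow> nat" where
  "num_1stars P = card {S \<in> P. card (verts S) = 1}"

section \<open>The operations\<close>

text \<open>A designation fixes the center of every potential 2-star. Since none of the operations
  creates a 2-star, one designation serves a whole run.\<close>

definition designation :: "('a set \<Rightarrow> 'a) \<Rightarrow> bool" where
  "designation \<delta> \<longleftrightarrow> (\<forall>e. card e = 2 \<longrightarrow> \<delta> e \<in> e)"

definition is_center :: "('a set \<Rightarrow> 'a) \<Rightarrow> 'a ugraph \<Rightarrow> 'a \<Rightarrow> bool" where
  "is_center \<delta> S c \<longleftrightarrow>
     (if card (verts S) = 2 then c = \<delta> (verts S)
      else c \<in> verts S \<and> (\<forall>v\<in>verts S. vdegree S v \<le> vdegree S c))"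

definition critical :: "('a set \<Rightarrow> 'a) \<Rightarrow> 'a ugraph set \<Rightarrow> 'a \<Rightarrow> bool" where
  "critical \<delta> P v \<longleftrightarrow>
     (\<exists>S\<in>P. card (verts S) = 2 \<and> v \<in> verts S \<or> card (verts S) = 3 \<and> is_center \<delta> S v)"

definition in_different_stars :: "'a ugraph set \<Rightarrow> 'a \<Rightarrow> 'a \<Rightarrow> bool" where
  "in_different_stars P u v \<longleftrightarrow> (\<exists>S\<in>P. \<exists>T\<in>P. S \<noteq> T \<and> u \<in> verts S \<and> v \<in> verts T)"

definition tiny :: "'a ugraph \<Rightarrow> bool" where
  "tiny S \<longleftrightarrow> card (verts S) = 2 \<or> card (verts S) = 3"

definition components :: "'a set \<Rightarrow> 'a set set \<Rightarrow> 'a ugraph set" where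
  "components V F =
     {(C, {e \<in> F. e \<subseteq> C}) | C. \<exists>u\<in>V. C = {v \<in> V. (u, v) \<in> (adj_rel F)\<^sup>*}}"

text \<open>A family of vertex-disjoint stars covering \<open>V\<close> is the set of components of the spanning
  subgraph formed by all star edges. Deleting the edges \<open>D\<close> and adding the edges \<open>A\<close> yields the
  components of the modified spanning subgraph. That these are stars again is not part of the
  definition.\<close>

definition exchange :: "'a ugraph \<Rightarrow> 'a ugraph set \<Rightarrow> 'a set set \<Rightarrow> 'a set set \<Rightarrow> 'a ugraph set" where
  "exchange G P D A = components (verts G) (((\<Union>S\<in>P. edges S) - D) \<union> A)"

inductive operation ::
    "nat \<Rightarrow> 'a ugraph \<Rightarrow> ('a set \<Rightarrow> 'a) \<Rightarrow> 'a ugraph set \<Rightarrow> 'a ugraph set \<Rightarrow> bool"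
  for k G \<delta> P where
  Operation1:
    "\<lbrakk> U \<in> P; card (verts U) = 2; u \<in> verts U;
       T \<in> P; 4 \<le> card (verts T); is_center \<delta> T c; v \<in> verts T; v \<noteq> c;
       {u, v} \<in> edges G \<rbrakk>
     \<Longrightarrow> operation k G \<delta> P (exchange G P {{c, v}} {{u, v}})"
| Operation2:
    "\<lbrakk> S \<in> P; card (verts S) \<in> {2, 3, 4};
       \<And>v. v \<in> verts S \<Longrightarrow> critical \<delta> P (w v) \<and> w v \<notin> verts S \<and> {v, w v} \<in> edges G;
       \<And>v v'. \<lbrakk> v \<in> verts S; v' \<in> verts S; v \<noteq> v' \<rbrakk> \<Longrightarrow> in_different_stars P (w v) (w v') \<rbrakk>
     \<Longrightarrow> operation k G \<delta> P (exchange G P (edges S) {{v, w v} | v. v \<in> verts S})"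
| Operation3_all:
    "\<lbrakk> S \<in> P; tiny S; is_center \<delta> S v1;
       W \<in> P; W \<noteq> S; w1 \<noteq> w2; verts W = {w1, w2}; {w1, v1} \<in> edges G; {w2, v1} \<in> edges G;
       5 \<le> k \<or> card (verts S) = 2 \<rbrakk>
     \<Longrightarrow> operation k G \<delta> P (exchange G P {{w1, w2}} {{w1, v1}, {w2, v1}})"
| Operation3_k4:
    "\<lbrakk> S \<in> P; tiny S; is_center \<delta> S v1;
       W \<in> P; W \<noteq> S; w1 \<noteq> w2; verts W = {w1, w2}; {w1, v1} \<in> edges G; {w2, v1} \<in> edges G;
       \<not> (5 \<le> k \<or> card (verts S) = 2);
       vj \<in> verts S; vj \<noteq> v1;
       critical \<delta> P w3; w3 \<notin> verts S \<union> verts W; {w3, vj} \<in> edges G \<rbrakk>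
     \<Longrightarrow> operation k G \<delta> P
           (exchange G P {{w1, w2}, {v1, vj}} {{w1, v1}, {w2, v1}, {w3, vj}})"

section \<open>The algorithm\<close>

definition initial_partition :: "nat \<Rightarrow> 'a ugraph \<Rightarrow> 'a ugraph set \<Rightarrow> bool" where
  "initial_partition k G P \<longleftrightarrow>
     star_partition k G P \<and> (\<forall>Q. star_partition k G Q \<longrightarrow> num_1stars P \<le> num_1stars Q)"

definition terminal :: "nat \<Rightarrow> 'a ugraph \<Rightarrow> ('a set \<Rightarrow> 'a) \<Rightarrow> 'a ugraph set \<Rightarrow> bool" where
  "terminal k G \<delta> P \<longleftrightarrow> (\<nexists>Q. operation k G \<delta> P Q)"

definition approx1_output ::
    "nat \<Rightarrow> 'a ugraph \<Rightarrow> ('a set \<Rightarrow> 'a) \<Rightarrow> 'a ugraph set \<Rightarrow> bool" where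
  "approx1_output k G \<delta> P \<longleftrightarrow>
     (\<exists>P0. initial_partition k G P0 \<and> (operation k G \<delta>)\<^sup>*\<^sup>* P0 P \<and> terminal k G \<delta> P)"

definition approx1_diverges :: "nat \<Rightarrow> 'a ugraph \<Rightarrow> ('a set \<Rightarrow> 'a) \<Rightarrow> bool" where
  "approx1_diverges k G \<delta> \<longleftrightarrow>
     (\<exists>f :: nat \<Rightarrow> 'a ugraph set.
        initial_partition k G (f 0) \<and> (\<forall>i. operation k G \<delta> (f i) (f (Suc i))))"

section \<open>Model of computation\<close>

text \<open>A random access machine, presented as a while-language over arrays of natural numbers
  (a scalar is entry 0 of an array). Every memory access, addition, truncated subtraction,
  comparison, Boolean connective, assignment and branch takes one unit of time; there is no
  multiplication. Numbers stored in memory are limited to at most \<open>W\<close>: an assignment of a larger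
  value has no execution, so unit-cost arithmetic on huge numbers is excluded.\<close>

type_synonym mem = "string \<Rightarrow> nat \<Rightarrow> nat"

datatype aexp = Lit nat | Read string aexp | Add aexp aexp | Sub aexp aexp

datatype bexp = Lt aexp aexp | Neg bexp | Conj bexp bexp

datatype com =
    Skip
  | Write string aexp aexp
  | Seq com com
  | If bexp com com
  | While bexp com

fun aval :: "aexp \<Rightarrow> mem \<Rightarrow> nat" where
  "aval (Lit m) s = m"
| "aval (Read x i) s = s x (aval i s)"
| "aval (Add a b) s = aval a s + aval b s"
| "aval (Sub a b) s = aval a s - aval b s"

fun acost :: "aexp \<Rightarrow> nat" where
  "acost (Lit m) = 1"
| "acost (Read x i) = 1 + acost i"
| "acost (Add a b) = 1 + acost a + acost b"
| "acost (Sub a b) = 1 + acost a + acost b"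

fun bval :: "bexp \<Rightarrow> mem \<Rightarrow> bool" where
  "bval (Lt a b) s \<longleftrightarrow> aval a s < aval b s"
| "bval (Neg p) s \<longleftrightarrow> \<not> bval p s"
| "bval (Conj p q) s \<longleftrightarrow> bval p s \<and> bval q s"

fun bcost :: "bexp \<Rightarrow> nat" where
  "bcost (Lt a b) = 1 + acost a + acost b"
| "bcost (Neg p) = 1 + bcost p"
| "bcost (Conj p q) = 1 + bcost p + bcost q"

text \<open>\<open>exec W c s t s'\<close>: started in memory \<open>s\<close>, program \<open>c\<close> halts after \<open>t\<close> steps in \<open>s'\<close>.\<close>

inductive exec :: "nat \<Rightarrow> com \<Rightarrow> mem \<Rightarrow> nat \<Rightarrow> mem \<Rightarrow> bool" for W where
  Skip: "exec W Skip s 1 s"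
| Write: "aval a s \<le> W \<Longrightarrow>
    exec W (Write x i a) s (1 + acost i + acost a) (s(x := (s x)(aval i s := aval a s)))"
| Seq: "\<lbrakk> exec W c s t s'; exec W d s' t' s'' \<rbrakk> \<Longrightarrow> exec W (Seq c d) s (t + t') s''"
| IfTrue: "\<lbrakk> bval b s; exec W c s t s' \<rbrakk> \<Longrightarrow> exec W (If b c d) s (1 + bcost b + t) s'"
| IfFalse: "\<lbrakk> \<not> bval b s; exec W d s t s' \<rbrakk> \<Longrightarrow> exec W (If b c d) s (1 + bcost b + t) s'"
| WhileFalse: "\<not> bval b s \<Longrightarrow> exec W (While b c) s (1 + bcost b) s"
| WhileTrue: "\<lbrakk> bval b s; exec W c s t s'; exec W (While b c) s' t' s'' \<rbrakk>
    \<Longrightarrow> exec W (While b c) s (1 + bcost b + t + t') s''"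

section \<open>Implementations of the algorithm\<close>

text \<open>The input graph on \<open>{..<n}\<close> is given by its adjacency matrix, stored row by row; a star
  partition is stored by letting \<open>ctr\<close> map each satellite to its center and every other
  vertex to itself.\<close>

definition input_mem :: "nat \<Rightarrow> nat \<Rightarrow> nat set set \<Rightarrow> mem" where
  "input_mem k n E = (\<lambda>x i.
     if x = ''n'' \<and> i = 0 then n
     else if x = ''k'' \<and> i = 0 then k
     else if x = ''adj'' \<and> i < n * n \<and> {i div n, i mod n} \<in> E then 1
     else 0)"

definition stored_partition :: "nat \<Rightarrow> mem \<Rightarrow> nat ugraph set" where
  "stored_partition n s =
     components {..<n} {{v, s ''ctr'' v} | v. v < n \<and> s ''ctr'' v < n \<and> s ''ctr'' v \<noteq> v}"

text \<open>Executions of \<open>While b body\<close> in which every iteration performs exactly one operation on the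
  stored partition and which stop only when no operation is applicable; the step count is that
  of \<open>exec\<close>.\<close>

inductive approx1_loop ::
    "nat \<Rightarrow> nat \<Rightarrow> nat \<Rightarrow> nat set set \<Rightarrow> (nat set \<Rightarrow> nat) \<Rightarrow> bexp \<Rightarrow> com \<Rightarrow> mem \<Rightarrow> nat \<Rightarrow> mem \<Rightarrow> bool"
  for W k n E \<delta> b body where
  stop: "\<lbrakk> \<not> bval b s; terminal k ({..<n}, E) \<delta> (stored_partition n s) \<rbrakk>
    \<Longrightarrow> approx1_loop W k n E \<delta> b body s (1 + bcost b) s"
| iterate: "\<lbrakk> bval b s; exec W body s t s';
      operation k ({..<n}, E) \<delta> (stored_partition n s) (stored_partition n s');
      approx1_loop W k n E \<delta> b body s' t' s'' \<rbrakk>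
    \<Longrightarrow> approx1_loop W k n E \<delta> b body s (1 + bcost b + t + t') s''"

definition approx1_exec ::
    "nat \<Rightarrow> nat \<Rightarrow> nat \<Rightarrow> nat set set \<Rightarrow> (nat set \<Rightarrow> nat) \<Rightarrow> com \<Rightarrow> bexp \<Rightarrow> com \<Rightarrow> nat \<Rightarrow> mem \<Rightarrow> bool" where
  "approx1_exec W k n E \<delta> start b body t s \<longleftrightarrow>
     (\<exists>s0 t0 t1. exec W start (input_mem k n E) t0 s0 \<and>
        initial_partition k ({..<n}, E) (stored_partition n s0) \<and>
        approx1_loop W k n E \<delta> b body s0 t1 s \<and> t = t0 + t1)"

lemma approx1_loop_exec: "approx1_loop W k n E \<delta> b body s t s' \<Longrightarrow> exec W (While b body) s t s'"
  by (induction rule: approx1_loop.induct) (blast intro: exec.WhileFalse exec.WhileTrue)+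

lemma approx1_exec_exec:
  "approx1_exec W k n E \<delta> start b body t s
   \<Longrightarrow> exec W (Seq start (While b body)) (input_mem k n E) t s"
  by (auto simp: approx1_exec_def intro: exec.Seq approx1_loop_exec)

lemma approx1_exec_output:
  assumes "approx1_exec W k n E \<delta> start b body t s"
  shows "approx1_output k ({..<n}, E) \<delta> (stored_partition n s)"
proof -
  have "(operation k ({..<n}, E) \<delta>)\<^sup>*\<^sup>* (stored_partition n s0) (stored_partition n s1) \<and>
      terminal k ({..<n}, E) \<delta> (stored_partition n s1)"
    if "approx1_loop W k n E \<delta> b body s0 t1 s1" for s0 t1 s1
    using that by (induction rule: approx1_loop.induct)
      (auto intro: converse_rtranclp_into_rtranclp)
  with assms show ?thesis
    unfolding approx1_exec_def approx1_output_def by blast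
qed

end

(*
  A partition into k^- -stars is represented by a map c sending every vertex to the center of its
  star. Every operation is then a short sequence of steps "attach v to w", and each operation
  decreases the number of stars plus the number of vertices in 2-stars, because 2-stars are never
  created. Hence there are at most 2n iterations, each of which costs O(n^2): for Operation 2 it
  suffices to know, for every vertex, four critical neighbors in different stars.

  A partition with the fewest 1-stars is found by augmentation. From a 1-star d with neighbor v, the
  number of 1-stars can be decreased at once unless v is the center of a k-star; in that case d
  can replace any satellite of v, which becomes a 1-star instead. A breadth-first search, backwards
  from the vertices that are not centers of k-stars, takes O(n^2) steps and finds a chain of such
  replacements ending in an improvement. If there is none, let S be the set of centers of
  k-stars that are not reached and D the set of 1-stars and satellites of S. All neighbors of
  D lie in S, so every k^- -star partition leaves at least |D| - (k-1)|S| vertices of D as 1-stars,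
  which is the present number.
*)
theory Submission
  imports Defs
begin

text \<open>The relation \<open>exchange\<close> returns the connected components of a modified edge
  set and does not promise stars, so each operation must be shown to lead back to stars. A center
  map settles this because its edge set \<open>links\<close> determines the partition: it suffices
  to follow the effect of \<open>attach\<close> on fibers and links. The two ends of a 2-star cannot
  be told apart by their degrees, so a map must also agree with the designation there. A surviving
  2-star keeps its center; hence one designation, read off from the initial map, serves a whole run.

  The programs may depend neither on n nor on k. Therefore each iteration tests a fixed list of
  conditions for every pair of vertices. To avoid reasoning about \<open>exec\<close>, all inner
  loops run for exactly n rounds: the effect of a program is then a function, its cost is read from
  the syntax, and its nesting depth is the exponent of n. The word size follows from the running
  time, because one assignment raises the largest stored number by at most n + 4.\<close>

section \<open>Center maps and the stars that they describe\<close>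

definition star :: "'a set \<Rightarrow> ('a \<Rightarrow> 'a) \<Rightarrow> 'a \<Rightarrow> 'a set" where
  "star V c v = {u \<in> V. c u = c v}"

definition links :: "'a set \<Rightarrow> ('a \<Rightarrow> 'a) \<Rightarrow> 'a set set" where
  "links V c = {{v, c v} | v. v \<in> V \<and> c v \<noteq> v}"

definition star_graph :: "'a set \<Rightarrow> ('a \<Rightarrow> 'a) \<Rightarrow> 'a \<Rightarrow> 'a ugraph" where
  "star_graph V c v = (star V c v, {{u, c v} | u. u \<in> star V c v \<and> u \<noteq> c v})"

abbreviation part :: "'a set \<Rightarrow> ('a \<Rightarrow> 'a) \<Rightarrow> 'a ugraph set" where
  "part V c \<equiv> components V (links V c)"

definition singles :: "'a set \<Rightarrow> ('a \<Rightarrow> 'a) \<Rightarrow> 'a set" where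
  "singles V c = {v \<in> V. star V c v = {v}}"

lemma inj_on_edge: "inj_on (\<lambda>u. {u, x}) A"
  by (auto simp: inj_on_def doubleton_eq_iff)

locale bounded_graph =
  fixes k :: nat and V :: "'a set" and E :: "'a set set"
  assumes simple: "simple_graph (V, E)" and k4: "4 \<le> k"
begin

text \<open>Idempotence makes every value of \<open>c\<close> a fixed point, so the vertices with a
  common value are all joined to one of them and no longer chains of centers arise.\<close>

definition valid :: "('a \<Rightarrow> 'a) \<Rightarrow> bool" where
  "valid c \<longleftrightarrow> (\<forall>v\<in>V. c v \<in> V \<and> c (c v) = c v \<and> (c v \<noteq> v \<longrightarrow> {v, c v} \<in> E)
     \<and> card (star V c v) \<le> k)"

lemma finV: "finite V"
  using simple by (simp add: simple_graph_def)

lemma edgeD: "{u, v} \<in> E \<Longrightarrow> u \<in> V \<and> v \<in> V \<and> u \<noteq> v"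
  using simple by (fastforce simp: simple_graph_def)

lemma finite_star: "finite (star V c v)"
  using finV by (simp add: star_def)

lemma validD:
  assumes "valid c" "v \<in> V"
  shows "c v \<in> V" "c (c v) = c v" "c v \<noteq> v \<Longrightarrow> {v, c v} \<in> E" "card (star V c v) \<le> k"
  using assms by (auto simp: valid_def)

lemma star_self: "v \<in> V \<Longrightarrow> v \<in> star V c v"
  by (simp add: star_def)

lemma center_in_star: "valid c \<Longrightarrow> v \<in> V \<Longrightarrow> c v \<in> star V c v"
  by (simp add: star_def validD)

lemma star_eqI: "c u = c v \<Longrightarrow> star V c u = star V c v"
  by (simp add: star_def)

lemma star_eqD: "u \<in> V \<Longrightarrow> star V c u = star V c v \<Longrightarrow> c u = c v"
  by (auto simp: star_def)

text \<open>A link joins two vertices with the same center, so paths stay inside a star; conversely,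
  any two vertices of a star are connected through their center.\<close>

lemma reachable_iff:
  assumes "valid c" "u \<in> V"
  shows "v \<in> V \<and> (u, v) \<in> (adj_rel (links V c))\<^sup>* \<longleftrightarrow> v \<in> star V c u"
proof
  assume *: "v \<in> V \<and> (u, v) \<in> (adj_rel (links V c))\<^sup>*"
  have "c v = c u" using conjunct2[OF *]
  proof (induction rule: rtrancl_induct)
    case (step a b)
    then obtain x where "{a, b} = {x, c x}" "x \<in> V" by (auto simp: adj_rel_def links_def)
    then have "c a = c b" using assms(1) by (auto simp: doubleton_eq_iff validD)
    then show ?case using step by simp
  qed simp
  then show "v \<in> star V c u" using * by (simp add: star_def)
next
  assume *: "v \<in> star V c u"
  have to_center: "(x, c x) \<in> (adj_rel (links V c))\<^sup>* \<and> (c x, x) \<in> (adj_rel (links V c))\<^sup>*"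
    if "x \<in> V" for x
  proof (cases "c x = x")
    case False
    then have "{x, c x} \<in> links V c" "{c x, x} \<in> links V c"
      using that by (auto simp: links_def insert_commute)
    then show ?thesis by (auto simp: adj_rel_def)
  qed simp
  have "v \<in> V" "c v = c u" using * by (auto simp: star_def)
  then show "v \<in> V \<and> (u, v) \<in> (adj_rel (links V c))\<^sup>*"
    using to_center[OF assms(2)] to_center[of v] by (metis rtrancl_trans)
qed

lemma part_eq:
  assumes "valid c"
  shows "part V c = star_graph V c ` V"
proof -
  have C: "{v \<in> V. (u, v) \<in> (adj_rel (links V c))\<^sup>*} = star V c u" if "u \<in> V" for u
    using reachable_iff[OF assms that] by blast
  have D: "{e \<in> links V c. e \<subseteq> star V c u} = {{w, c u} | w. w \<in> star V c u \<and> w \<noteq> c u}" 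
    if "u \<in> V" for u
    using assms that by (fastforce simp: links_def star_def validD)
  show ?thesis
    unfolding components_def star_graph_def using C D by (auto simp: image_iff)
qed

lemma verts_star_graph [simp]: "verts (star_graph V c v) = star V c v"
  by (simp add: star_graph_def)

lemma union_edges_part:
  assumes "valid c" shows "(\<Union>S\<in>part V c. edges S) = links V c"
  unfolding part_eq[OF assms]
  using assms by (fastforce simp: star_graph_def links_def star_def validD)

lemma vdegree_star_graph:
  assumes "valid c" "v \<in> V" "u \<in> star V c v"
  shows "vdegree (star_graph V c v) u = (if u = c v then card (star V c v) - 1 else 1)"
proof (cases "u = c v")
  case True
  have "{e \<in> edges (star_graph V c v). u \<in> e} = (\<lambda>w. {w, c v}) ` (star V c v - {c v})"
    using True by (auto simp: star_graph_def)
  then show ?thesis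
    using True assms by (simp add: vdegree_def card_image inj_on_edge center_in_star finite_star)
next
  case False
  have "{e \<in> edges (star_graph V c v). u \<in> e} = {{u, c v}}"
    using False assms by (auto simp: star_graph_def)
  then show ?thesis using False by (simp add: vdegree_def)
qed

text \<open>Every edge contains the hub \<open>c v\<close>, but three consecutive edges of a cycle
  have no common vertex: the first two meet only in \<open>p ! 1\<close>, which the third
  avoids.\<close>

lemma no_cycle_star_graph: "\<not> gcycle (star_graph V c v) p"
proof
  assume "gcycle (star_graph V c v) p"
  then have len: "3 \<le> length p" and d: "distinct p"
    and e: "\<And>i. i < length p \<Longrightarrow> {p ! i, p ! (Suc i mod length p)} \<in> edges (star_graph V c v)"
    by (auto simp: gcycle_def)
  have hub: "c v \<in> {p ! i, p ! (Suc i mod length p)}" if "i < length p" for i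
    using e[OF that] by (auto simp: star_graph_def)
  have ne: "p ! i \<noteq> p ! j" if "i \<noteq> j" "i < length p" "j < length p" for i j
    using d that by (simp add: nth_eq_iff_index_eq)
  have 0: "c v \<in> {p ! 0, p ! 1}" and 1: "c v \<in> {p ! 1, p ! 2}"
    using hub[of 0] hub[of 1] len by (simp_all add: mod_less numeral_2_eq_2 del: length_0_conv length_greater_0_conv)
  have 3: "c v \<in> {p ! 2, p ! (3 mod length p)}"
    using hub[of 2] len by (simp add: numeral_3_eq_3)
  have lt: "3 mod length p < length p" using len by (intro mod_less_divisor) linarith
  \<comment> \<open>In a triangle the third edge closes up at position 0; in a longer cycle it leads
    on to position 3.\<close>
  have "3 mod length p = 0 \<or> 3 mod length p = 3" using len by (cases "length p = 3") auto
  then have n1: "3 mod length p \<noteq> 1" by auto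
  have "p ! 0 \<noteq> p ! 2" by (rule ne) (use len in auto)
  then have "c v = p ! 1" using 0 1 by (metis insertE singletonD)
  moreover have "p ! 1 \<noteq> p ! 2" by (rule ne) (use len in auto)
  moreover have "p ! 1 \<noteq> p ! (3 mod length p)" by (rule ne) (use len lt n1 in auto)
  ultimately show False using 3 by auto
qed

lemma star_in_star_graph:
  assumes "valid c" "v \<in> V"
  shows "star_in (V, E) (star_graph V c v)"
proof -
  let ?S = "star_graph V c v"
  have cv: "c v \<in> star V c v" by (rule center_in_star[OF assms])
  have sub: "subgraph ?S (V, E)"
    using assms cv by (auto simp: subgraph_def star_graph_def star_def) (metis validD(3))
  have "is_star ?S"
  proof (cases "card (star V c v) \<ge> 3")
    case True
    have reach: "(x, c v) \<in> (adj_rel (edges ?S))\<^sup>* \<and> (c v, x) \<in> (adj_rel (edges ?S))\<^sup>*"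
      if "x \<in> star V c v" for x
    proof (cases "x = c v")
      case False
      then have "{x, c v} \<in> edges ?S" "{c v, x} \<in> edges ?S"
        using that by (auto simp: star_graph_def insert_commute)
      then show ?thesis by (auto simp: adj_rel_def)
    qed simp
    have "gconnected ?S"
      unfolding gconnected_def using cv reach by (auto intro: rtrancl_trans)
    then have "tree ?S" by (simp add: tree_def no_cycle_star_graph)
    moreover have "2 \<le> vdegree ?S (c v)" "\<forall>u\<in>verts ?S - {c v}. vdegree ?S u = 1"
      using True cv by (auto simp: vdegree_star_graph assms)
    ultimately show ?thesis unfolding is_star_def using cv by auto
  next
    case False
    have "card (star V c v) > 0" using cv finite_star by (auto simp: card_gt_0_iff)
    then consider "card (star V c v) = 1" | "card (star V c v) = 2" using False by linarith
    then show ?thesis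
    proof cases
      case 1
      then have "star V c v = {c v}" using cv by (metis card_1_singletonE singletonD)
      then have "?S = ({c v}, {})" by (auto simp: star_graph_def)
      then show ?thesis unfolding is_star_def by blast
    next
      case 2
      then obtain x where "star V c v = {x, c v}" "x \<noteq> c v" using cv
        by (metis card_2_iff doubleton_eq_iff insertE singletonD)
      then have "?S = ({x, c v}, {{x, c v}})" "x \<noteq> c v" by (auto simp: star_graph_def)
      then show ?thesis unfolding is_star_def by blast
    qed
  qed
  with sub show ?thesis by (simp add: star_in_def)
qed

lemma star_partition_part:
  assumes "valid c" shows "star_partition k (V, E) (part V c)"
  unfolding star_partition_def part_eq[OF assms]
  using assms by (auto simp: star_in_star_graph validD star_self)
    (auto simp: star_def star_graph_def)

lemma num_1stars_part:
  assumes "valid c" shows "num_1stars (part V c) = card (singles V c)"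
proof -
  have "{S \<in> part V c. card (verts S) = 1} = star_graph V c ` singles V c"
    unfolding part_eq[OF assms] singles_def
    by (auto simp: image_iff card_1_singleton_iff) (metis singletonD star_self)
  moreover have "inj_on (star_graph V c) (singles V c)"
    by (auto simp: inj_on_def singles_def star_graph_def)
  ultimately show ?thesis by (simp add: num_1stars_def card_image)
qed

section \<open>Every star partition comes from a center map\<close>

text \<open>In the third shape, suppose that a vertex \<open>v\<close> of degree 1 is not joined to
  \<open>c\<close>. Its only neighbor \<open>x\<close> then differs from \<open>c\<close> and has
  degree 1 too, so the edge between them is a whole component and \<open>c\<close> cannot be reached
  from \<open>v\<close>.\<close>

lemma star_in_shape:
  assumes "star_in (V, E) S" "designation \<delta>"
  shows "\<exists>c\<in>verts S. edges S = {{u, c} | u. u \<in> verts S \<and> u \<noteq> c} \<and> (card (verts S) = 2 \<longrightarrow> c = \<delta> (verts S))"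
proof -
  have sub: "subgraph S (V, E)" and st: "is_star S" using assms by (auto simp: star_in_def)
  have ed: "e \<subseteq> verts S \<and> card e = 2" if "e \<in> edges S" for e
    using sub simple that by (auto simp: subgraph_def simple_graph_def)
  from st consider (one) v where "S = ({v}, {})"
    | (two) u v where "u \<noteq> v" "S = ({u, v}, {{u, v}})"
    | (more) c where "tree S" "c \<in> verts S" "2 \<le> vdegree S c" "\<forall>v\<in>verts S - {c}. vdegree S v = 1"
    unfolding is_star_def by blast
  then show ?thesis
  proof cases
    case one
    then show ?thesis by auto
  next
    case two
    have "card {u, v} = 2" using two by simp
    then have "\<delta> {u, v} \<in> {u, v}" using assms(2) unfolding designation_def by blast
    then show ?thesis using two by (auto simp: insert_commute)
  next
    case more
    have uniq: "\<exists>e. {e \<in> edges S. v \<in> e} = {e}" if "v \<in> verts S" "v \<noteq> c" for v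
      using more(4) that by (simp add: vdegree_def card_1_singleton_iff)
    have finE: "finite (edges S)"
    proof (rule finite_subset)
      show "edges S \<subseteq> Pow V" using sub simple by (auto simp: subgraph_def simple_graph_def)
    qed (simp add: finV)
    have adj: "{v, c} \<in> edges S" if v: "v \<in> verts S" "v \<noteq> c" for v
    proof (rule ccontr)
      assume non: "{v, c} \<notin> edges S"
      obtain e where e: "{e \<in> edges S. v \<in> e} = {e}" using uniq[OF v] by blast
      then have "e \<in> edges S" "v \<in> e" by auto
      then obtain x where x: "e = {v, x}" "x \<noteq> v" using ed[of e]
        by (metis card_2_iff doubleton_eq_iff insert_iff singletonD)
      then have xS: "x \<in> verts S" "x \<noteq> c" using ed \<open>e \<in> edges S\<close> non by auto
      obtain e' where e': "{e \<in> edges S. x \<in> e} = {e'}" using uniq[OF xS] by blast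
      have "e \<in> {e'}" unfolding e'[symmetric] using x(1) \<open>e \<in> edges S\<close> by simp
      then have "e' = e" by simp
      have closed: "b \<in> {v, x}" if "(a, b) \<in> adj_rel (edges S)" "a \<in> {v, x}" for a b
      proof -
        have "{a, b} \<in> edges S" using that by (simp add: adj_rel_def)
        then have "{a, b} \<in> {e \<in> edges S. v \<in> e} \<or> {a, b} \<in> {e \<in> edges S. x \<in> e}"
          using that(2) by auto
        then have "b \<in> e" unfolding e e' \<open>e' = e\<close> by auto
        then show ?thesis using x by simp
      qed
      have "b \<in> {v, x}" if "(v, b) \<in> (adj_rel (edges S))\<^sup>*" for b
        using that by (induction rule: rtrancl_induct) (use closed in blast)+
      then have "(v, c) \<notin> (adj_rel (edges S))\<^sup>*" using v(2) xS(2) by blast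
      then show False using more(1,2) v(1) by (auto simp: tree_def gconnected_def)
    qed
    have "edges S = {{u, c} | u. u \<in> verts S \<and> u \<noteq> c}"
    proof (intro set_eqI iffI)
      fix e assume eS: "e \<in> edges S"
      then have "card e = 2" "e \<subseteq> verts S" using ed by auto
      then obtain a where a: "a \<in> e" "a \<noteq> c" "a \<in> verts S"
        by (metis card_2_iff insertI1 insertI2 subsetD)
      obtain e0 where "{e \<in> edges S. a \<in> e} = {e0}" using uniq[OF a(3,2)] by blast
      moreover have "e \<in> {e \<in> edges S. a \<in> e}" "{a, c} \<in> {e \<in> edges S. a \<in> e}"
        using adj[OF a(3,2)] eS a(1) by simp_all
      ultimately have "e = e0" "{a, c} = e0" by simp_all
      then have "e = {a, c}" by simp
      then show "e \<in> {{u, c} | u. u \<in> verts S \<and> u \<noteq> c}" using a by blast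
    qed (use adj in auto)
    \<comment> \<open>Degree at least 2 at \<open>c\<close> forces a third vertex, so the center
      prescribed by \<delta> concerns only the single-edge shape.\<close>
    moreover have "card (verts S) \<noteq> 2"
    proof
      assume "card (verts S) = 2"
      then obtain x where x: "verts S = {x, c}" "x \<noteq> c" using more(2)
        by (metis card_2_iff doubleton_eq_iff insertE singletonD)
      then have "{e \<in> edges S. c \<in> e} \<subseteq> {{x, c}}" using calculation by auto
      then have "vdegree S c \<le> card {{x, c}}" unfolding vdegree_def by (intro card_mono) auto
      then show False using more(3) by simp
    qed
    ultimately show ?thesis using more(2) by blast
  qed
qed

text \<open>A 2-star is described by two maps, one for each choice of center. The one that follows
  \<delta> is the one whose values are the vertices satisfying \<open>is_center\<close>.\<close>

definition designated :: "('a set \<Rightarrow> 'a) \<Rightarrow> ('a \<Rightarrow> 'a) \<Rightarrow> bool" where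
  "designated \<delta> c \<longleftrightarrow> (\<forall>v\<in>V. card (star V c v) = 2 \<longrightarrow> c v = \<delta> (star V c v))"

text \<open>Disjointness and covering turn the star that contains a vertex into the function
  \<open>st\<close>; composing it with a chosen center gives the map.\<close>

lemma star_partition_center_map:
  assumes P: "star_partition k (V, E) P" and "designation \<delta>"
  obtains c where "valid c" "designated \<delta> c" "P = part V c"
proof -
  have Pst: "star_in (V, E) S" "card (verts S) \<le> k" if "S \<in> P" for S
    using P that by (auto simp: star_partition_def)
  have disj: "S = T" if "S \<in> P" "T \<in> P" "v \<in> verts S" "v \<in> verts T" for S T v
    using P that unfolding star_partition_def by blast
  have cover: "(\<Union>S\<in>P. verts S) = V" using P by (simp add: star_partition_def)
  define C where "C S = (SOME c. c \<in> verts S \<and> edges S = {{u, c} | u. u \<in> verts S \<and> u \<noteq> c} \<and>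
     (card (verts S) = 2 \<longrightarrow> c = \<delta> (verts S)))" for S
  have C: "C S \<in> verts S \<and> edges S = {{u, C S} | u. u \<in> verts S \<and> u \<noteq> C S} \<and>
     (card (verts S) = 2 \<longrightarrow> C S = \<delta> (verts S))" if "S \<in> P" for S
    using star_in_shape[OF Pst(1)[OF that] assms(2), unfolded Bex_def, THEN someI_ex]
    by (fold C_def) 
  define st where "st v = (THE S. S \<in> P \<and> v \<in> verts S)" for v
  have st_eq: "st v = S" if "S \<in> P" "v \<in> verts S" for v S
    unfolding st_def by (rule the_equality) (use that disj in blast)+
  define c where "c v = C (st v)" for v
  have c_eq: "c v = C S" if "S \<in> P" "v \<in> verts S" for v S
    using st_eq[OF that] by (simp add: c_def)
  have star_eq: "star V c v = verts S" if S: "S \<in> P" and v: "v \<in> verts S" for v S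
  proof
    show "star V c v \<subseteq> verts S"
    proof
      fix u assume "u \<in> star V c v"
      then have u: "u \<in> V" "c u = c v" by (auto simp: star_def)
      then obtain T where T: "T \<in> P" "u \<in> verts T" using cover by blast
      then have "C T = C S" using u c_eq[OF T] c_eq[OF S v] by simp
      then have "T = S" using disj[OF T(1) S, of "C S"] C[OF T(1)] C[OF S] by simp
      then show "u \<in> verts S" using T by simp
    qed
    show "verts S \<subseteq> star V c v"
      using S v c_eq[OF S] cover by (auto simp: star_def)
  qed
  have valid: "valid c"
    unfolding valid_def
  proof
    fix v assume "v \<in> V"
    then obtain S where S: "S \<in> P" "v \<in> verts S" using cover by blast
    have "edges S \<subseteq> E" using Pst(1)[OF S(1)] by (simp add: star_in_def subgraph_def)
    moreover have "{v, C S} \<in> edges S" if "C S \<noteq> v" using C[OF S(1)] S that by auto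
    moreover have "C S \<in> V" using C[OF S(1)] S cover by blast
    ultimately show "c v \<in> V \<and> c (c v) = c v \<and> (c v \<noteq> v \<longrightarrow> {v, c v} \<in> E) \<and> card (star V c v) \<le> k"
      using c_eq[OF S] c_eq[OF S(1), of "C S"] C[OF S(1)] star_eq[OF S] Pst(2)[OF S(1)] by auto
  qed
  \<comment> \<open>Equal partitions need equal edge sets as well; these agree because a star is
    determined by its vertex set and its center.\<close>
  have graph_eq: "star_graph V c v = S" if S: "S \<in> P" and v: "v \<in> verts S" for v S
    using C[OF S] star_eq[OF S v] c_eq[OF S v] by (auto simp: star_graph_def prod_eq_iff)
  have "P = part V c"
    unfolding part_eq[OF valid]
  proof (intro set_eqI iffI)
    fix S assume S: "S \<in> P"
    then have "C S \<in> verts S" "C S \<in> V" using C[OF S] cover by auto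
    then show "S \<in> star_graph V c ` V" using graph_eq[OF S, of "C S"] by force
  next
    fix S assume "S \<in> star_graph V c ` V"
    then show "S \<in> P" using graph_eq cover by blast
  qed
  moreover have "designated \<delta> c"
    unfolding designated_def
  proof (intro ballI impI)
    fix v assume v: "v \<in> V" "card (star V c v) = 2"
    then obtain S where S: "S \<in> P" "v \<in> verts S" using cover by blast
    then show "c v = \<delta> (star V c v)" using v star_eq[OF S] C[OF S(1)] c_eq[OF S] by simp
  qed
  ultimately show thesis using that valid by blast
qed

end

section \<open>Attaching a vertex to a star\<close>

text \<open>If \<open>w\<close> is already a center, the first two assignments change nothing. If
  \<open>w\<close> is the satellite of a 2-star, they exchange the roles of its two vertices. Being
  free of case distinctions, the same three writes serve as a program.\<close>

fun attach :: "'a \<times> 'a \<Rightarrow> ('a \<Rightarrow> 'a) \<Rightarrow> 'a \<Rightarrow> 'a" where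
  "attach (v, w) c = c(c w := w, w := w, v := w)"

declare attach.simps [simp del]

context bounded_graph
begin

text \<open>A center may leave only if it is a 1-star, since its satellites would lose their center
  otherwise. The target \<open>w\<close> must be able to act as center: it is one already, or it
  lies in a 2-star, where the roles can be exchanged.\<close>

definition attachable :: "('a \<Rightarrow> 'a) \<Rightarrow> 'a \<Rightarrow> 'a \<Rightarrow> bool" where
  "attachable c v w \<longleftrightarrow> v \<in> V \<and> w \<in> V \<and> {v, w} \<in> E \<and> c v \<noteq> c w \<and>
     (c v = v \<longrightarrow> star V c v = {v}) \<and> (c w = w \<or> card (star V c w) = 2) \<and>
     card (star V c w) < k"

lemma card2_star:
  assumes "valid c" "w \<in> V" "card (star V c w) = 2" "c w \<noteq> w"
  shows "star V c w = {w, c w}"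
proof -
  have "{w, c w} \<subseteq> star V c w" using assms by (simp add: star_self center_in_star)
  then show ?thesis using assms by (intro card_seteq[symmetric]) (auto simp: finite_star)
qed

lemma attach_apply:
  assumes "valid c" "attachable c v w" "x \<in> V"
  shows "attach (v, w) c x = (if x = v \<or> x \<in> star V c w then w else c x)"
proof -
  have w: "w \<in> V" "c w = w \<or> card (star V c w) = 2" using assms by (auto simp: attachable_def)
  show ?thesis
  proof (cases "c w = w")
    case True
    then show ?thesis using w assms(3) by (auto simp: star_def attach.simps)
  next
    case False
    then have "star V c w = {w, c w}" using w card2_star[OF assms(1)] by blast
    then show ?thesis by (auto simp: attach.simps)
  qed
qed

lemma star_attach:
  assumes "valid c" "attachable c v w" "x \<in> V"
  shows "star V (attach (v, w) c) x =
    (if x = v \<or> x \<in> star V c w then insert v (star V c w) else star V c x - {v})"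
proof -
  note app = attach_apply[OF assms(1,2)]
  have vw: "v \<in> V" "w \<in> V" using assms(2) by (auto simp: attachable_def)
  have out: "c y \<noteq> w" if "y \<in> V" "y \<notin> star V c w" for y
  proof
    assume "c y = w"
    then have "c w = c y" using validD(2)[OF assms(1) that(1)] by simp
    then show False using that by (simp add: star_def)
  qed
  show ?thesis
  proof (cases "x = v \<or> x \<in> star V c w")
    case True
    have "star V (attach (v, w) c) x = {u \<in> V. attach (v, w) c u = w}"
      using app[OF assms(3)] True by (auto simp: star_def)
    also have "\<dots> = {u \<in> V. u = v \<or> u \<in> star V c w}"
      using app out by (intro Collect_cong) (auto split: if_splits)
    finally show ?thesis using True vw by (auto simp: star_def)
  next
    case False
    have "star V (attach (v, w) c) x = {u \<in> V. attach (v, w) c u = c x}"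
      using app[OF assms(3)] False by (auto simp: star_def)
    also have "\<dots> = {u \<in> V. u \<noteq> v \<and> c u = c x}"
      using app out[OF assms(3)] False assms(3)
      by (intro Collect_cong) (auto simp: star_def split: if_splits)
    finally show ?thesis using False by (auto simp: star_def)
  qed
qed

lemma attachable_notin: "attachable c v w \<Longrightarrow> v \<notin> star V c w"
  by (auto simp: attachable_def star_def)

text \<open>A vertex that stays in place keeps a legal center: \<open>v\<close> is not the center of
  any other vertex, and the center of a vertex outside the star of \<open>w\<close> is outside as
  well.\<close>

lemma center_ne:
  assumes "valid c" "attachable c v w" "x \<in> V" "x \<noteq> v" "x \<notin> star V c w"
  shows "c x \<noteq> v" "c x \<notin> star V c w"
proof -
  have cx: "c (c x) = c x" using validD(2)[OF assms(1,3)] .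
  show "c x \<noteq> v"
  proof
    assume "c x = v"
    then have "star V c v = {v}" "x \<in> star V c v" using cx assms by (auto simp: attachable_def star_def)
    then show False using assms by simp
  qed
  show "c x \<notin> star V c w" using assms cx by (auto simp: star_def)
qed

lemma valid_attach:
  assumes "valid c" "attachable c v w"
  shows "valid (attach (v, w) c)"
  unfolding valid_def
proof
  fix x assume x: "x \<in> V"
  note app = attach_apply[OF assms] and st = star_attach[OF assms x]
  have vw: "v \<in> V" "w \<in> V" "{v, w} \<in> E" "card (star V c w) < k" "c w = w \<or> card (star V c w) = 2"
    using assms(2) by (auto simp: attachable_def)
  let ?c = "attach (v, w) c"
  have cx: "c x \<in> V" "c (c x) = c x" using validD[OF assms(1) x] by auto
  show "?c x \<in> V \<and> ?c (?c x) = ?c x \<and> (?c x \<noteq> x \<longrightarrow> {x, ?c x} \<in> E) \<and> card (star V ?c x) \<le> k"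
  proof (cases "x = v \<or> x \<in> star V c w")
    case True
    have "{x, w} \<in> E" if "x \<in> star V c w" "x \<noteq> w"
    proof (cases "c w = w")
      case False
      then have "x = c w" using that card2_star[OF assms(1) vw(2)] vw by auto
      then show ?thesis using validD(3)[OF assms(1) vw(2)] that by (simp add: insert_commute)
    next
      case True
      then show ?thesis using that validD(3)[OF assms(1) x] by (auto simp: star_def)
    qed
    then show ?thesis
      using True vw st app[OF x] app[OF vw(2)] star_self[OF vw(2)] finite_star
      by (auto simp: card_insert_if)
  next
    case False
    have "card (star V c x - {v}) \<le> card (star V c x)" by (simp add: card_mono finite_star)
    then show ?thesis
      using False x cx app[OF x] app[OF cx(1)] center_ne[OF assms x] st validD(3,4)[OF assms(1) x]
      by auto
  qed
qed

text \<open>If \<open>v\<close> is a 1-star, then \<open>{v, c v}\<close> is the singleton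
  \<open>{v}\<close>, which is not a link, and nothing is removed; one formula covers both
  cases.\<close>

lemma links_attach:
  assumes "valid c" "attachable c v w"
  shows "links V (attach (v, w) c) = links V c - {{v, c v}} \<union> {{v, w}}"
proof -
  note app = attach_apply[OF assms]
  have vw: "v \<in> V" "w \<in> V" "c w = w \<or> card (star V c w) = 2" "c v \<noteq> c w"
    using assms(2) by (auto simp: attachable_def)
  have v_notin: "v \<notin> star V c w" by (rule attachable_notin[OF assms(2)])
  have split: "links V c - {{v, c v}} = {{x, c x} | x. x \<in> V \<and> x \<noteq> v \<and> x \<notin> star V c w \<and> c x \<noteq> x}
      \<union> {{x, c x} | x. x \<in> star V c w \<and> c x \<noteq> x}"
    (is "_ = ?A \<union> ?B")
  proof (intro set_eqI iffI)
    fix e assume "e \<in> links V c - {{v, c v}}"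
    then obtain x where "x \<in> V" "e = {x, c x}" "c x \<noteq> x" "x \<noteq> v" by (auto simp: links_def)
    then show "e \<in> ?A \<union> ?B" by (cases "x \<in> star V c w") auto
  next
    fix e assume "e \<in> ?A \<union> ?B"
    then obtain x where x: "e = {x, c x}" "c x \<noteq> x" "x \<in> V" "x \<noteq> v" "c x \<noteq> v"
    proof (elim UnE CollectE exE conjE)
      fix x assume x: "e = {x, c x}" "x \<in> V" "x \<noteq> v" "x \<notin> star V c w" "c x \<noteq> x"
      show thesis by (rule that[of x]) (use x center_ne(1)[OF assms x(2-4)] in simp_all)
    next
      fix x assume x: "e = {x, c x}" "x \<in> star V c w" "c x \<noteq> x"
      have "x \<in> V" "c x = c w" using x(2) by (auto simp: star_def)
      moreover have "x \<noteq> v" "c w \<noteq> v"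
        using x(2) v_notin center_in_star[OF assms(1) vw(2)] by metis+
      ultimately have "c x \<noteq> v" by metis
      show thesis by (rule that[OF x(1,3) \<open>x \<in> V\<close> \<open>x \<noteq> v\<close> \<open>c x \<noteq> v\<close>])
    qed
    then have "v \<notin> e" by simp
    then show "e \<in> links V c - {{v, c v}}" using x by (auto simp: links_def)
  qed
  \<comment> \<open>Exchanging the roles in a 2-star keeps its only edge, so within the star of
    \<open>w\<close> the old links already are those of a star centered at \<open>w\<close>.\<close>
  have in_w: "{{x, c x} | x. x \<in> star V c w \<and> c x \<noteq> x} = {{x, w} | x. x \<in> star V c w \<and> x \<noteq> w}"
  proof (cases "c w = w")
    case True
    then have "c x = w" if "x \<in> star V c w" for x using that by (simp add: star_def)
    then show ?thesis by (intro Collect_cong ex_cong1) auto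
  next
    case False
    then have st: "star V c w = {w, c w}" using vw card2_star[OF assms(1)] by blast
    show ?thesis using False validD(2)[OF assms(1) vw(2)] unfolding st by (auto simp: insert_commute)
  qed
  have "links V (attach (v, w) c) =
     {{x, c x} | x. x \<in> V \<and> x \<noteq> v \<and> x \<notin> star V c w \<and> c x \<noteq> x}
      \<union> {{x, w} | x. x \<in> star V c w \<and> x \<noteq> w} \<union> {{v, w}}"
    (is "_ = ?A \<union> ?B \<union> ?C")
  proof (intro set_eqI iffI)
    fix e assume "e \<in> links V (attach (v, w) c)"
    then obtain x where x: "x \<in> V" "attach (v, w) c x \<noteq> x" "e = {x, attach (v, w) c x}"
      by (auto simp: links_def)
    show "e \<in> ?A \<union> ?B \<union> ?C"
      using x app[OF x(1)] by (cases "x = v"; cases "x \<in> star V c w") auto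
  next
    fix e assume "e \<in> ?A \<union> ?B \<union> ?C"
    then obtain x where "x \<in> V" "attach (v, w) c x \<noteq> x" "e = {x, attach (v, w) c x}"
    proof (elim UnE CollectE exE conjE)
      fix x assume x: "e = {x, c x}" "x \<in> V" "x \<noteq> v" "x \<notin> star V c w" "c x \<noteq> x"
      show thesis by (rule that[of x]) (use x app[OF x(2)] in simp_all)
    next
      fix x assume x: "e = {x, w}" "x \<in> star V c w" "x \<noteq> w"
      then have xV: "x \<in> V" by (simp add: star_def)
      show thesis by (rule that[of x]) (use x xV app[OF xV] in simp_all)
    next
      assume e: "e \<in> ?C"
      have "w \<noteq> v" using v_notin star_self[OF vw(2)] by auto
      then show thesis by (intro that[of v]) (use e app[OF vw(1)] vw in simp_all)
    qed
    then show "e \<in> links V (attach (v, w) c)" by (auto simp: links_def)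
  qed
  then show ?thesis using split in_w by simp
qed

definition centers :: "('a \<Rightarrow> 'a) \<Rightarrow> 'a set" where
  "centers c = {v \<in> V. c v = v}"

definition pairs :: "('a \<Rightarrow> 'a) \<Rightarrow> 'a set" where
  "pairs c = {v \<in> V. card (star V c v) = 2}"

text \<open>In the star of \<open>w\<close> the center \<open>c w\<close> is replaced by
  \<open>w\<close>, and \<open>v\<close> is no center afterwards. So no star is added, and the star
  \<open>{v}\<close> vanishes if there was one.\<close>

lemma centers_attach:
  assumes "valid c" "attachable c v w"
  shows "card (centers (attach (v, w) c)) \<le> card (centers c)"
    and "c v = v \<Longrightarrow> card (centers (attach (v, w) c)) < card (centers c)"
proof -
  note app = attach_apply[OF assms]
  have vw: "v \<in> V" "w \<in> V" "c v \<noteq> c w" using assms(2) by (auto simp: attachable_def)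
  have fin: "finite (centers c)" using finV by (simp add: centers_def)
  have cw: "c w \<in> centers c" using validD[OF assms(1) vw(2)] by (simp add: centers_def)
  have eq: "centers (attach (v, w) c) = insert w (centers c - {v, c w})"
  proof (intro set_eqI iffI)
    fix x assume "x \<in> centers (attach (v, w) c)"
    then have x: "x \<in> V" "attach (v, w) c x = x" by (auto simp: centers_def)
    then show "x \<in> insert w (centers c - {v, c w})"
      using app[OF x(1)] center_in_star[OF assms(1) vw(2)] by (auto simp: centers_def split: if_splits)
  next
    fix x assume "x \<in> insert w (centers c - {v, c w})"
    then show "x \<in> centers (attach (v, w) c)"
      using app vw star_self[OF vw(2)] by (auto simp: centers_def star_def)
  qed
  have w: "w \<notin> centers c - {v, c w}" by (auto simp: centers_def)
  have "c w \<noteq> v" if "c v = v" using that vw by auto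
  then have card: "card (centers c - {v, c w}) = card (centers c) - (if c v = v then 2 else 1)"
    using cw vw fin by (auto simp: centers_def card_Diff_subset card_insert_if)
  have "card (centers c) \<ge> (if c v = v then 2 else 1)"
    using cw vw fin card_mono[OF fin, of "{v, c w}"] by (auto simp: centers_def card_gt_0_iff Suc_le_eq)
  then show "card (centers (attach (v, w) c)) \<le> card (centers c)"
    "c v = v \<Longrightarrow> card (centers (attach (v, w) c)) < card (centers c)"
    using w card fin by (auto simp: eq card_insert_if split: if_splits)
qed


lemma finite_pairs: "finite (pairs c)"
  using finV by (simp add: pairs_def)

section \<open>Simultaneous attachments\<close>

text \<open>All conditions refer to the original map \<open>c\<close>. No source star is a target
  star and the target stars are distinct, so earlier attachments leave each later target untouched.
  The last clause lets a center leave only after all its satellites.\<close>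

definition parallel :: "('a \<Rightarrow> 'a) \<Rightarrow> ('a \<times> 'a) list \<Rightarrow> bool" where
  "parallel c L \<longleftrightarrow> distinct (map fst L) \<and> distinct (map (c \<circ> snd) L) \<and>
     (\<forall>v w. (v, w) \<in> set L \<longrightarrow> v \<in> V \<and> w \<in> V \<and> {v, w} \<in> E \<and>
        (c w = w \<or> card (star V c w) = 2) \<and> card (star V c w) < k) \<and>
     (\<forall>v w v' w'. (v, w) \<in> set L \<longrightarrow> (v', w') \<in> set L \<longrightarrow> c v' \<noteq> c w) \<and>
     (\<forall>L1 v w L2. L = L1 @ (v, w) # L2 \<longrightarrow> c v = v \<longrightarrow> star V c v \<subseteq> insert v (fst ` set L1))"

lemma parallelD:
  assumes "parallel c L"
  shows "distinct (map fst L)" "distinct (map (c \<circ> snd) L)"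
    and "(v, w) \<in> set L \<Longrightarrow> v \<in> V \<and> w \<in> V \<and> {v, w} \<in> E \<and>
        (c w = w \<or> card (star V c w) = 2) \<and> card (star V c w) < k"
    and "(v1, w1) \<in> set L \<Longrightarrow> (v2, w2) \<in> set L \<Longrightarrow> c v2 \<noteq> c w1"
    and "L = L1 @ (v, w) # L2 \<Longrightarrow> c v = v \<Longrightarrow> star V c v \<subseteq> insert v (fst ` set L1)"
  using assms unfolding parallel_def by blast+

text \<open>Induction over the last pair. When it is processed, the star of \<open>w\<close> is
  still that of \<open>c\<close>, and the star of \<open>v\<close> has only lost earlier sources;
  these two facts make the pair \<open>attachable\<close>.\<close>

lemma fold_attach_parallel:
  assumes "valid c" "parallel c L"
  defines "c' \<equiv> fold attach L c"
  shows "valid c'" (is ?A)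
    and "\<forall>(v, w)\<in>set L. \<forall>x\<in>insert v (star V c w). c' x = w \<and> star V c' x = insert v (star V c w)" (is ?B)
    and "\<forall>x\<in>V. x \<notin> fst ` set L \<longrightarrow> c x \<notin> (c \<circ> snd) ` set L \<longrightarrow>
       c' x = c x \<and> star V c' x = star V c x - fst ` set L" (is ?C)
    and "links V c' = links V c - (\<lambda>v. {v, c v}) ` fst ` set L \<union> (\<lambda>(v, w). {v, w}) ` set L" (is ?D)
    and "card (centers c') \<le> card (centers c)" (is ?E)
    and "(\<exists>v\<in>fst ` set L. c v = v) \<Longrightarrow> card (centers c') < card (centers c)"
proof -
  have main: "?A \<and> ?B \<and> ?C \<and> ?D \<and> ?E \<and> ((\<exists>v\<in>fst ` set L. c v = v) \<longrightarrow> card (centers c') < card (centers c))"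
    unfolding c'_def using assms(2)
  proof (induction L rule: rev_induct)
    case Nil
    then show ?case using assms(1) by auto
  next
    case (snoc vw L)
    obtain v w where vw [simp]: "vw = (v, w)" by (cases vw)
    have par: "parallel c L"
      using snoc.prems unfolding parallel_def by auto
    define c1 where "c1 = fold attach L c"
    note IH = snoc.IH[OF par, folded c1_def]
    have A: "valid c1" using IH by (elim conjE)
    have "\<forall>(v, w)\<in>set L. \<forall>x\<in>insert v (star V c w). c1 x = w \<and> star V c1 x = insert v (star V c w)"
      using IH by (elim conjE)
    from bspec[OF this] have B: "\<And>v w x. (v, w) \<in> set L \<Longrightarrow> x \<in> insert v (star V c w) \<Longrightarrow>
          c1 x = w \<and> star V c1 x = insert v (star V c w)"
      by fastforce
    have "\<forall>x\<in>V. x \<notin> fst ` set L \<longrightarrow> c x \<notin> (c \<circ> snd) ` set L \<longrightarrow>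
       c1 x = c x \<and> star V c1 x = star V c x - fst ` set L" using IH by (elim conjE)
    then have C: "\<And>x. x \<in> V \<Longrightarrow> x \<notin> fst ` set L \<Longrightarrow> c x \<notin> (c \<circ> snd) ` set L \<Longrightarrow>
          c1 x = c x \<and> star V c1 x = star V c x - fst ` set L"
      by simp
    have D: "links V c1 = links V c - (\<lambda>v. {v, c v}) ` fst ` set L \<union> (\<lambda>(v, w). {v, w}) ` set L"
      using IH by (elim conjE)
    have E: "card (centers c1) \<le> card (centers c)" using IH by (elim conjE)
    have F: "\<exists>v\<in>fst ` set L. c v = v \<Longrightarrow> card (centers c1) < card (centers c)"
      using IH by (elim conjE) simp
    have "distinct (map fst (L @ [(v, w)]))" "distinct (map (c \<circ> snd) (L @ [(v, w)]))"
      and vw_in: "\<And>v' w'. (v', w') \<in> set (L @ [(v, w)]) \<Longrightarrow> v' \<in> V \<and> w' \<in> V \<and> {v', w'} \<in> E \<and>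
        (c w' = w' \<or> card (star V c w') = 2) \<and> card (star V c w') < k"
      and sep: "\<And>v1 w1 v2 w2. (v1, w1) \<in> set (L @ [(v, w)]) \<Longrightarrow> (v2, w2) \<in> set (L @ [(v, w)]) \<Longrightarrow> c v2 \<noteq> c w1"
      and last: "c v = v \<Longrightarrow> star V c v \<subseteq> insert v (fst ` set L)"
      using parallelD[OF snoc.prems[unfolded vw]] by (blast, blast, blast, blast, blast)
    then have v: "v \<in> V" "v \<notin> fst ` set L" "c v = v \<Longrightarrow> star V c v \<subseteq> insert v (fst ` set L)"
      and w: "w \<in> V" "{v, w} \<in> E" "c w = w \<or> card (star V c w) = 2" "card (star V c w) < k"
         "c w \<notin> (c \<circ> snd) ` set L" "c v \<noteq> c w"
      using vw_in[of v w] sep[of v w v w] by simp_all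
    have Lv: "c v' \<noteq> c w \<and> c v \<noteq> c w'" if "(v', w') \<in> set L" for v' w'
      using sep[of v' w' v w] sep[of v w v' w'] that by simp
    have cv: "c1 v = c v" "star V c1 v = star V c v - fst ` set L"
    proof -
      have "c v \<notin> (c \<circ> snd) ` set L" using Lv by (metis comp_apply imageE prod.collapse)
      then show "c1 v = c v" "star V c1 v = star V c v - fst ` set L" using C[OF v(1,2)] by simp_all
    qed
    have cw: "c1 w = c w" "star V c1 w = star V c w"
    proof -
      have fL: "c v' \<noteq> c w" if "v' \<in> fst ` set L" for v' using that Lv by (metis imageE prod.collapse)
      then have "w \<notin> fst ` set L" by metis
      moreover have "star V c w - fst ` set L = star V c w" using fL by (fastforce simp: star_def)
      ultimately show "c1 w = c w" "star V c1 w = star V c w" using C[OF w(1) _ w(5)] by simp_all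
    qed
    have att: "attachable c1 v w"
    proof -
      \<comment> \<open>If \<open>v\<close> is a center, the order of the list guarantees that
        \<open>v\<close> is alone in its star by now.\<close>
      have "star V c1 v = {v}" if "c1 v = v"
      proof -
        have "star V c v \<subseteq> insert v (fst ` set L)" using that v(3) cv(1) by simp
        then show ?thesis using cv(2) star_self[OF v(1), of c1] by blast
      qed
      then show ?thesis unfolding attachable_def using v(1) w(1,2,3,4,6) cv(1) cw by simp
    qed
    note app = attach_apply[OF A att] and st = star_attach[OF A att]
    have fold: "fold attach (L @ [vw]) c = attach (v, w) c1" by (simp add: c1_def)
    have S1: "\<forall>x\<in>insert v' (star V c w'). attach (v, w) c1 x = w' \<and>
        star V (attach (v, w) c1) x = insert v' (star V c w')" if "(v', w') \<in> set (L @ [vw])" for v' w'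
    proof (cases "(v', w') \<in> set L")
      case True
      show ?thesis
      proof
        fix x assume x: "x \<in> insert v' (star V c w')"
        have "v' \<in> V" using vw_in[of v' w'] True by simp
        then have xV: "x \<in> V" using x by (auto simp: star_def)
        have ne: "v \<notin> insert v' (star V c w')"
          using True v(2) Lv[OF True] by (force simp: star_def)
        have "c w' \<noteq> c w" using w(5) True by force
        then have "x \<notin> star V c w" using x Lv[OF True] by (auto simp: star_def)
        then show "attach (v, w) c1 x = w' \<and> star V (attach (v, w) c1) x = insert v' (star V c w')"
          using B[OF True x] app[OF xV] st[OF xV] ne x cw by auto
      qed
    next
      case False
      then have "v' = v" "w' = w" using that by auto
      show ?thesis unfolding \<open>v' = v\<close> \<open>w' = w\<close>
      proof
        fix x assume x: "x \<in> insert v (star V c w)"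
        then have "x \<in> V" using v(1) by (auto simp: star_def)
        then show "attach (v, w) c1 x = w \<and> star V (attach (v, w) c1) x = insert v (star V c w)"
          using app[of x] st[of x] x cw by auto
      qed
    qed
    have S2: "attach (v, w) c1 x = c x \<and>
        star V (attach (v, w) c1) x = star V c x - fst ` set (L @ [vw])"
      if x: "x \<in> V" "x \<notin> fst ` set (L @ [vw])" "c x \<notin> (c \<circ> snd) ` set (L @ [vw])" for x
    proof -
      have "x \<notin> star V c w" "x \<noteq> v" using x by (auto simp: star_def)
      then show ?thesis using C[of x] x app[OF x(1)] st[OF x(1)] cw by auto
    qed
    have S3: "links V (attach (v, w) c1) =
       links V c - (\<lambda>v. {v, c v}) ` fst ` set (L @ [vw]) \<union> (\<lambda>(v, w). {v, w}) ` set (L @ [vw])"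
    proof -
      \<comment> \<open>The edge to be deleted must not be one that an earlier pair has added:
        otherwise \<open>v\<close> would be a target, but source and target stars are
        different.\<close>
      have "{v, c v} \<noteq> {v', w'}" if "(v', w') \<in> set L" for v' w'
      proof
        assume "{v, c v} = {v', w'}"
        moreover have "v \<noteq> v'" using v(2) that by force
        ultimately have "v = w'" by auto
        then show False using Lv[OF that] by simp
      qed
      then have "{v, c v} \<notin> (\<lambda>(v, w). {v, w}) ` set L" by auto
      then show ?thesis unfolding links_attach[OF A att] D cv(1) by auto
    qed
    have S4: "card (centers (attach (v, w) c1)) \<le> card (centers c)"
      using centers_attach(1)[OF A att] E by simp
    have S5: "card (centers (attach (v, w) c1)) < card (centers c)"
      if "\<exists>v\<in>fst ` set (L @ [vw]). c v = v"
    proof (cases "c v = v")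
      case True
      then show ?thesis using centers_attach(2)[OF A att] E cv by simp
    next
      case False
      then show ?thesis using centers_attach(1)[OF A att] F that by auto
    qed
    show ?case
      unfolding fold
    proof (intro conjI ballI impI case_prodI2)
      fix p v' w' x assume "p \<in> set (L @ [vw])" "p = (v', w')" "x \<in> insert v' (star V c w')"
      then show "attach (v, w) c1 x = w'" "star V (attach (v, w) c1) x = insert v' (star V c w')"
        using S1[of v' w'] by blast+
    qed (use S2 S3 S4 S5 valid_attach[OF A att] in blast)+
  qed
  show ?A ?B ?C ?D ?E using main by - (elim conjE, assumption)+
  assume "\<exists>v\<in>fst ` set L. c v = v"
  with main show "card (centers c') < card (centers c)" by (elim conjE) (rule mp)
qed

section \<open>Moves and the potential\<close>

definition crit :: "('a \<Rightarrow> 'a) \<Rightarrow> 'a \<Rightarrow> bool" where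
  "crit c v \<longleftrightarrow> card (star V c v) = 2 \<or> card (star V c v) = 3 \<and> c v = v"

text \<open>In Operation 3, the star \<open>S\<close> has center \<open>v\<close> and the 2-star \<open>W\<close> consists of the satellite \<open>x\<close>
  and the center \<open>r\<close>.\<close>

definition absorbs :: "('a \<Rightarrow> 'a) \<Rightarrow> 'a \<Rightarrow> 'a \<Rightarrow> 'a \<Rightarrow> bool" where
  "absorbs c v x r \<longleftrightarrow> v \<in> V \<and> x \<in> V \<and> r \<in> V \<and> c v = v \<and> c x = r \<and> c r = r \<and> x \<noteq> r \<and> r \<noteq> v \<and>
     card (star V c r) = 2 \<and> {x, v} \<in> E \<and> {r, v} \<in> E"

text \<open>A pair \<open>(v, w)\<close> stands for \<open>attach (v, w)\<close>. The pairs are ordered such that every intermediate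
  map is valid: the center of a dissolved star comes last, and for \<open>k = 4\<close> the satellite \<open>y\<close>
  leaves the star of \<open>v\<close> before \<open>x\<close> and \<open>r\<close> join it.\<close>

inductive move :: "('a \<Rightarrow> 'a) \<Rightarrow> ('a \<times> 'a) list \<Rightarrow> bool" for c where
  move1: "\<lbrakk> u \<in> V; v \<in> V; {v, u} \<in> E; card (star V c u) = 2; 4 \<le> card (star V c v); c v \<noteq> v \<rbrakk>
    \<Longrightarrow> move c [(v, u)]"
| move2: "\<lbrakk> r \<in> V; c r = r; card (star V c r) \<in> {2, 3, 4}; L = Ls @ [(r, w)];
      distinct (map fst L); set (map fst L) = star V c r; distinct (map (c \<circ> snd) L);
      \<And>v w. (v, w) \<in> set L \<Longrightarrow> w \<in> V \<and> crit c w \<and> c w \<noteq> r \<and> {v, w} \<in> E \<rbrakk>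
    \<Longrightarrow> move c L"
| move3: "\<lbrakk> absorbs c v x r; card (star V c v) = 2 \<or> card (star V c v) = 3 \<and> 5 \<le> k \<rbrakk>
    \<Longrightarrow> move c [(x, v), (r, v)]"
| move3': "\<lbrakk> absorbs c v x r; card (star V c v) = 3; \<not> 5 \<le> k; y \<in> star V c v; y \<noteq> v;
      w \<in> V; crit c w; c w \<noteq> v; c w \<noteq> r; {y, w} \<in> E \<rbrakk>
    \<Longrightarrow> move c [(y, w), (x, v), (r, v)]"

text \<open>Besides excluding new 2-stars, this fixes the centers of the surviving ones, as is
  needed to stay \<open>designated\<close>.\<close>

definition keeps_pairs :: "('a \<Rightarrow> 'a) \<Rightarrow> ('a \<Rightarrow> 'a) \<Rightarrow> bool" where
  "keeps_pairs c c' \<longleftrightarrow>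
     (\<forall>x\<in>V. card (star V c' x) = 2 \<longrightarrow> star V c' x = star V c x \<and> c' x = c x)"

text \<open>\<open>fold_attach_parallel\<close> does not apply, because both pairs have the same
  target star. Attaching the satellite \<open>x\<close> first turns \<open>r\<close> into a 1-star,
  which may then be attached in turn; this saves one star.\<close>

lemma fold_attach_absorbs:
  assumes "valid c" "absorbs c v x r" "card (star V c v) + 2 \<le> k"
  defines "c' \<equiv> fold attach [(x, v), (r, v)] c"
  shows "valid c'"
    and "\<And>y. y \<in> {x, r} \<union> star V c v \<Longrightarrow> star V c' y = {x, r} \<union> star V c v"
    and "\<And>y. y \<in> V \<Longrightarrow> y \<notin> {x, r} \<union> star V c v \<Longrightarrow> star V c' y = star V c y \<and> c' y = c y"
    and "links V c' = links V c - {{x, r}} \<union> {{x, v}, {r, v}}"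
    and "card (centers c') < card (centers c)"
proof -
  have in_V: "v \<in> V" "x \<in> V" "r \<in> V" and c: "c v = v" "c x = r" "c r = r" "x \<noteq> r" "r \<noteq> v"
    and edges: "{x, v} \<in> E" "{r, v} \<in> E" and card2: "card (star V c r) = 2"
    using assms(2) by (auto simp: absorbs_def)
  have "{x, r} \<subseteq> star V c r" using in_V c by (simp add: star_def)
  then have star_r: "star V c r = {x, r}" using c card2
    by (intro card_seteq[symmetric]) (auto simp: finite_star)
  have star_x: "star V c x = {x, r}" using star_r c by (simp add: star_def)
  have a1: "attachable c x v"
    unfolding attachable_def using in_V c edges assms(3) by simp
  define c1 where "c1 = attach (x, v) c"
  have x_notin: "x \<notin> star V c v" "r \<notin> star V c v" using c by (auto simp: star_def)
  note app1 = attach_apply[OF assms(1) a1, folded c1_def] 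
  note st1 = star_attach[OF assms(1) a1, folded c1_def]
  have v1: "valid c1" unfolding c1_def by (rule valid_attach[OF assms(1) a1])
  have r1: "c1 r = r" "star V c1 r = {r}"
    using app1[OF in_V(3)] st1[OF in_V(3)] x_notin star_r c by auto
  have cv1: "c1 v = v" "star V c1 v = insert x (star V c v)"
    using app1[OF in_V(1)] st1[OF in_V(1)] star_self[OF in_V(1)] by auto
  have a2: "attachable c1 r v"
    unfolding attachable_def using in_V edges assms(3) r1 cv1 c x_notin
    by (simp add: card_insert_if finite_star)
  have c': "c' = attach (r, v) c1" by (simp add: c'_def c1_def)
  note app2 = attach_apply[OF v1 a2, folded c'] 
  note st2 = star_attach[OF v1 a2, folded c']
  show "valid c'" unfolding c' by (rule valid_attach[OF v1 a2])
  show "star V c' y = {x, r} \<union> star V c v" if y: "y \<in> {x, r} \<union> star V c v" for y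
  proof -
    have "y \<in> V" using y in_V by (auto simp: star_def)
    then show ?thesis using st2[of y] y cv1 by auto
  qed
  show "star V c' y = star V c y \<and> c' y = c y" if y: "y \<in> V" "y \<notin> {x, r} \<union> star V c v" for y
  proof -
    have "c y \<noteq> r"
    proof
      assume "c y = r"
      then have "y \<in> star V c r" using y(1) c(3) by (simp add: star_def)
      then show False using y(2) star_r by simp
    qed
    then have "r \<notin> star V c y" "x \<notin> star V c y" using c by (simp_all add: star_def)
    then show ?thesis using st2[OF y(1)] app2[OF y(1)] st1[OF y(1)] app1[OF y(1)] y cv1 by auto
  qed
  \<comment> \<open>The second attachment removes no link: \<open>r\<close> is its own center by
    then, and \<open>{r}\<close> is not a link.\<close>
  have "{r} \<noteq> {x, v}" "{r} \<notin> links V c" using c by (auto simp: links_def)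
  then show "links V c' = links V c - {{x, r}} \<union> {{x, v}, {r, v}}"
    unfolding c' links_attach[OF v1 a2] using r1 c
    by (auto simp: c1_def links_attach[OF assms(1) a1])
  show "card (centers c') < card (centers c)"
    using centers_attach(2)[OF v1 a2] centers_attach(1)[OF assms(1) a1] r1
    by (simp add: c' c1_def)
qed

text \<open>Critical vertices lie in stars with at most three vertices, so \<open>k \<ge> 4\<close>
  leaves room for one more.\<close>

lemma crit_center: "crit c w \<Longrightarrow> c w = w \<or> card (star V c w) = 2" and
  crit_card: "crit c w \<Longrightarrow> card (star V c w) < k" "crit c w \<Longrightarrow> 2 \<le> card (star V c w)"
  using k4 by (auto simp: crit_def)

lemma parallel_move2:
  assumes "valid c" "r \<in> V" "c r = r" "L = Ls @ [(r, w)]"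
    "distinct (map fst L)" "set (map fst L) = star V c r" "distinct (map (c \<circ> snd) L)"
    "\<And>v w. (v, w) \<in> set L \<Longrightarrow> w \<in> V \<and> crit c w \<and> c w \<noteq> r \<and> {v, w} \<in> E"
  shows "parallel c L"
  unfolding parallel_def
proof (intro conjI allI impI)
  have fst: "v \<in> V \<and> c v = r" if "v \<in> fst ` set L" for v
    using assms(3,6) that by (auto simp: star_def)
  fix v w assume vw: "(v, w) \<in> set L"
  note w = assms(8)[OF vw]
  have v: "v \<in> fst ` set L" using vw by force
  show "v \<in> V" "w \<in> V" "{v, w} \<in> E" "c w = w \<or> card (star V c w) = 2" "card (star V c w) < k"
    using fst[OF v] w crit_center[of c w] crit_card(1)[of c w] by simp_all
  fix v' w' assume "(v', w') \<in> set L"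
  then have "v' \<in> fst ` set L" by force
  from fst[OF this] show "c v' \<noteq> c w" using w by auto
next
  have fst: "v \<in> V \<and> c v = r" if "v \<in> fst ` set L" for v
    using assms(3,6) that by (auto simp: star_def)
  fix L1 v w' L2
  assume L: "L = L1 @ (v, w') # L2" and "c v = v"
  have "v \<in> fst ` set L" using L by force
  then have "v = r" using fst \<open>c v = v\<close> by force
  \<comment> \<open>\<open>r\<close> occurs only once among the first components, and it is the last
    entry of \<open>L\<close>; hence all satellites precede it.\<close>
  have "L2 = []"
  proof (rule ccontr)
    assume "L2 \<noteq> []"
    then obtain L3 z where "L2 = L3 @ [z]" by (meson rev_exhaust)
    then have "Ls = L1 @ (v, w') # L3" using L assms(4) by simp
    then show False using assms(4,5) \<open>v = r\<close> by auto
  qed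
  then show "star V c v \<subseteq> insert v (fst ` set L1)"
    using assms(6) L \<open>v = r\<close> by auto
qed (use assms in auto)

lemma keeps_pairs_card: "keeps_pairs c c' \<Longrightarrow> card (pairs c') \<le> card (pairs c)"
  by (intro card_mono finite_pairs) (auto simp: keeps_pairs_def pairs_def)

lemma move1_attachable:
  assumes "u \<in> V" "v \<in> V" "{v, u} \<in> E" "card (star V c u) = 2" "4 \<le> card (star V c v)" "c v \<noteq> v"
  shows "attachable c v u"
proof -
  have "c v \<noteq> c u" using star_eqI[of c v u] assms(4,5) by auto
  then show ?thesis using assms k4 by (simp add: attachable_def)
qed

text \<open>The 2-star of \<open>u\<close> grows to three vertices and the star of \<open>v\<close>
  keeps at least three. So a 2-star disappears and none arises; the gain is in \<open>pairs\<close>,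
  not in \<open>centers\<close>.\<close>

lemma move1_progress:
  assumes "valid c" "u \<in> V" "v \<in> V" "{v, u} \<in> E" "card (star V c u) = 2" "4 \<le> card (star V c v)" "c v \<noteq> v"
  shows "keeps_pairs c (attach (v, u) c)" "card (pairs (attach (v, u) c)) < card (pairs c)"
proof -
  have att: "attachable c v u" using assms by (intro move1_attachable)
  have v: "v \<notin> star V c u" by (rule attachable_notin[OF att])
  let ?c = "attach (v, u) c"
  have big: "card (insert v (star V c u)) = 3" using v assms(5) finite_star by simp
  have keep: "x \<noteq> v \<and> x \<notin> star V c u \<and> v \<notin> star V c x"
    if x: "x \<in> V" "card (star V ?c x) = 2" for x
  proof (intro conjI)
    show out: "x \<noteq> v" "x \<notin> star V c u"
      using x big star_attach[OF assms(1) att x(1)] by auto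
    show "v \<notin> star V c x"
    proof
      assume "v \<in> star V c x"
      then have "star V c x = star V c v" by (simp add: star_def)
      then have "card (star V ?c x) = card (star V c v) - 1"
        using star_attach[OF assms(1) att x(1)] out assms(3) by (simp add: star_self finite_star)
      then show False using x assms(6) by simp
    qed
  qed
  show k: "keeps_pairs c ?c"
    unfolding keeps_pairs_def
  proof (intro ballI impI)
    fix x assume x: "x \<in> V" "card (star V ?c x) = 2"
    show "star V ?c x = star V c x \<and> ?c x = c x"
      unfolding star_attach[OF assms(1) att x(1)] attach_apply[OF assms(1) att x(1)]
      using keep[OF x] by simp
  qed
  have "u \<in> pairs c" "u \<notin> pairs ?c"
    using assms(2,5) keep[of u] star_self by (auto simp: pairs_def)
  moreover have "pairs ?c \<subseteq> pairs c" using k by (auto simp: keeps_pairs_def pairs_def)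
  ultimately show "card (pairs ?c) < card (pairs c)"
    by (intro psubset_card_mono finite_pairs) auto
qed

text \<open>The targets are critical, so their stars had at least two vertices and now have at least
  three; the star of \<open>r\<close> is dissolved completely, and all other stars are
  untouched.\<close>

lemma keeps_pairs_move2:
  assumes "valid c" "parallel c L" "set (map fst L) = star V c r"
    "\<And>v w. (v, w) \<in> set L \<Longrightarrow> crit c w"
  shows "keeps_pairs c (fold attach L c)"
  unfolding keeps_pairs_def
proof (intro ballI impI)
  let ?c = "fold attach L c"
  note par = fold_attach_parallel[OF assms(1,2)]
  fix x assume x: "x \<in> V" "card (star V ?c x) = 2"
  have big: "x \<notin> insert v (star V c w)" if vw: "(v, w) \<in> set L" for v w
  proof
    assume "x \<in> insert v (star V c w)"
    then have "star V ?c x = insert v (star V c w)" using bspec[OF par(2) vw] by auto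
    moreover have "v \<notin> star V c w" using parallelD(4)[OF assms(2) vw vw] by (simp add: star_def)
    ultimately have "card (star V ?c x) = Suc (card (star V c w))" by (simp add: finite_star)
    then show False using x crit_card(2)[OF assms(4)[OF vw]] by simp
  qed
  then have "x \<notin> fst ` set L" "c x \<notin> (c \<circ> snd) ` set L"
    using x(1) by (force simp: star_def)+
  moreover from this have "star V c x - fst ` set L = star V c x"
    using assms(3) x(1) by (auto simp: star_def)
  ultimately show "star V ?c x = star V c x \<and> ?c x = c x" using par(3) x(1) by simp
qed

lemma absorbs_notin: "absorbs c v x r \<Longrightarrow> x \<notin> star V c v \<and> r \<notin> star V c v \<and> x \<noteq> v \<and> r \<noteq> v \<and> x \<noteq> r"
  by (auto simp: absorbs_def star_def)

lemma absorbs_star: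
  assumes "absorbs c v x r" shows "star V c r = {x, r}"
proof -
  have "{x, r} \<subseteq> star V c r" "card (star V c r) = 2" "x \<noteq> r"
    using assms by (auto simp: absorbs_def star_def)
  then show ?thesis by (intro card_seteq[symmetric]) (auto simp: finite_star)
qed

lemma absorbs_card:
  assumes "absorbs c v x r" shows "3 \<le> card ({x, r} \<union> star V c v)"
proof -
  have "v \<in> star V c v" using assms by (simp add: absorbs_def star_def)
  then have "card {x, r, v} \<le> card ({x, r} \<union> star V c v)"
    by (intro card_mono) (auto simp: finite_star)
  then show ?thesis using absorbs_notin[OF assms] by simp
qed

lemma keeps_pairs_absorbs:
  assumes "valid c" "absorbs c v x r" "card (star V c v) + 2 \<le> k"
  shows "keeps_pairs c (fold attach [(x, v), (r, v)] c)"
  unfolding keeps_pairs_def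
proof (intro ballI impI)
  let ?c = "fold attach [(x, v), (r, v)] c"
  note f = fold_attach_absorbs[OF assms]
  fix y assume y: "y \<in> V" "card (star V ?c y) = 2"
  then have "y \<notin> {x, r} \<union> star V c v" using f(2)[of y] absorbs_card[OF assms(2)] by auto
  then show "star V ?c y = star V c y \<and> ?c y = c y" using f(3) y by simp
qed

text \<open>For \<open>k = 4\<close> a 3-star has no room for two more vertices; sending
  \<open>y\<close> elsewhere first makes room. Since the star of \<open>w\<close> is neither that of
  \<open>v\<close> nor that of \<open>r\<close>, the premises of \<open>absorbs\<close>
  survive.\<close>

lemma move3'_step:
  assumes "valid c" "absorbs c v x r" "card (star V c v) = 3" "y \<in> star V c v" "y \<noteq> v"
      "w \<in> V" "crit c w" "c w \<noteq> v" "c w \<noteq> r" "{y, w} \<in> E"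
  defines "c1 \<equiv> attach (y, w) c"
  shows "attachable c y w" "absorbs c1 v x r" "card (star V c1 v) + 2 \<le> k"
    and "star V c1 v = star V c v - {y}" "star V c1 w = insert y (star V c w)"
proof -
  have y: "y \<in> V" "c y = v" and v: "v \<in> V" "c v = v" and r: "r \<in> V" "c r = r" "r \<noteq> v"
    and x: "x \<in> V" "c x = r" "x \<noteq> r"
    using assms(2,4) by (auto simp: star_def absorbs_def)
  show att: "attachable c y w"
    unfolding attachable_def
    using assms(5-10) y crit_center[OF assms(7)] crit_card(1)[OF assms(7)] by auto
  note st = star_attach[OF assms(1) att, folded c1_def] and app = attach_apply[OF assms(1) att, folded c1_def]
  have out: "v \<notin> star V c w" "r \<notin> star V c w" "x \<notin> star V c w"
    using v r x assms(8,9) by (auto simp: star_def)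
  have ne: "r \<noteq> y" "x \<noteq> y" using y r x by auto
  show sv: "star V c1 v = star V c v - {y}" using st[OF v(1)] out assms(5) by auto
  show "star V c1 w = insert y (star V c w)" using st[OF assms(6)] star_self[OF assms(6)] by simp
  show "card (star V c1 v) + 2 \<le> k" using sv assms(3,4) k4 by (simp add: finite_star)
  have "star V c1 r = star V c r" using st[OF r(1)] out ne y r by (auto simp: star_def)
  then show "absorbs c1 v x r"
    using assms(2) app[OF v(1)] app[OF r(1)] app[OF x(1)] out assms(5) ne
    by (simp add: absorbs_def)
qed

text \<open>The argument looks at the final map, because the intermediate one does contain a new
  2-star, namely the rest of the star of \<open>v\<close>; the next two attachments enlarge it to
  four vertices.\<close>

lemma keeps_pairs_move3':
  assumes "valid c" "absorbs c v x r" "card (star V c v) = 3" "y \<in> star V c v" "y \<noteq> v"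
      "w \<in> V" "crit c w" "c w \<noteq> v" "c w \<noteq> r" "{y, w} \<in> E"
  shows "keeps_pairs c (fold attach [(y, w), (x, v), (r, v)] c)"
  unfolding keeps_pairs_def
proof (intro ballI impI)
  define c1 where "c1 = attach (y, w) c"
  note s = move3'_step[OF assms, folded c1_def]
  have v1: "valid c1" unfolding c1_def by (rule valid_attach[OF assms(1) s(1)])
  let ?c = "fold attach [(y, w), (x, v), (r, v)] c"
  have c': "?c = fold attach [(x, v), (r, v)] c1" by (simp add: c1_def)
  note f = fold_attach_absorbs[OF v1 s(2,3)]
  fix z assume z: "z \<in> V" "card (star V ?c z) = 2"
  then have z': "z \<notin> {x, r} \<union> star V c1 v"
    using f(2)[of z] absorbs_card[OF s(2)] unfolding c' by auto
  then have eq: "star V ?c z = star V c1 z" "?c z = c1 z" using f(3)[OF z(1)] unfolding c' by auto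
  have "card (insert y (star V c w)) \<ge> 3"
    using crit_card(2)[OF assms(7)] attachable_notin[OF s(1)] by (simp add: finite_star)
  then have zw: "z \<noteq> y" "z \<notin> star V c w"
    using z(2) star_attach[OF assms(1) s(1) z(1), folded c1_def] eq by auto
  have cv: "c y = v" "c v = v" using assms(2,4) by (simp_all add: star_def absorbs_def)
  have "c z \<noteq> v"
  proof
    assume "c z = v"
    then have "z \<in> star V c v" using z(1) cv(2) by (simp add: star_def)
    then show False using z' zw(1) s(4) by simp
  qed
  then have "y \<notin> star V c z" using cv(1) by (simp add: star_def)
  then show "star V ?c z = star V c z \<and> ?c z = c z"
    using eq zw star_attach[OF assms(1) s(1) z(1), folded c1_def]
      attach_apply[OF assms(1) s(1) z(1), folded c1_def] by simp
qed

text \<open>Operation 1 lowers \<open>pairs\<close> without adding stars; Operations 2 and 3 lose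
  the center \<open>r\<close> and create no 2-star.\<close>

lemma move_progress:
  assumes "valid c" "move c L"
  shows "valid (fold attach L c)" "keeps_pairs c (fold attach L c)"
    and "card (centers (fold attach L c)) + card (pairs (fold attach L c)) < card (centers c) + card (pairs c)"
proof -
  let ?c = "fold attach L c"
  have "valid ?c \<and> keeps_pairs c ?c \<and>
    card (centers ?c) + card (pairs ?c) < card (centers c) + card (pairs c)"
    using assms(2)
  proof cases
    case (move1 u v)
    then have att: "attachable c v u" by (intro move1_attachable)
    show ?thesis
      using move1_progress[OF assms(1) move1(2-7)] valid_attach[OF assms(1) att]
        centers_attach(1)[OF assms(1) att] move1(1) by simp
  next
    case (move2 r Ls w)
    have par: "parallel c L" by (rule parallel_move2[OF assms(1)]) (rule move2)+
    have k: "keeps_pairs c ?c"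
      using move2 by (intro keeps_pairs_move2[OF assms(1) par]) blast+
    have "r \<in> fst ` set L" using move2(4) by simp
    then have "\<exists>v\<in>fst ` set L. c v = v" using move2(2) by blast
    from fold_attach_parallel(6)[OF assms(1) par this] show ?thesis
      using fold_attach_parallel(1)[OF assms(1) par] k keeps_pairs_card[OF k] by simp
  next
    case (move3 v x r)
    have le: "card (star V c v) + 2 \<le> k" using move3 k4 by auto
    note f = fold_attach_absorbs[OF assms(1) move3(2) le]
    have k: "keeps_pairs c ?c" unfolding move3(1) by (rule keeps_pairs_absorbs[OF assms(1) move3(2) le])
    show ?thesis using f(1,5) k keeps_pairs_card[OF k] move3(1) by simp
  next
    case (move3' v x r y w)
    note pre = move3'(2,3,5-)
    define c1 where "c1 = attach (y, w) c"
    note s = move3'_step[OF assms(1) pre, folded c1_def]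
    have v1: "valid c1" unfolding c1_def by (rule valid_attach[OF assms(1) s(1)])
    note f = fold_attach_absorbs[OF v1 s(2,3)]
    have k: "keeps_pairs c ?c" unfolding move3'(1) by (rule keeps_pairs_move3'[OF assms(1) pre])
    have "card (centers c1) \<le> card (centers c)"
      unfolding c1_def by (rule centers_attach(1)[OF assms(1) s(1)])
    then show ?thesis using f(1,5) k keeps_pairs_card[OF k] move3'(1) by (simp add: c1_def)
  qed
  then show "valid ?c" "keeps_pairs c ?c"
    "card (centers ?c) + card (pairs ?c) < card (centers c) + card (pairs c)" by blast+
qed

lemma designated_keeps: "designated \<delta> c \<Longrightarrow> keeps_pairs c c' \<Longrightarrow> designated \<delta> c'"
  by (simp add: designated_def keeps_pairs_def)

lemma progress_bound: "card (centers c) + card (pairs c) \<le> 2 * card V"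
proof -
  have "card (centers c) \<le> card V" "card (pairs c) \<le> card V"
    using finV by (auto simp: centers_def pairs_def intro: card_mono)
  then show ?thesis by simp
qed

section \<open>Operations as moves\<close>

lemma star_graph_eqI: "c u = c v \<Longrightarrow> star_graph V c u = star_graph V c v"
  by (simp add: star_graph_def star_def)

lemma in_part:
  assumes "valid c" "S \<in> part V c" "x \<in> verts S"
  shows "S = star_graph V c x" "x \<in> V"
proof -
  obtain v where v: "S = star_graph V c v" "v \<in> V" using assms part_eq by auto
  then have "x \<in> V" "c x = c v" using assms(3) by (auto simp: star_def)
  then show "S = star_graph V c x" "x \<in> V" using v star_graph_eqI[of c x v] by auto
qed

lemma star_graph_in_part: "valid c \<Longrightarrow> v \<in> V \<Longrightarrow> star_graph V c v \<in> part V c"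
  by (simp add: part_eq)

text \<open>From three vertices on, the center is the only vertex of degree at least 2. In a 2-star,
  \<open>is_center\<close> refers to \<delta>, with which the map agrees.\<close>

lemma is_center_iff:
  assumes "valid c" "designated \<delta> c" "v \<in> V" "2 \<le> card (star V c v)"
  shows "is_center \<delta> (star_graph V c v) x \<longleftrightarrow> x = c v"
proof (cases "card (star V c v) = 2")
  case True
  then show ?thesis using assms(2,3) by (auto simp: is_center_def designated_def)
next
  case False
  then have "3 \<le> card (star V c v)" using assms(4) by simp
  then show ?thesis
    using center_in_star[OF assms(1,3)] False
    by (auto simp: is_center_def vdegree_star_graph[OF assms(1,3)] split: if_splits)
qed

lemma critical_iff:
  assumes "valid c" "designated \<delta> c"
  shows "critical \<delta> (part V c) v \<longleftrightarrow> v \<in> V \<and> crit c v"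
proof
  assume "critical \<delta> (part V c) v"
  then obtain S where S: "S \<in> part V c"
    "card (verts S) = 2 \<and> v \<in> verts S \<or> card (verts S) = 3 \<and> is_center \<delta> S v"
    by (auto simp: critical_def)
  then have "v \<in> verts S" by (auto simp: is_center_def)
  from in_part[OF assms(1) S(1) this] show "v \<in> V \<and> crit c v"
    using S(2) is_center_iff[OF assms, of v v] by (auto simp: crit_def)
next
  assume v: "v \<in> V \<and> crit c v"
  then have "star_graph V c v \<in> part V c" "v \<in> star V c v"
    using star_graph_in_part[OF assms(1)] star_self by auto
  moreover have "card (star V c v) = 2 \<or> card (star V c v) = 3 \<and> is_center \<delta> (star_graph V c v) v"
    using v is_center_iff[OF assms, of v v] by (auto simp: crit_def)
  ultimately show "critical \<delta> (part V c) v"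
    unfolding critical_def by (metis verts_star_graph)
qed

lemma in_different_stars_iff:
  assumes "valid c"
  shows "in_different_stars (part V c) u v \<longleftrightarrow> u \<in> V \<and> v \<in> V \<and> c u \<noteq> c v"
proof
  assume "in_different_stars (part V c) u v"
  then obtain S T where "S \<in> part V c" "T \<in> part V c" "S \<noteq> T" "u \<in> verts S" "v \<in> verts T"
    by (auto simp: in_different_stars_def)
  then show "u \<in> V \<and> v \<in> V \<and> c u \<noteq> c v" using in_part[OF assms] star_graph_eqI by metis
next
  assume uv: "u \<in> V \<and> v \<in> V \<and> c u \<noteq> c v"
  then have "star_graph V c u \<noteq> star_graph V c v"
    using star_eqD[of u c v] by (auto simp: star_graph_def)
  then show "in_different_stars (part V c) u v"
    unfolding in_different_stars_def using uv star_graph_in_part[OF assms] star_self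
    by (metis verts_star_graph)
qed

text \<open>An exchange and a move give the same partition as soon as their edge sets agree; the
  next four lemmas compare these.\<close>

lemma exchange_part:
  "valid c \<Longrightarrow> exchange (V, E) (part V c) D A = components V (links V c - D \<union> A)"
  by (simp add: exchange_def union_edges_part)

lemma links_move1:
  assumes "valid c" "attachable c v u"
  shows "part V (fold attach [(v, u)] c) = exchange (V, E) (part V c) {{c v, v}} {{u, v}}"
  by (simp add: exchange_part assms links_attach insert_commute)

lemma links_move2:
  assumes "valid c" "parallel c L" "c r = r" "set (map fst L) = star V c r"
  shows "part V (fold attach L c) =
    exchange (V, E) (part V c) (edges (star_graph V c r)) ((\<lambda>(v, w). {v, w}) ` set L)"
proof -
  have fst: "fst ` set L = star V c r" using assms(4) by simp
  have "links V c - (\<lambda>v. {v, c v}) ` star V c r = links V c - edges (star_graph V c r)"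
    using assms(3) by (auto simp: links_def star_graph_def star_def)
  then show ?thesis
    by (simp only: exchange_part[OF assms(1)] fold_attach_parallel(4)[OF assms(1,2)] fst)
qed

lemma links_move3:
  assumes "valid c" "absorbs c v x r" "card (star V c v) + 2 \<le> k"
  shows "part V (fold attach [(x, v), (r, v)] c) =
    exchange (V, E) (part V c) {{x, r}} {{x, v}, {r, v}}"
  by (simp only: exchange_part[OF assms(1)] fold_attach_absorbs(4)[OF assms])

lemma links_move3':
  assumes "valid c" "absorbs c v x r" "card (star V c v) = 3" "y \<in> star V c v" "y \<noteq> v"
      "w \<in> V" "crit c w" "c w \<noteq> v" "c w \<noteq> r" "{y, w} \<in> E"
  shows "part V (fold attach [(y, w), (x, v), (r, v)] c) =
    exchange (V, E) (part V c) {{x, r}, {v, y}} {{x, v}, {r, v}, {w, y}}"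
proof -
  define c1 where "c1 = attach (y, w) c"
  note s = move3'_step[OF assms, folded c1_def]
  have v1: "valid c1" unfolding c1_def by (rule valid_attach[OF assms(1) s(1)])
  have y: "c y = v" using assms(2,4) by (simp add: star_def absorbs_def)
  \<comment> \<open>The edge \<open>{y, w}\<close>, which is added first, must survive the deletion
    of \<open>{x, r}\<close>.\<close>
  have "y \<noteq> x" "y \<noteq> r" using y assms(2) by (auto simp: absorbs_def)
  then have "{y, w} \<noteq> {x, r}" by (auto simp: doubleton_eq_iff)
  then have "links V c1 - {{x, r}} \<union> {{x, v}, {r, v}}
     = links V c - {{x, r}, {v, y}} \<union> {{x, v}, {r, v}, {w, y}}"
    unfolding c1_def links_attach[OF assms(1) s(1)] y by (auto simp: insert_commute)
  then show ?thesis
    using fold_attach_absorbs(4)[OF v1 s(2,3)]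
    by (simp add: exchange_part[OF assms(1)] c1_def)
qed

lemma move_operation:
  assumes "valid c" "designated \<delta> c" "move c L"
  shows "operation k (V, E) \<delta> (part V c) (part V (fold attach L c))"
  using assms(3)
proof cases
  case (move1 u v)
  then have att: "attachable c v u" by (intro move1_attachable)
  show ?thesis unfolding move1(1) links_move1[OF assms(1) att]
    by (rule Operation1[where U = "star_graph V c u" and T = "star_graph V c v"])
      (use move1 assms in \<open>simp_all add: star_graph_in_part star_self is_center_iff insert_commute\<close>)
next
  case (move2 r Ls w)
  have par: "parallel c L" by (rule parallel_move2[OF assms(1)]) (rule move2)+
  \<comment> \<open>Operation 2 chooses partners by a function, a move lists pairs; as the first
    components are distinct, lookup in the list is that function.\<close>
  define f where "f v = the (map_of L v)" for v
  have f: "(v, f v) \<in> set L" if "v \<in> star V c r" for v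
  proof -
    have "v \<in> fst ` set L" using that move2(6) by simp
    then show ?thesis unfolding f_def by (metis domIff dom_map_of_conv_image_fst map_of_SomeD option.collapse)
  qed
  have f_eq: "w = f v" if "(v, w) \<in> set L" for v w
    using that move2(5) by (simp add: f_def)
  have A: "(\<lambda>(v, w). {v, w}) ` set L = {{v, f v} | v. v \<in> verts (star_graph V c r)}"
  proof (intro set_eqI iffI)
    fix e assume "e \<in> (\<lambda>(v, w). {v, w}) ` set L"
    then obtain v w where vw: "(v, w) \<in> set L" "e = {v, w}" by auto
    then have "v \<in> star V c r" using move2(6) by force
    then show "e \<in> {{v, f v} | v. v \<in> verts (star_graph V c r)}" using vw f_eq by auto
  qed (use f in force)
  show ?thesis
    unfolding links_move2[OF assms(1) par move2(2,6)] A
  proof (rule Operation2)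
    show "star_graph V c r \<in> part V c" "card (verts (star_graph V c r)) \<in> {2, 3, 4}"
      using move2 assms by (simp_all add: star_graph_in_part)
    fix v assume "v \<in> verts (star_graph V c r)"
    then have v: "(v, f v) \<in> set L" using f by simp
    show "critical \<delta> (part V c) (f v) \<and> f v \<notin> verts (star_graph V c r) \<and> {v, f v} \<in> edges (V, E)"
      using move2(8)[OF v] move2(2) critical_iff[OF assms(1,2)] by (auto simp: star_def)
    fix v' assume "v' \<in> verts (star_graph V c r)" and ne: "v \<noteq> v'"
    then have v': "(v', f v') \<in> set L" using f by simp
    have "inj_on (c \<circ> snd) (set L)" using move2(7) by (simp add: distinct_map)
    then have "c (f v) \<noteq> c (f v')" using v v' ne by (force simp: inj_on_def)
    then show "in_different_stars (part V c) (f v) (f v')"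
      using move2(8)[OF v] move2(8)[OF v'] by (simp add: in_different_stars_iff assms)
  qed
next
  case (move3 v x r)
  have le: "card (star V c v) + 2 \<le> k" using move3 k4 by auto
  have a: "v \<in> V" "r \<in> V" "c v = v" "c r = r" "r \<noteq> v" using move3(2) by (auto simp: absorbs_def)
  show ?thesis unfolding move3(1) links_move3[OF assms(1) move3(2) le]
  proof (rule Operation3_all)
    show "star_graph V c v \<in> part V c" "star_graph V c r \<in> part V c"
      using a assms by (auto simp: star_graph_in_part)
    show "star_graph V c r \<noteq> star_graph V c v"
      using star_eqD[of r c v] a by (auto simp: star_graph_def)
    have "2 \<le> card (star V c v)" using move3(3) by auto
    then show "is_center \<delta> (star_graph V c v) v"
      using is_center_iff[OF assms(1,2) a(1)] a(3) by simp
    show "verts (star_graph V c r) = {x, r}" using absorbs_star[OF move3(2)] by simp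
    show "tiny (star_graph V c v)" using move3(3) by (auto simp: tiny_def)
    show "5 \<le> k \<or> card (verts (star_graph V c v)) = 2" using move3(3) by auto
    show "{x, v} \<in> edges (V, E)" "{r, v} \<in> edges (V, E)" "x \<noteq> r"
      using move3(2) by (simp_all add: absorbs_def)
  qed
next
  case (move3' v x r y w)
  note pre = move3'(2,3,5-)
  have a: "v \<in> V" "r \<in> V" "c v = v" "c r = r" "r \<noteq> v" "{x, v} \<in> E" "{r, v} \<in> E" "x \<noteq> r"
    using move3'(2) by (auto simp: absorbs_def)
  show ?thesis unfolding move3'(1) links_move3'[OF assms(1) pre]
  proof (rule Operation3_k4)
    show "star_graph V c v \<in> part V c" "star_graph V c r \<in> part V c"
      using a assms by (auto simp: star_graph_in_part)
    show "star_graph V c r \<noteq> star_graph V c v"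
      using star_eqD[of r c v] a by (auto simp: star_graph_def)
    show "is_center \<delta> (star_graph V c v) v" using a move3' assms by (simp add: is_center_iff)
    show "verts (star_graph V c r) = {x, r}" using absorbs_star[OF move3'(2)] by simp
    show "w \<notin> verts (star_graph V c v) \<union> verts (star_graph V c r)"
      using move3'(9,10) a by (auto simp: star_def)
    show "critical \<delta> (part V c) w" using critical_iff[OF assms(1,2)] move3' by simp
    show "{w, y} \<in> edges (V, E)" using move3'(11) by (simp add: insert_commute)
  qed (use move3' a in \<open>auto simp: tiny_def\<close>)
qed

text \<open>Operation 3 does not say which of \<open>w1\<close> and \<open>w2\<close> is the center
  of \<open>W\<close>, whereas a move must detach the satellite first; naming them \<open>x\<close>
  and \<open>r\<close> settles the order.\<close>

lemma absorbsI:
  assumes "valid c" "designated \<delta> c" "S \<in> part V c" "tiny S" "is_center \<delta> S v" "W \<in> part V c" "W \<noteq> S"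
    "w1 \<noteq> w2" "verts W = {w1, w2}" "{w1, v} \<in> E" "{w2, v} \<in> E"
  obtains x r where "absorbs c v x r" "S = star_graph V c v" "{x, r} = {w1, w2}"
    "W = star_graph V c r" "{{x, v}, {r, v}} = {{w1, v}, {w2, v}}"
proof -
  have "verts S \<noteq> {}" using assms(4) by (auto simp: tiny_def)
  then obtain s where s: "s \<in> verts S" by blast
  note S = in_part[OF assms(1,3) s]
  have "2 \<le> card (star V c s)" using assms(4) S(1) by (auto simp: tiny_def)
  then have v: "v = c s" using is_center_iff[OF assms(1,2) S(2)] assms(5) S(1) by simp
  have v': "v \<in> V" "c v = v" using validD[OF assms(1) S(2)] v by auto
  have Sv: "S = star_graph V c v" using S(1) star_graph_eqI[of c v s] v v' by simp
  have W1: "W = star_graph V c w1" "w1 \<in> V" and W2: "W = star_graph V c w2" "w2 \<in> V"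
    using in_part[OF assms(1,6)] assms(9) by auto
  have st1: "star V c w1 = {w1, w2}" using W1 assms(9) by simp
  have st2: "star V c w2 = {w1, w2}" using W2 assms(9) by simp
  have c12: "c w1 = c w2" using st2 by (auto simp: star_def)
  have "c w1 \<in> {w1, w2}" using center_in_star[OF assms(1) W1(2)] st1 by simp
  then have "\<exists>x r. c x = r \<and> c r = r \<and> x \<noteq> r \<and> (x = w1 \<and> r = w2 \<or> x = w2 \<and> r = w1)"
  proof
    assume "c w1 = w1" then show ?thesis using c12 assms(8) by (intro exI[of _ w2] exI[of _ w1]) simp
  next
    assume "c w1 \<in> {w2}" then show ?thesis using c12 assms(8) by (intro exI[of _ w1] exI[of _ w2]) simp
  qed
  then obtain x r where xr: "c x = r" "c r = r" "x \<noteq> r" "x = w1 \<and> r = w2 \<or> x = w2 \<and> r = w1" by blast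
  have Wr: "W = star_graph V c r" using xr(4) W1 W2 by blast
  have "r \<noteq> v" using assms(7) Sv Wr by blast
  moreover have "card (star V c r) = 2" using xr(4) st1 st2 assms(8) by auto
  moreover have "x \<in> V" "r \<in> V" "{x, v} \<in> E" "{r, v} \<in> E" using xr(4) W1 W2 assms by auto
  ultimately have "absorbs c v x r" unfolding absorbs_def using xr(1-3) v' by simp
  moreover have "{x, r} = {w1, w2}" "{{x, v}, {r, v}} = {{w1, v}, {w2, v}}" using xr(4) by blast+
  ultimately show thesis using that Sv Wr by blast
qed

lemma operation_move:
  assumes "valid c" "designated \<delta> c" "operation k (V, E) \<delta> (part V c) Q"
  obtains L where "move c L" "Q = part V (fold attach L c)"
  using assms(3)
proof cases
  case (Operation1 U u T z v)
  note U = in_part[OF assms(1) Operation1(2,4)] and T = in_part[OF assms(1) Operation1(5,8)]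
  have z: "z = c v"
    using Operation1(6,7) is_center_iff[OF assms(1,2) T(2)] T(1) by simp
  have m: "move c [(v, u)]"
    using Operation1 U T z by (intro move1) (auto simp: insert_commute)
  have "attachable c v u"
    using Operation1 U T z by (intro move1_attachable) (auto simp: insert_commute)
  from links_move1[OF assms(1) this] show thesis using that[OF m] Operation1(1) z by simp
next
  case (Operation2 S w)
  have "verts S \<noteq> {}" using Operation2(3) by auto
  then obtain x where x: "x \<in> verts S" by blast
  note X = in_part[OF assms(1) Operation2(2) x]
  define r where "r = c x"
  have r: "r \<in> V" "c r = r" using validD[OF assms(1) X(2)] by (auto simp: r_def)
  have S: "S = star_graph V c r"
    using X(1) star_graph_eqI[of c r x] r by (simp add: r_def)
  obtain ys where ys: "set ys = star V c r - {r}" "distinct ys"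
    using finite_distinct_list[of "star V c r - {r}"] finite_star by auto
  \<comment> \<open>The satellites may come in any order, but the center \<open>r\<close> must be
    last.\<close>
  define L where "L = map (\<lambda>v. (v, w v)) (ys @ [r])"
  have set_ys: "set (ys @ [r]) = star V c r" using ys star_self[of r c] r by auto
  have L: "(v, u) \<in> set L \<longleftrightarrow> v \<in> star V c r \<and> u = w v" for v u
  proof -
    have "(v, u) \<in> set L \<longleftrightarrow> v \<in> set (ys @ [r]) \<and> u = w v" unfolding L_def by auto
    then show ?thesis by (simp only: set_ys)
  qed
  have w: "w v \<in> V" "crit c (w v)" "c (w v) \<noteq> r" "{v, w v} \<in> E" if "v \<in> star V c r" for v
  proof -
    have *: "critical \<delta> (part V c) (w v)" "w v \<notin> star V c r" "{v, w v} \<in> E"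
      using Operation2(4)[of v] that S by auto
    then show "w v \<in> V" "crit c (w v)" "{v, w v} \<in> E" using critical_iff[OF assms(1,2)] by auto
    then show "c (w v) \<noteq> r" using *(2) r by (simp add: star_def)
  qed
  have inj: "c (w v) \<noteq> c (w v')" if "v \<in> star V c r" "v' \<in> star V c r" "v \<noteq> v'" for v v'
    using Operation2(5)[of v v'] that S by (simp add: in_different_stars_iff assms)
  have dist: "distinct (ys @ [r])" using ys by simp
  have d1: "distinct (map fst L)" using dist by (simp add: L_def comp_def)
  have "inj_on (c \<circ> w) (set (ys @ [r]))" unfolding set_ys using inj by (auto simp: inj_on_def)
  then have d2: "distinct (map (c \<circ> snd) L)"
    unfolding L_def using dist distinct_map[of "c \<circ> w" "ys @ [r]"] by (simp add: comp_def)
  have set_fst: "set (map fst L) = star V c r" using set_ys by (auto simp: L_def)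
  have Ls: "L = map (\<lambda>v. (v, w v)) ys @ [(r, w r)]" by (simp add: L_def)
  have m: "move c L"
    by (rule move.move2[OF r _ Ls d1 set_fst d2]) (use Operation2(3) S L w in auto)
  have par: "parallel c L"
    by (rule parallel_move2[OF assms(1) r Ls d1 set_fst d2]) (use L w in auto)
  have "(\<lambda>(v, w). {v, w}) ` set L = {{v, w v} | v. v \<in> verts S}"
    using S by (auto simp: L_def set_ys[symmetric])
  then show thesis
    using that[OF m] links_move2[OF assms(1) par r(2) set_fst] Operation2(1) S by simp
next
  case (Operation3_all S v W w1 w2)
  have e: "{w1, v} \<in> E" "{w2, v} \<in> E" using Operation3_all(9,10) by auto
  obtain x r where xr: "absorbs c v x r" "S = star_graph V c v" "{x, r} = {w1, w2}"
    "{{x, v}, {r, v}} = {{w1, v}, {w2, v}}"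
    by (rule absorbsI[OF assms(1,2) Operation3_all(2-8) e])
  have card: "card (star V c v) = 2 \<or> card (star V c v) = 3 \<and> 5 \<le> k"
    using Operation3_all(3,11) xr(2) by (auto simp: tiny_def)
  then have "card (star V c v) + 2 \<le> k" using k4 by auto
  from links_move3[OF assms(1) xr(1) this] show thesis
    using that[OF move3[OF xr(1) card]] Operation3_all(1) xr(3,4) by simp
next
  case (Operation3_k4 S v W w1 w2 y w)
  have e: "{w1, v} \<in> E" "{w2, v} \<in> E" using Operation3_k4(9,10) by auto
  obtain x r where xr: "absorbs c v x r" "S = star_graph V c v" "{x, r} = {w1, w2}"
    "W = star_graph V c r" "{{x, v}, {r, v}} = {{w1, v}, {w2, v}}"
    by (rule absorbsI[OF assms(1,2) Operation3_k4(2-8) e])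
  have 3: "card (star V c v) = 3" using Operation3_k4(3,11) xr(2) by (auto simp: tiny_def)
  have w: "w \<in> V" "crit c w" using Operation3_k4(14) critical_iff[OF assms(1,2)] by auto
  have vr: "c v = v" "c r = r" using xr(1) by (auto simp: absorbs_def)
  have cw: "c w \<noteq> v" "c w \<noteq> r" using Operation3_k4(15) xr(2,4) w vr by (auto simp: star_def)
  have y: "y \<in> star V c v" "y \<noteq> v" "{y, w} \<in> E"
    using Operation3_k4 xr(2) by (auto simp: insert_commute)
  have k5: "\<not> 5 \<le> k" using Operation3_k4(11) by simp
  have "{{x, v}, {r, v}, {w, y}} = {{w1, v}, {w2, v}, {w, y}}" using arg_cong[OF xr(5), of "\<lambda>A. A \<union> {{w, y}}"]
    by (simp only: Un_insert_left sup_bot_left)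
  then show thesis
    using that[OF move3'[OF xr(1) 3 k5 y(1,2) w cw y(3)]]
      links_move3'[OF assms(1) xr(1) 3 y(1,2) w cw y(3)] Operation3_k4(1) xr(3) by simp
qed

lemma terminal_iff:
  assumes "valid c" "designated \<delta> c"
  shows "terminal k (V, E) \<delta> (part V c) \<longleftrightarrow> (\<nexists>L. move c L)"
  unfolding terminal_def using move_operation[OF assms] operation_move[OF assms] by metis

text \<open>Every partition that is reached belongs to a valid and designated map, and the potential
  plus the number of steps never exceeds the initial potential.\<close>

theorem operations_terminate_correctly:
  assumes "designation \<delta>"
  shows "\<not> approx1_diverges k (V, E) \<delta>"
    and "approx1_output k (V, E) \<delta> P \<Longrightarrow> star_partition k (V, E) P"
proof -
  have step: "\<exists>c'. valid c' \<and> designated \<delta> c' \<and> Q = part V c' \<and>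
      card (centers c') + card (pairs c') < card (centers c) + card (pairs c)"
    if c: "valid c" "designated \<delta> c" "operation k (V, E) \<delta> (part V c) Q" for c Q
  proof -
    obtain L where "move c L" "Q = part V (fold attach L c)"
      by (rule operation_move[OF c])
    then show ?thesis
      using move_progress[OF that(1)] designated_keeps[OF that(2)] by blast
  qed
  show "\<not> approx1_diverges k (V, E) \<delta>"
  proof
    assume "approx1_diverges k (V, E) \<delta>"
    then obtain f where f: "initial_partition k (V, E) (f 0)" "\<And>i. operation k (V, E) \<delta> (f i) (f (Suc i))"
      by (auto simp: approx1_diverges_def)
    then obtain c0 where c0: "valid c0" "designated \<delta> c0" "f 0 = part V c0"
      using star_partition_center_map[OF _ assms] by (metis initial_partition_def)
    let ?N = "card (centers c0) + card (pairs c0)"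
    have "\<exists>c. valid c \<and> designated \<delta> c \<and> f i = part V c \<and> card (centers c) + card (pairs c) + i \<le> ?N" for i
    proof (induction i)
      case 0
      then show ?case using c0 by auto
    next
      case (Suc i)
      then obtain c where c: "valid c" "designated \<delta> c" "f i = part V c"
        "card (centers c) + card (pairs c) + i \<le> ?N" by blast
      then show ?case using step[OF c(1,2)] f(2)[of i] by fastforce
    qed
    from this[of "Suc ?N"] show False by auto
  qed
  assume "approx1_output k (V, E) \<delta> P"
  then obtain P0 where "initial_partition k (V, E) P0" and steps: "(operation k (V, E) \<delta>)\<^sup>*\<^sup>* P0 P"
    by (auto simp: approx1_output_def)
  then obtain c0 where "valid c0" "designated \<delta> c0" "P0 = part V c0"
    using star_partition_center_map[OF _ assms] by (metis initial_partition_def)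
  from steps this have "\<exists>c. valid c \<and> designated \<delta> c \<and> P = part V c"
    by (induction rule: rtranclp_induct) (use step in blast)+
  then show "star_partition k (V, E) P" using star_partition_part by blast
qed

end

section \<open>Partitions with the fewest 1-stars\<close>

text \<open>Indexed by the center instead of a member: for a valid map the set is empty unless
  \<open>r\<close> is a center, so cardinality \<open>k\<close> says that \<open>r\<close> is the
  center of a \<open>k\<close>-star. The array ''sz'' stores these cardinalities.\<close>

definition fiber :: "'a set \<Rightarrow> ('a \<Rightarrow> 'a) \<Rightarrow> 'a \<Rightarrow> 'a set" where
  "fiber V c r = {v \<in> V. c v = r}"

context bounded_graph
begin

lemma finite_fiber: "finite (fiber V c r)"
  using finV by (simp add: fiber_def)

lemma fiber_center: "c r = r \<Longrightarrow> fiber V c r = star V c r"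
  by (simp add: fiber_def star_def)

lemma fiber_eq_star: "fiber V c (c v) = star V c v"
  by (simp add: fiber_def star_def)

lemma fiber_nonempty_center: "valid c \<Longrightarrow> fiber V c r \<noteq> {} \<Longrightarrow> c r = r"
  by (auto simp: fiber_def validD)

lemma full_center: "valid c \<Longrightarrow> card (fiber V c r) = k \<Longrightarrow> c r = r"
  using k4 by (intro fiber_nonempty_center) auto

lemma singlesD:
  assumes "valid c" "d \<in> singles V c"
  shows "d \<in> V" "c d = d" "star V c d = {d}"
  using assms center_in_star[of c d] by (auto simp: singles_def)

text \<open>A vertex of \<open>D\<close> that is not a 1-star of \<open>q\<close> shares its star with a vertex of \<open>S\<close>, and
  each \<open>s \<in> S\<close> serves at most \<open>k - 1\<close> vertices of \<open>D\<close> in this way.\<close>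

lemma singles_minimal:
  fixes S and c :: "'a \<Rightarrow> 'a"
  defines "D \<equiv> singles V c \<union> {x \<in> V. c x \<in> S \<and> c x \<noteq> x}"
  assumes "valid c" "S \<subseteq> V" "\<And>r. r \<in> S \<Longrightarrow> card (fiber V c r) = k"
    and nbrs: "\<And>d v. d \<in> D \<Longrightarrow> {d, v} \<in> E \<Longrightarrow> v \<in> S"
    and "valid q"
  shows "card (singles V c) \<le> card (singles V q)"
proof -
  have center: "c r = r" if "r \<in> S" for r using assms(4)[OF that] full_center[OF assms(2)] by blast
  have finS: "finite S" using assms(3) finV finite_subset by blast
  have finD: "finite D" using finV by (auto simp: D_def singles_def)
  have sats: "{x \<in> V. c x \<in> S \<and> c x \<noteq> x} = (\<Union>r\<in>S. fiber V c r - {r})"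
    using center by (auto simp: fiber_def)
  have "card (\<Union>r\<in>S. fiber V c r - {r}) = (\<Sum>r\<in>S. card (fiber V c r - {r}))"
    by (rule card_UN_disjoint) (use finS finite_fiber in \<open>auto simp: fiber_def\<close>)
  also have "\<dots> = (\<Sum>r\<in>S. k - 1)"
  proof (rule sum.cong)
    fix r assume "r \<in> S"
    then have "r \<in> fiber V c r" "card (fiber V c r) = k" using center assms(3,4) by (auto simp: fiber_def)
    then show "card (fiber V c r - {r}) = k - 1" by (simp add: finite_fiber)
  qed simp
  finally have card_sats: "card {x \<in> V. c x \<in> S \<and> c x \<noteq> x} = card S * (k - 1)" using sats by simp
  have "singles V c \<inter> {x \<in> V. c x \<in> S \<and> c x \<noteq> x} = {}"
    using singlesD(2)[OF assms(2)] by auto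
  then have card_D: "card D = card (singles V c) + card S * (k - 1)"
    unfolding D_def using finV card_sats by (subst card_Un_disjoint) (auto simp: singles_def)
  \<comment> \<open>A center of a \<open>k\<close>-star is neither a 1-star nor a satellite. Hence a
    vertex of \<open>D\<close> that shares its star with \<open>s\<close> differs from
    \<open>s\<close>.\<close>
  have disj: "s \<notin> D" if "s \<in> S" for s
  proof
    assume "s \<in> D"
    then have "s \<in> singles V c" using center[OF that] by (auto simp: D_def)
    then have "card (star V c s) = 1" by (auto simp: singles_def)
    then show False using assms(4)[OF that] fiber_center[of c s] center[OF that] k4 by simp
  qed
  \<comment> \<open>If \<open>d\<close> is not a 1-star of \<open>q\<close>, it has a neighbor in
    its star: its center, or some satellite if \<open>d\<close> is the center itself. That neighbor
    must lie in \<open>S\<close>.\<close>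
  define g where "g d = (if q d \<noteq> d then q d else (SOME x. x \<in> star V q d \<and> x \<noteq> d))" for d
  have DV: "d \<in> V" if "d \<in> D" for d using that by (auto simp: D_def singles_def)
  have g: "g d \<in> S \<and> (q d = d \<longrightarrow> q (g d) = d)" if d: "d \<in> D" "d \<notin> singles V q" for d
  proof (cases "q d = d")
    case False
    then have "{d, q d} \<in> E" using validD(3)[OF assms(6) DV[OF d(1)]] by simp
    then show ?thesis using nbrs[OF d(1)] False by (simp add: g_def)
  next
    case True
    have "\<exists>x. x \<in> star V q d \<and> x \<noteq> d"
      using d DV[OF d(1)] star_self[OF DV[OF d(1)], of q] by (auto simp: singles_def)
    then have "g d \<in> star V q d \<and> g d \<noteq> d" unfolding g_def using True by (simp add: someI_ex[of "\<lambda>x. x \<in> star V q d \<and> x \<noteq> d"])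
    then have *: "g d \<in> V" "q (g d) = d" "g d \<noteq> d" using True by (auto simp: star_def)
    then have "{g d, d} \<in> E" using validD(3)[OF assms(6) *(1)] by simp
    then show ?thesis using nbrs[OF d(1), of "g d"] * by (simp add: insert_commute)
  qed
  \<comment> \<open>If \<open>s\<close> is a center of \<open>q\<close>, all these vertices are
    satellites of \<open>s\<close>; otherwise the only possible one is the center of
    \<open>s\<close>.\<close>
  have le: "card {d \<in> D - singles V q. g d = s} \<le> k - 1" if s: "s \<in> S" for s
  proof (cases "q s = s")
    case True
    have "{d \<in> D - singles V q. g d = s} \<subseteq> star V q s - {s}"
    proof
      fix d assume d: "d \<in> {d \<in> D - singles V q. g d = s}"
      then have "d \<noteq> s" using disj[OF s] by auto
      then have "q d \<noteq> d" using g[of d] d True by auto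
      then have "q d = s" using d by (simp add: g_def)
      then show "d \<in> star V q s - {s}" using d DV[of d] True \<open>d \<noteq> s\<close> by (simp add: star_def)
    qed
    then have "card {d \<in> D - singles V q. g d = s} \<le> card (star V q s - {s})"
      by (intro card_mono) (auto simp: finite_star)
    also have "\<dots> \<le> k - 1"
      using s assms(3) validD(4)[OF assms(6), of s] star_self[of s q] by (auto simp: finite_star)
    finally show ?thesis .
  next
    case False
    have "{d \<in> D - singles V q. g d = s} \<subseteq> {q s}"
    proof
      fix d assume d: "d \<in> {d \<in> D - singles V q. g d = s}"
      have "q d = d"
      proof (rule ccontr)
        assume "q d \<noteq> d"
        then have "q d = s" using d by (simp add: g_def)
        then show False using False validD(2)[OF assms(6) DV[of d]] d by simp
      qed
      then show "d \<in> {q s}" using g[of d] d by auto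
    qed
    then have "card {d \<in> D - singles V q. g d = s} \<le> card {q s}" by (intro card_mono) auto
    then show ?thesis using k4 by simp
  qed
  have "D - singles V q = (\<Union>s\<in>S. {d \<in> D - singles V q. g d = s})" using g by auto
  then have "card (D - singles V q) = card (\<Union>s\<in>S. {d \<in> D - singles V q. g d = s})"
    by (rule arg_cong)
  also have "\<dots> \<le> (\<Sum>s\<in>S. card {d \<in> D - singles V q. g d = s})"
    by (rule card_UN_le[OF finS])
  also have "\<dots> \<le> card S * (k - 1)" using sum_bounded_above[of S _ "k - 1"] le by simp
  finally have "card (D - singles V q) \<le> card S * (k - 1)" .
  moreover have "card D - card (singles V q) \<le> card (D - singles V q)"
    using finV by (intro diff_card_le_card_Diff) (simp add: singles_def)
  ultimately show ?thesis using card_D by simp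
qed

lemma initial_partition_part:
  assumes "valid c" "\<And>q. valid q \<Longrightarrow> card (singles V c) \<le> card (singles V q)"
  shows "initial_partition k (V, E) (part V c)"
  unfolding initial_partition_def
proof (intro conjI allI impI)
  show "star_partition k (V, E) (part V c)" by (rule star_partition_part[OF assms(1)])
  fix Q assume Q: "star_partition k (V, E) Q"
  \<comment> \<open>Representing \<open>Q\<close> by a map takes some designation; the number of
    1-stars is the same for each.\<close>
  have "designation (\<lambda>e::'a set. SOME x. x \<in> e)"
    unfolding designation_def
  proof (intro allI impI)
    fix e :: "'a set" assume "card e = 2"
    then have "e \<noteq> {}" by auto
    then show "(SOME x. x \<in> e) \<in> e" by (simp add: some_in_eq)
  qed
  then obtain q where "valid q" "Q = part V q" using star_partition_center_map[OF Q] by metis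
  then show "num_1stars (part V c) \<le> num_1stars Q"
    using assms by (simp add: num_1stars_part)
qed

section \<open>Replacing a satellite and absorbing a 1-star\<close>

text \<open>One replacement in a chain. Only the fibers of \<open>s\<close>, \<open>d\<close> and
  \<open>x\<close> change; that of \<open>s\<close> keeps its size, and the other two have at most
  one vertex before and after. So the centers of \<open>k\<close>-stars stay the same, and what the
  search has found remains usable.\<close>

lemma shift:
  assumes "valid c" "d \<in> singles V c" "{d, s} \<in> E" "card (fiber V c s) = k"
    "x \<in> V" "c x = s" "x \<noteq> s"
  defines "c' \<equiv> c(d := s, x := x)"
  shows "valid c'" "card (singles V c') = card (singles V c)" "x \<in> singles V c'"
    "\<And>r. card (fiber V c' r) = k \<longleftrightarrow> card (fiber V c r) = k"
proof -
  note d = singlesD[OF assms(1,2)]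
  have s: "c s = s" "s \<in> V" using full_center[OF assms(1,4)] edgeD[OF assms(3)] by auto
  have ne: "d \<noteq> s" "d \<noteq> x" using edgeD[OF assms(3)] d assms(6,7) by auto
  have fd: "fiber V c d = {d}" using d by (simp add: fiber_center)
  have fx: "fiber V c x = {}"
    using fiber_nonempty_center[OF assms(1), of x] assms(6,7) by auto
  have f's: "fiber V c' s = insert d (fiber V c s - {x})"
    using ne assms(5-7) d by (auto simp: c'_def fiber_def)
  have f'd: "fiber V c' d = {}" using fd ne assms(6,7) by (auto simp: c'_def fiber_def)
  have f'x: "fiber V c' x = {x}" using fx ne assms(5-7) by (auto simp: c'_def fiber_def)
  have f'o: "fiber V c' r = fiber V c r" if "r \<noteq> s" "r \<noteq> d" "r \<noteq> x" for r
    using that d(2) assms(6) by (auto simp: c'_def fiber_def)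
  have xs: "x \<in> fiber V c s" "d \<notin> fiber V c s" using assms(5,6) d ne by (auto simp: fiber_def)
  have card_s: "card (fiber V c' s) = k"
    using xs assms(4) k4 by (simp add: f's finite_fiber)
  show full: "card (fiber V c' r) = k \<longleftrightarrow> card (fiber V c r) = k" for r
    using f's f'd f'x f'o[of r] fd fx card_s assms(4) k4 by (cases "r = s"; cases "r = d"; cases "r = x") auto
  have c'_out: "c y \<noteq> d \<and> c y \<noteq> x" if "y \<in> V" "y \<noteq> d" for y
  proof -
    have "c y \<noteq> d" using that fd by (auto simp: fiber_def)
    moreover have "c y \<noteq> x" using that fx by (auto simp: fiber_def)
    ultimately show ?thesis by simp
  qed
  have star': "star V c' y = fiber V c' (c' y)" for y by (simp add: star_def fiber_def)
  show "valid c'"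
    unfolding valid_def
  proof
    fix y assume y: "y \<in> V"
    have "card (star V c' y) \<le> k"
    proof (cases "c' y = s \<or> c' y = x \<or> c' y = d")
      case True
      then show ?thesis using card_s f'x f'd k4 by (auto simp: star')
    next
      case False
      then have "y \<noteq> x" "y \<noteq> d" by (auto simp: c'_def split: if_splits)
      then have "fiber V c' (c' y) = star V c y"
        using f'o[of "c' y"] False by (simp add: c'_def fiber_eq_star)
      then show ?thesis using validD(4)[OF assms(1) y] by (simp add: star')
    qed
    then show "c' y \<in> V \<and> c' (c' y) = c' y \<and> (c' y \<noteq> y \<longrightarrow> {y, c' y} \<in> E) \<and> card (star V c' y) \<le> k"
      using y s ne assms(3,5-7) validD[OF assms(1) y] c'_out[OF y] by (auto simp: c'_def)
  qed
  have c'x: "c' x = x" by (simp add: c'_def)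
  then show x: "x \<in> singles V c'" using f'x assms(5) by (simp add: singles_def star')
  have "singles V c' = insert x (singles V c - {d})"
  proof (intro set_eqI iffI)
    fix y assume y: "y \<in> singles V c'"
    then have yV: "y \<in> V" and st: "fiber V c' (c' y) = {y}" by (auto simp: singles_def star')
    show "y \<in> insert x (singles V c - {d})"
    proof (cases "y = x")
      case False
      have "c' y \<noteq> s" using st card_s k4 by auto
      then have "y \<noteq> d" using False by (auto simp: c'_def split: if_splits)
      then have "c' y = c y" "c y \<noteq> d" "c y \<noteq> x" using False c'_out[OF yV] by (auto simp: c'_def)
      then have "star V c y = {y}" using st f'o[of "c y"] \<open>c' y \<noteq> s\<close> by (simp add: fiber_eq_star)
      then show ?thesis using yV \<open>y \<noteq> d\<close> by (simp add: singles_def)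
    qed simp
  next
    fix y assume "y \<in> insert x (singles V c - {d})"
    then consider "y = x" | "y \<in> singles V c" "y \<noteq> d" "y \<noteq> x" by auto
    then show "y \<in> singles V c'"
    proof cases
      case 2
      note Y = singlesD[OF assms(1) 2(1)]
      have "y \<noteq> s" using Y assms(4) k4 by (auto simp: fiber_center)
      then have "fiber V c' y = fiber V c y" using f'o 2 by simp
      moreover have "c' y = y" using Y 2 by (simp add: c'_def)
      ultimately have "star V c' y = {y}"
        by (simp only: star' fiber_center[of c y, OF Y(2)] Y(3))
      then show ?thesis using Y(1) by (simp add: singles_def)
    qed (use x in simp)
  qed
  moreover have "x \<notin> singles V c" using assms(6,7) singlesD(2)[OF assms(1)] by auto
  moreover have fin: "finite (singles V c)" using finV by (simp add: singles_def)
  ultimately have "card (singles V c') = Suc (card (singles V c - {d}))" by simp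
  also have "\<dots> = card (singles V c)" by (rule card.remove[OF fin assms(2), symmetric])
  finally show "card (singles V c') = card (singles V c)" .
qed

text \<open>A satellite \<open>v\<close> of a star with at least three vertices can be spared and
  forms a 2-star with \<open>d\<close>. Otherwise \<open>v\<close> is a center with room left or
  lies in a 2-star, and \<open>d\<close> joins \<open>v\<close>.\<close>

lemma augment:
  assumes "valid c" "d \<in> singles V c" "{d, v} \<in> E" "card (fiber V c v) \<noteq> k"
  defines "c' \<equiv> (if c v \<noteq> v \<and> 2 < card (fiber V c (c v)) then attach (v, d) c else attach (d, v) c)"
  shows "valid c'" "card (singles V c') < card (singles V c)"
proof -
  note d = singlesD[OF assms(1,2)]
  have v: "v \<in> V" "v \<noteq> d" using edgeD[OF assms(3)] by auto
  have ne: "c v \<noteq> c d"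
  proof
    assume "c v = c d"
    then have "v \<in> star V c d" using v by (simp add: star_def)
    then show False using v d by simp
  qed
  have sv: "v \<in> star V c v" by (rule star_self[OF v(1)])
  have sub: "valid c' \<and> singles V c' \<subseteq> singles V c \<and> d \<notin> singles V c'"
  proof (cases "c v \<noteq> v \<and> 2 < card (fiber V c (c v))")
    case True
    then have c': "c' = attach (v, d) c" by (simp add: c'_def)
    have att: "attachable c v d"
      unfolding attachable_def using v d ne True assms(3) k4 by (simp add: insert_commute)
    note st = star_attach[OF assms(1) att, folded c']
    have "d \<notin> singles V c'" using st[OF d(1)] d v by (auto simp: singles_def)
    moreover have "y \<in> singles V c" if y: "y \<in> singles V c'" for y
    proof -
      have yV: "y \<in> V" and s1: "star V c' y = {y}" using y by (auto simp: singles_def)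
      have "\<not> (y = v \<or> y \<in> star V c d)" using st[OF yV] s1 d(3) v by auto
      then have eq: "star V c y - {v} = {y}" using st[OF yV] s1 by simp
      have "v \<notin> star V c y"
      proof
        assume "v \<in> star V c y"
        then have "star V c y = star V c v" by (simp add: star_def)
        then have "card (star V c y - {v}) = card (star V c v) - 1" using sv finite_star by simp
        then show False using eq conjunct2[OF True] by (simp add: fiber_eq_star)
      qed
      then show ?thesis using eq yV by (simp add: singles_def)
    qed
    ultimately show ?thesis using valid_attach[OF assms(1) att] c' by auto
  next
    case False
    then have c': "c' = attach (d, v) c" unfolding c'_def by (rule if_not_P)
    have small: "c v = v \<or> card (star V c v) = 2"
    proof (cases "c v = v")
      case False
      have "card {v, c v} \<le> card (star V c v)"
        using sv center_in_star[OF assms(1) v(1)] by (intro card_mono finite_star) auto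
      then show ?thesis using False \<open>\<not> (c v \<noteq> v \<and> _)\<close> by (simp add: fiber_eq_star)
    qed simp
    have "card (star V c v) < k"
      using small k4 validD(4)[OF assms(1) v(1)] assms(4) fiber_center[of c v] by auto
    then have att: "attachable c d v"
      unfolding attachable_def using v d ne assms(3) small by simp
    note st = star_attach[OF assms(1) att, folded c']
    have big: "insert d (star V c v) \<noteq> {y}" for y using sv v by auto
    have "d \<notin> singles V c'" using st[OF d(1)] big by (simp add: singles_def)
    moreover have "y \<in> singles V c" if y: "y \<in> singles V c'" for y
    proof -
      have yV: "y \<in> V" and s1: "star V c' y = {y}" using y by (auto simp: singles_def)
      have yd: "y \<noteq> d" "y \<notin> star V c v" using st[OF yV] s1 big by auto
      then have eq: "star V c y - {d} = {y}" using st[OF yV] s1 by simp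
      have "d \<notin> star V c y"
      proof
        assume "d \<in> star V c y"
        then have "y \<in> star V c d" using yV by (simp add: star_def)
        then show False using d yd by simp
      qed
      then show ?thesis using eq yV by (simp add: singles_def)
    qed
    ultimately show ?thesis using valid_attach[OF assms(1) att] c' by auto
  qed
  then show "valid c'" by blast
  have "singles V c' \<subset> singles V c" using sub assms(2) by blast
  then show "card (singles V c') < card (singles V c)"
    using finV by (intro psubset_card_mono) (auto simp: singles_def)
qed

end

section \<open>Programs with bounded loops\<close>

text \<open>With loops that run a counter from 0 to n - 1, the effect of a program is the total
  function \<open>run\<close> and its cost is a function of the syntax; derivations of
  \<open>exec\<close> are built once and for all in \<open>exec_compile\<close>.\<close>

datatype prog =
    PSkip
  | PWrite string aexp aexp
  | PSeq prog prog (infixr ";;" 60)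
  | PIf bexp prog prog
  | PFor string prog

abbreviation Var :: "string \<Rightarrow> aexp" where "Var x \<equiv> Read x (Lit 0)"

definition upd :: "string \<Rightarrow> nat \<Rightarrow> nat \<Rightarrow> mem \<Rightarrow> mem" where
  "upd x i v s = s(x := (s x)(i := v))"

lemma upd_apply: "upd x i v s y = (if y = x then (s x)(i := v) else s y)"
  by (simp add: upd_def)

primrec compile :: "prog \<Rightarrow> com" where
  "compile PSkip = Skip"
| "compile (PWrite x i a) = Write x i a"
| "compile (c ;; d) = Seq (compile c) (compile d)"
| "compile (PIf b c d) = If b (compile c) (compile d)"
| "compile (PFor x c) = Seq (Write x (Lit 0) (Lit 0))
     (While (Lt (Var x) (Var ''n'')) (Seq (compile c) (Write x (Lit 0) (Add (Var x) (Lit 1)))))"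

text \<open>A loop sets its counter from the recursion index, while the compiled program increments
  the stored value. The two agree because \<open>wf\<close> forbids the body to write the
  counter.\<close>

primrec run :: "nat \<Rightarrow> prog \<Rightarrow> mem \<Rightarrow> mem" where
  "run n PSkip s = s"
| "run n (PWrite x i a) s = upd x (aval i s) (aval a s) s"
| "run n (c ;; d) s = run n d (run n c s)"
| "run n (PIf b c d) s = (if bval b s then run n c s else run n d s)"
| "run n (PFor x c) s = rec_nat (upd x 0 0 s) (\<lambda>i s'. upd x 0 (Suc i) (run n c s')) n"

text \<open>A bound independent of the memory, so both branches of a conditional are added. A loop
  pays 3 for setting the counter and 6 for the last test; each round pays 6 for the test and 6 for
  the increment.\<close>

primrec cost :: "nat \<Rightarrow> prog \<Rightarrow> nat" where
  "cost n PSkip = 1"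
| "cost n (PWrite x i a) = 1 + acost i + acost a"
| "cost n (c ;; d) = cost n c + cost n d"
| "cost n (PIf b c d) = 1 + bcost b + cost n c + cost n d"
| "cost n (PFor x c) = 9 + n * (12 + cost n c)"

primrec depth :: "prog \<Rightarrow> nat" where
  "depth PSkip = 0"
| "depth (PWrite x i a) = 0"
| "depth (c ;; d) = max (depth c) (depth d)"
| "depth (PIf b c d) = max (depth c) (depth d)"
| "depth (PFor x c) = Suc (depth c)"

primrec writes :: "prog \<Rightarrow> string set" where
  "writes PSkip = {}"
| "writes (PWrite x i a) = {x}"
| "writes (c ;; d) = writes c \<union> writes d"
| "writes (PIf b c d) = writes c \<union> writes d"
| "writes (PFor x c) = insert x (writes c)"

text \<open>Expressions whose value exceeds the largest number in memory by at most \<open>n + 4\<close>; if only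
  such values are assigned, the running time bounds the numbers that occur.\<close>

fun grows_slowly :: "aexp \<Rightarrow> bool" where
  "grows_slowly (Lit m) \<longleftrightarrow> m \<le> 4"
| "grows_slowly (Read x i) \<longleftrightarrow> True"
| "grows_slowly (Add (Read x i) (Lit m)) \<longleftrightarrow> m \<le> 4"
| "grows_slowly (Add (Read x i) (Read y (Lit 0))) \<longleftrightarrow> y = ''n''"
| "grows_slowly _ \<longleftrightarrow> False"

primrec wf :: "prog \<Rightarrow> bool" where
  "wf PSkip \<longleftrightarrow> True"
| "wf (PWrite x i a) \<longleftrightarrow> x \<noteq> ''n'' \<and> grows_slowly a"
| "wf (c ;; d) \<longleftrightarrow> wf c \<and> wf d"
| "wf (PIf b c d) \<longleftrightarrow> wf c \<and> wf d"
| "wf (PFor x c) \<longleftrightarrow> x \<noteq> ''n'' \<and> x \<notin> writes c \<and> wf c"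

definition bounded :: "nat \<Rightarrow> mem \<Rightarrow> bool" where
  "bounded B s \<longleftrightarrow> (\<forall>x i. s x i \<le> B)"

lemma bounded_mono: "bounded B s \<Longrightarrow> B \<le> B' \<Longrightarrow> bounded B' s"
  by (auto simp: bounded_def intro: order_trans)

lemma bounded_upd: "bounded B s \<Longrightarrow> v \<le> B \<Longrightarrow> bounded B (upd x i v s)"
  by (simp add: bounded_def upd_apply)

lemma aval_bounded:
  "grows_slowly a \<Longrightarrow> bounded B s \<Longrightarrow> s ''n'' 0 = n \<Longrightarrow> aval a s \<le> B + (n + 4)"
  by (induction a rule: grows_slowly.induct)
    (auto simp: bounded_def intro: le_trans[OF _ le_add1] add_le_mono trans_le_add1)

lemma run_frame: "x \<notin> writes c \<Longrightarrow> run n c s x = s x"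
proof (induction c arbitrary: s)
  case (PFor y c)
  have "rec_nat (upd y 0 0 s) (\<lambda>i s'. upd y 0 (Suc i) (run n c s')) m x = s x" for m
    by (induction m) (use PFor in \<open>auto simp: upd_apply\<close>)
  then show ?case by simp
qed (auto simp: upd_apply)

lemma wf_writes: "wf c \<Longrightarrow> ''n'' \<notin> writes c"
  by (induction c) auto

lemma run_n: "wf c \<Longrightarrow> run n c s ''n'' = s ''n''"
  by (simp add: run_frame wf_writes)

text \<open>Each assignment raises the largest stored number by at most \<open>n + 4\<close>, and
  there are at most as many assignments as units of cost. So with this word size no assignment gets
  stuck.\<close>

lemma exec_compile:
  assumes "wf c" "s ''n'' 0 = n" "bounded B s" "B + (n + 4) * cost n c \<le> W"
  shows "\<exists>t\<le>cost n c. exec W (compile c) s t (run n c s) \<and> bounded (B + (n + 4) * cost n c) (run n c s)"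
  using assms
proof (induction c arbitrary: s B)
  case PSkip
  then show ?case by (auto intro!: exec.Skip exI[of _ 1] bounded_mono[of B])
next
  case (PWrite x i a)
  have "B + (n + 4) \<le> B + (n + 4) * cost n (PWrite x i a)" by simp
  moreover have v: "aval a s \<le> B + (n + 4)" using PWrite by (intro aval_bounded) auto
  ultimately have v': "aval a s \<le> B + (n + 4) * cost n (PWrite x i a)" by (rule order_trans[rotated])
  then have "aval a s \<le> W" using PWrite.prems(4) by (rule order_trans)
  then have "exec W (compile (PWrite x i a)) s (cost n (PWrite x i a)) (run n (PWrite x i a) s)"
    using exec.Write[of a s W x i] by (simp add: upd_def)
  moreover have "bounded (B + (n + 4) * cost n (PWrite x i a)) (run n (PWrite x i a) s)"
    unfolding run.simps by (intro bounded_upd v' bounded_mono[OF PWrite.prems(3)]) simp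
  ultimately show ?case by blast
next
  case (PSeq c d)
  have "B + (n + 4) * cost n c \<le> W" using PSeq.prems(4) by (simp add: algebra_simps)
  then obtain t1 where t1: "t1 \<le> cost n c" "exec W (compile c) s t1 (run n c s)"
    "bounded (B + (n + 4) * cost n c) (run n c s)" using PSeq by (metis wf.simps(3))
  have W2: "B + (n + 4) * cost n c + (n + 4) * cost n d \<le> W"
    using PSeq.prems(4) by (simp add: algebra_simps)
  have "run n c s ''n'' 0 = n" using PSeq.prems by (simp add: run_n)
  then obtain t2 where t2: "t2 \<le> cost n d" "exec W (compile d) (run n c s) t2 (run n d (run n c s))"
    "bounded (B + (n + 4) * cost n c + (n + 4) * cost n d) (run n d (run n c s))"
    using PSeq.IH(2)[OF _ _ t1(3) W2] PSeq.prems(1) by auto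
  then show ?case
    using t1 by (intro exI[of _ "t1 + t2"]) (auto simp: algebra_simps intro: exec.Seq)
next
  case (PIf b c d)
  have W: "B + (n + 4) * cost n c \<le> W" "B + (n + 4) * cost n d \<le> W"
    using PIf.prems(4) by (auto simp: algebra_simps)
  have le: "B + (n + 4) * cost n c \<le> B + (n + 4) * cost n (PIf b c d)"
    "B + (n + 4) * cost n d \<le> B + (n + 4) * cost n (PIf b c d)"
    by (auto simp: algebra_simps)
  show ?case
  proof (cases "bval b s")
    case True
    then obtain t where "t \<le> cost n c" "exec W (compile c) s t (run n c s)"
      "bounded (B + (n + 4) * cost n c) (run n c s)"
      using PIf.IH(1)[OF _ PIf.prems(2,3) W(1)] PIf.prems(1) by auto
    then show ?thesis using True le bounded_mono
      by (intro exI[of _ "1 + bcost b + t"]) (auto intro: exec.IfTrue[simplified])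
  next
    case False
    then obtain t where "t \<le> cost n d" "exec W (compile d) s t (run n d s)"
      "bounded (B + (n + 4) * cost n d) (run n d s)"
      using PIf.IH(2)[OF _ PIf.prems(2,3) W(2)] PIf.prems(1) by auto
    then show ?thesis using False le bounded_mono
      by (intro exI[of _ "1 + bcost b + t"]) (auto intro: exec.IfFalse[simplified])
  qed
next
  case (PFor x c)
  let ?b = "Lt (Var x) (Var ''n'')" and ?inc = "Write x (Lit 0) (Add (Var x) (Lit 1))"
  define st where "st j = rec_nat (upd x 0 0 s) (\<lambda>i s'. upd x 0 (Suc i) (run n c s')) j" for j
  define K where "K = 12 + cost n c"
  \<comment> \<open>\<open>bd j\<close> bounds the memory before round \<open>j\<close>; the 9
    covers what a loop spends outside its rounds.\<close>
  define bd where "bd j = B + (n + 4) * (9 + j * K)" for j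
  have x: "x \<noteq> ''n''" "x \<notin> writes c" "wf c" using PFor.prems(1) by auto
  have st_Suc: "st (Suc j) = upd x 0 (Suc j) (run n c (st j))" for j by (simp add: st_def)
  have st_n: "st j ''n'' 0 = n" for j
    by (induction j) (use PFor.prems(2) x in \<open>auto simp: st_def upd_apply run_n\<close>)
  have st_x: "st j x 0 = j" for j by (cases j) (auto simp: st_def upd_apply)
  have bd_W: "bd j \<le> W" if "j \<le> n" for j
  proof -
    have "bd j \<le> bd n" using that by (simp add: bd_def)
    also have "bd n = B + (n + 4) * cost n (PFor x c)" by (simp add: bd_def K_def)
    finally show ?thesis using PFor.prems(4) by simp
  qed
  have step: "\<exists>t\<le>cost n c. exec W (compile c) (st j) t (run n c (st j)) \<and>
      bounded (bd j + (n + 4) * cost n c) (run n c (st j))" if "j < n" "bounded (bd j) (st j)" for j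
  proof (rule PFor.IH)
    have "bd j + (n + 4) * cost n c \<le> bd (Suc j)" by (simp add: bd_def K_def algebra_simps)
    then show "bd j + (n + 4) * cost n c \<le> W" using bd_W[of "Suc j"] that by simp
  qed (use x st_n that in auto)
  have bds: "bounded (bd j) (st j)" if "j \<le> n" for j
    using that
  proof (induction j)
    case 0
    have "bounded (bd 0) s" by (rule bounded_mono[OF PFor.prems(3)]) (simp add: bd_def)
    then show ?case by (simp add: st_def bounded_upd)
  next
    case (Suc j)
    then have "bounded (bd j + (n + 4) * cost n c) (run n c (st j))" using step[of j] by auto
    then have "bounded (bd (Suc j)) (run n c (st j))"
      by (rule bounded_mono) (simp add: bd_def K_def algebra_simps)
    moreover have "Suc j \<le> bd (Suc j)"
      by (simp add: bd_def K_def algebra_simps)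
    ultimately show ?case by (simp add: st_Suc bounded_upd)
  qed
  \<comment> \<open>\<open>exec\<close> unrolls a loop from its first round, so the induction is on
    the number \<open>m\<close> of rounds that remain.\<close>
  have loop: "\<exists>t\<le>6 + m * K. exec W (While ?b (Seq (compile c) ?inc)) (st (n - m)) t (st n)" if "m \<le> n" for m
    using that
  proof (induction m)
    case 0
    have "exec W (While ?b (Seq (compile c) ?inc)) (st n) (1 + bcost ?b) (st n)"
      by (rule exec.WhileFalse) (simp add: st_x st_n)
    then show ?case by (intro exI[of _ "1 + bcost ?b"]) (simp del: One_nat_def)
  next
    case (Suc m)
    define j where "j = n - Suc m"
    have j: "j < n" "n - m = Suc j" using Suc.prems by (auto simp: j_def)
    obtain t1 where t1: "t1 \<le> cost n c" "exec W (compile c) (st j) t1 (run n c (st j))"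
      using step[OF j(1)] bds[of j] j by auto
    have rx: "run n c (st j) x 0 = j" using x st_x by (simp add: run_frame)
    have "Suc j \<le> bd (Suc j)" by (simp add: bd_def K_def algebra_simps)
    then have "Suc j \<le> W" using bd_W[of "Suc j"] j by simp
    then have inc: "exec W ?inc (run n c (st j)) (1 + acost (Lit 0) + acost (Add (Var x) (Lit 1))) (st (Suc j))"
      using exec.Write[of "Add (Var x) (Lit 1)" "run n c (st j)" W x "Lit 0"] rx
      by (simp add: st_Suc upd_def)
    note body = exec.Seq[OF t1(2) inc]
    obtain t2 where t2: "t2 \<le> 6 + m * K"
      "exec W (While ?b (Seq (compile c) ?inc)) (st (Suc j)) t2 (st n)"
      using Suc.IH Suc.prems j by auto
    have "exec W (While ?b (Seq (compile c) ?inc)) (st j) (1 + bcost ?b + (t1 + (1 + acost (Lit 0) + acost (Add (Var x) (Lit 1)))) + t2) (st n)"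
      by (rule exec.WhileTrue[OF _ body t2(2)]) (simp add: st_x st_n j)
    then show ?case
      using t1 t2 by (intro exI[of _ "1 + bcost ?b + (t1 + (1 + acost (Lit 0) + acost (Add (Var x) (Lit 1)))) + t2"]) (simp add: j_def[symmetric] K_def)
  qed
  obtain t where t: "t \<le> 6 + n * K" "exec W (While ?b (Seq (compile c) ?inc)) (st 0) t (st n)"
    using loop[of n] by auto
  have "exec W (Write x (Lit 0) (Lit 0)) s (1 + acost (Lit 0) + acost (Lit 0)) (st 0)"
    using exec.Write[of "Lit 0" s W x "Lit 0"] by (simp add: st_def upd_def)
  from exec.Seq[OF this t(2)]
  have "exec W (compile (PFor x c)) s (1 + acost (Lit 0) + acost (Lit 0) + t) (run n (PFor x c) s)"
    by (simp add: st_def)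
  moreover have "bd n = B + (n + 4) * cost n (PFor x c)" by (simp add: bd_def K_def)
  ultimately show ?case
    using t(1) bds[of n] by (intro exI[of _ "1 + acost (Lit 0) + acost (Lit 0) + t"]) (auto simp: K_def st_def)
qed

text \<open>Each nested loop contributes one factor. The base is \<open>n + 1\<close> so that
  constant costs are covered for \<open>n = 0\<close> as well.\<close>

lemma cost_depth: "\<exists>C. \<forall>n. cost n c \<le> C * (n + 1) ^ depth c"
proof (induction c)
  case (PSeq c d)
  then obtain C D where CD: "\<And>n. cost n c \<le> C * (n + 1) ^ depth c" "\<And>n. cost n d \<le> D * (n + 1) ^ depth d"
    by auto
  have "cost n (c ;; d) \<le> (C + D) * (n + 1) ^ depth (c ;; d)" for n
  proof -
    have "C * (n + 1) ^ depth c \<le> C * (n + 1) ^ depth (c ;; d)"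
      "D * (n + 1) ^ depth d \<le> D * (n + 1) ^ depth (c ;; d)"
      by (intro mult_left_mono power_increasing; simp)+
    then show ?thesis
      unfolding cost.simps add_mult_distrib by (meson CD add_mono order_trans)
  qed
  then show ?case by blast
next
  case (PIf b c d)
  then obtain C D where CD: "\<And>n. cost n c \<le> C * (n + 1) ^ depth c" "\<And>n. cost n d \<le> D * (n + 1) ^ depth d"
    by auto
  have "cost n (PIf b c d) \<le> (C + D + 1 + bcost b) * (n + 1) ^ depth (PIf b c d)" for n
  proof -
    have "C * (n + 1) ^ depth c \<le> C * (n + 1) ^ depth (PIf b c d)"
      "D * (n + 1) ^ depth d \<le> D * (n + 1) ^ depth (PIf b c d)"
      by (intro mult_left_mono power_increasing; simp)+
    moreover have "(1 + bcost b) * 1 \<le> (1 + bcost b) * (n + 1) ^ depth (PIf b c d)"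
      by (intro mult_left_mono) simp_all
    ultimately show ?thesis using CD[of n] unfolding cost.simps add_mult_distrib by linarith
  qed
  then show ?case by blast
next
  case (PFor x c)
  then obtain C where C: "\<And>n. cost n c \<le> C * (n + 1) ^ depth c" by auto
  \<comment> \<open>21 is 9 for the loop itself plus 12 for each round.\<close>
  have "cost n (PFor x c) \<le> (21 + C) * (n + 1) ^ depth (PFor x c)" for n
  proof -
    have one: "1 \<le> (n + 1) ^ depth c" by simp
    have "n * (12 + cost n c) \<le> (n + 1) * ((12 + C) * (n + 1) ^ depth c)"
    proof (rule mult_mono)
      have "12 * 1 \<le> 12 * (n + 1) ^ depth c" using one by (intro mult_left_mono) simp_all
      then show "12 + cost n c \<le> (12 + C) * (n + 1) ^ depth c" using C[of n]
        unfolding add_mult_distrib by linarith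
    qed simp_all
    moreover have "9 * 1 \<le> 9 * (n + 1) ^ depth (PFor x c)"
      by (intro mult_left_mono one_le_power) simp_all
    ultimately show ?thesis by (simp add: algebra_simps)
  qed
  then show ?case by blast
qed (auto intro!: exI[of _ 1] exI[of _ "1 + acost _ + acost _"])

text \<open>\<open>I i\<close> is claimed when the counter already holds \<open>i\<close>, which is
  why both premises include the counter update.\<close>

lemma run_PFor:
  assumes "I 0 (upd x 0 0 s)"
    and "\<And>i s. i < n \<Longrightarrow> I i s \<Longrightarrow> s x 0 = i \<Longrightarrow> I (Suc i) (upd x 0 (Suc i) (run n c s))"
  shows "I n (run n (PFor x c) s)"
proof -
  let ?st = "\<lambda>j. rec_nat (upd x 0 0 s) (\<lambda>i s'. upd x 0 (Suc i) (run n c s')) j"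
  have x: "?st j x 0 = j" for j by (cases j) (auto simp: upd_apply)
  have "j \<le> n \<Longrightarrow> I j (?st j)" for j
  proof (induction j)
    case (Suc j)
    then show ?case using assms(2)[of j "?st j"] x[of j] by simp
  qed (use assms(1) in simp)
  then show ?thesis by simp
qed

section \<open>Computing the initial partition\<close>

definition Eq :: "aexp \<Rightarrow> aexp \<Rightarrow> bexp" where
  "Eq a b = Conj (Neg (Lt a b)) (Neg (Lt b a))"

text \<open>The machine cannot multiply; the offset of a row of the matrix is looked up in ''row'',
  a table of the multiples of \<open>n\<close>.\<close>

definition Adj :: "aexp \<Rightarrow> aexp \<Rightarrow> bexp" where
  "Adj u v = Lt (Lit 0) (Read ''adj'' (Add (Read ''row'' u) v))"

lemma bval_Eq [simp]: "bval (Eq a b) s \<longleftrightarrow> aval a s = aval b s"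
  by (auto simp: Eq_def)

definition input_stored :: "nat \<Rightarrow> nat \<Rightarrow> nat set set \<Rightarrow> mem \<Rightarrow> bool" where
  "input_stored k n E s \<longleftrightarrow> s ''n'' 0 = n \<and> s ''k'' 0 = k \<and> (\<forall>u<n. s ''row'' u = u * n) \<and>
     (\<forall>u<n. \<forall>v<n. s ''adj'' (u * n + v) = (if {u, v} \<in> E then 1 else 0))"

lemma bval_Adj:
  "input_stored k n E s \<Longrightarrow> aval u s < n \<Longrightarrow> aval v s < n \<Longrightarrow>
    bval (Adj u v) s \<longleftrightarrow> {aval u s, aval v s} \<in> E"
  by (simp add: Adj_def input_stored_def)

definition same :: "string set \<Rightarrow> mem \<Rightarrow> mem \<Rightarrow> bool" where
  "same X s t \<longleftrightarrow> (\<forall>x. x \<notin> X \<longrightarrow> t x = s x)"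

lemma sameD: "same X s t \<Longrightarrow> x \<notin> X \<Longrightarrow> t x = s x"
  by (simp add: same_def)

lemma same_refl: "same X s s"
  by (simp add: same_def)

lemma same_upd: "same X s t \<Longrightarrow> x \<in> X \<Longrightarrow> same X s (upd x i v t)"
  by (auto simp: same_def upd_apply)

lemma same_run: "same X s t \<Longrightarrow> writes c \<subseteq> X \<Longrightarrow> same X s (run n c t)"
  unfolding same_def using run_frame by (metis subsetD)

lemma input_stored_same:
  "input_stored k n E s \<Longrightarrow> same X s t \<Longrightarrow> X \<inter> {''n'', ''k'', ''row'', ''adj''} = {} \<Longrightarrow> input_stored k n E t"
  unfolding input_stored_def same_def by (metis disjoint_iff insertI1 insertI2)

definition initialize :: prog where
  "initialize = PFor ''i'' (
     PWrite ''row'' (Add (Var ''i'') (Lit 1)) (Add (Read ''row'' (Var ''i'')) (Var ''n'')) ;;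
     PWrite ''ctr'' (Var ''i'') (Var ''i''))"

lemma run_initialize:
  fixes k :: nat
  assumes "simple_graph ({..<n}, E)"
  defines "s \<equiv> run n initialize (input_mem k n E)"
  shows "input_stored k n E s" "\<forall>u<n. s ''ctr'' u = u"
proof -
  \<comment> \<open>Entry 0 of ''row'' is 0 in the input memory, and round \<open>i\<close> writes
    entry \<open>i + 1\<close>; hence the range \<open>u \<le> i\<close>.\<close>
  define I where "I i s \<longleftrightarrow> same {''row'', ''ctr'', ''i''} (input_mem k n E) s \<and>
      (\<forall>u\<le>i. s ''row'' u = u * n) \<and> (\<forall>u<i. s ''ctr'' u = u)" for i s
  have "I n s"
    unfolding s_def initialize_def
  proof (rule run_PFor)
    show "I 0 (upd ''i'' 0 0 (input_mem k n E))"
      unfolding I_def by (auto simp: upd_apply input_mem_def intro!: same_upd same_refl)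
    fix i t assume t: "i < n" "I i t" "t ''i'' 0 = i"
    have "t ''n'' = input_mem k n E ''n''"
      using t(2) unfolding I_def by (elim conjE) (erule sameD, simp)
    then have "t ''n'' 0 = n" by (simp add: input_mem_def)
    then show "I (Suc i) (upd ''i'' 0 (Suc i) (run n
       (PWrite ''row'' (Add (Var ''i'') (Lit 1)) (Add (Read ''row'' (Var ''i'')) (Var ''n'')) ;;
        PWrite ''ctr'' (Var ''i'') (Var ''i'')) t))"
      using t unfolding I_def by (auto simp: upd_apply le_Suc_eq less_Suc_eq intro!: same_upd)
  qed
  then have same: "same {''row'', ''ctr'', ''i''} (input_mem k n E) s"
    and row: "\<forall>u\<le>n. s ''row'' u = u * n" and ctr: "\<forall>u<n. s ''ctr'' u = u"
    unfolding I_def by auto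
  have "s ''n'' = input_mem k n E ''n''" "s ''k'' = input_mem k n E ''k''"
    "s ''adj'' = input_mem k n E ''adj''"
    by (rule sameD[OF same], simp)+
  moreover have "u * n + v < n * n" if "u < n" "v < n" for u v
  proof -
    have "u * n + v < Suc u * n" using that by simp
    also have "\<dots> \<le> n * n" using that by (intro mult_le_mono1) simp
    finally show ?thesis .
  qed
  ultimately show "input_stored k n E s"
    using row by (simp add: input_stored_def input_mem_def)
  show "\<forall>u<n. s ''ctr'' u = u" by (rule ctr)
qed

definition sizes :: prog where
  "sizes = PFor ''i'' (PWrite ''sz'' (Var ''i'') (Lit 0)) ;;
     PFor ''i'' (PWrite ''sz'' (Read ''ctr'' (Var ''i'')) (Add (Read ''sz'' (Read ''ctr'' (Var ''i''))) (Lit 1)))"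

lemma writes_sizes: "writes sizes = {''i'', ''sz''}"
  by (auto simp: sizes_def)

lemma run_sizes:
  assumes "r < n"
  shows "run n sizes s ''sz'' r = card (fiber {..<n} (s ''ctr'') r)"
proof -
  let ?z = "PFor ''i'' (PWrite ''sz'' (Var ''i'') (Lit 0))"
  have "\<forall>r<n. run n ?z s ''sz'' r = 0"
    by (rule run_PFor[where I = "\<lambda>i s. \<forall>r<i. s ''sz'' r = 0"]) (auto simp: upd_apply less_Suc_eq)
  then have z: "run n ?z s ''sz'' r = 0" using assms by simp
  have c: "run n ?z s ''ctr'' = s ''ctr''" by (rule run_frame) simp
  let ?c = "s ''ctr''"
  define I where "I i t \<longleftrightarrow> t ''ctr'' = ?c \<and> t ''sz'' r = card {v \<in> {..<i}. ?c v = r}" for i t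
  have "I n (run n sizes s)"
    unfolding sizes_def run.simps(3)
  proof (rule run_PFor)
    show "I 0 (upd ''i'' 0 0 (run n ?z s))" using z c by (simp add: I_def upd_apply)
    fix i t assume t: "i < n" "I i t" "t ''i'' 0 = i"
    have "{v \<in> {..<Suc i}. ?c v = r} =
        (if ?c i = r then insert i {v \<in> {..<i}. ?c v = r} else {v \<in> {..<i}. ?c v = r})"
      by (auto simp: less_Suc_eq)
    then show "I (Suc i) (upd ''i'' 0 (Suc i) (run n (PWrite ''sz'' (Read ''ctr'' (Var ''i''))
        (Add (Read ''sz'' (Read ''ctr'' (Var ''i''))) (Lit 1))) t))"
      using t by (auto simp: I_def upd_apply)
  qed
  then show ?thesis by (simp add: I_def fiber_def)
qed

lemma inj_on_push:
  fixes m :: nat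
  assumes "inj_on q {..<m}" "x \<notin> q ` {..<m}"
  shows "inj_on (q(m := x)) {..<Suc m}"
proof (rule inj_onI)
  fix a b assume ab: "a \<in> {..<Suc m}" "b \<in> {..<Suc m}" "(q(m := x)) a = (q(m := x)) b"
  have "q a \<noteq> x" if "a < m" for a using assms(2) that by blast
  then show "a = b"
    using ab inj_onD[OF assms(1), of a b] by (cases "a = m"; cases "b = m") (auto simp: less_Suc_eq)
qed

section \<open>The breadth-first search and its invariant\<close>

locale nat_graph = bounded_graph k "{..<n}" E for k n :: nat and E :: "nat set set"
begin

abbreviation fib :: "(nat \<Rightarrow> nat) \<Rightarrow> nat \<Rightarrow> nat set" where
  "fib c r \<equiv> fiber {..<n} c r"

lemma card_fiber_le: 
  assumes "valid c" shows "card (fib c r) \<le> k"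
proof (cases "fib c r = {}")
  case False
  then obtain v where "v < n" "c v = r" by (auto simp: fiber_def)
  then show ?thesis using validD(4)[OF assms, of v] fiber_eq_star[of c v] by simp
qed simp

text \<open>A breadth-first search from the vertices that are not centers of \<open>k\<close>-stars, which could
  absorb a 1-star at once. \<open>nxt y\<close> is the vertex that a 1-star \<open>y\<close> would join; if that is the
  center \<open>r\<close> of a \<open>k\<close>-star, then \<open>rel r\<close> is the satellite it would release in exchange.
  Unset entries are \<open>nxt y = y\<close> and \<open>rel r = n\<close>. In the invariant, the queue \<open>q\<close> of length \<open>qt\<close> has
  been scanned up to entry \<open>h\<close> and neighbor \<open>j\<close>.\<close>

definition search_inv where
  "search_inv c nxt rel q qt h j \<longleftrightarrow>
     inj_on q {..<qt} \<and> q ` {..<qt} = {v. v < n \<and> (card (fib c v) < k \<or> rel v < n)} \<and>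
     (\<forall>y<n. nxt y \<noteq> y \<longrightarrow> (\<exists>p<qt. nxt y = q p \<and> {y, q p} \<in> E)) \<and>
     (\<forall>r<n. rel r < n \<longrightarrow> card (fib c r) = k \<and> c (rel r) = r \<and> rel r \<noteq> r \<and> nxt (rel r) \<noteq> rel r \<and>
        (\<exists>p p'. p < p' \<and> p' < qt \<and> r = q p' \<and> nxt (rel r) = q p)) \<and>
     (\<forall>p<qt. \<forall>y<n. (p < h \<or> p = h \<and> y < j) \<longrightarrow> {y, q p} \<in> E \<longrightarrow> nxt y \<noteq> y) \<and>
     (\<forall>y<n. nxt y \<noteq> y \<longrightarrow> c y \<noteq> y \<longrightarrow> card (fib c (c y)) = k \<longrightarrow> rel (c y) < n)"

lemma search_invD:
  assumes "search_inv c nxt rel q qt h j"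
  shows "inj_on q {..<qt}" "q ` {..<qt} = {v. v < n \<and> (card (fib c v) < k \<or> rel v < n)}"
    and "\<And>y. y < n \<Longrightarrow> nxt y \<noteq> y \<Longrightarrow> \<exists>p<qt. nxt y = q p \<and> {y, q p} \<in> E"
    and "\<And>r. r < n \<Longrightarrow> rel r < n \<Longrightarrow> card (fib c r) = k \<and> c (rel r) = r \<and> rel r \<noteq> r \<and> nxt (rel r) \<noteq> rel r \<and>
        (\<exists>p p'. p < p' \<and> p' < qt \<and> r = q p' \<and> nxt (rel r) = q p)"
    and "\<And>p y. p < qt \<Longrightarrow> y < n \<Longrightarrow> p < h \<or> p = h \<and> y < j \<Longrightarrow> {y, q p} \<in> E \<Longrightarrow> nxt y \<noteq> y"
    and "\<And>y. y < n \<Longrightarrow> nxt y \<noteq> y \<Longrightarrow> c y \<noteq> y \<Longrightarrow> card (fib c (c y)) = k \<Longrightarrow> rel (c y) < n"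
  using assms unfolding search_inv_def by blast+

lemma search_inv_skip:
  assumes "search_inv c nxt rel q qt h j" "\<not> ({j, q h} \<in> E \<and> nxt j = j)"
  shows "search_inv c nxt rel q qt h (Suc j)"
  using assms unfolding search_inv_def by (auto simp: less_Suc_eq)

lemma search_inv_row:
  assumes "search_inv c nxt rel q qt h n" shows "search_inv c nxt rel q qt (Suc h) 0"
  using assms unfolding search_inv_def by (auto simp: less_Suc_eq)

text \<open>Nothing is claimed beyond the end of the queue, so the outer loop may run
  \<open>n\<close> rounds for every queue length.\<close>

lemma search_inv_end:
  assumes "search_inv c nxt rel q qt h 0" "qt \<le> h" shows "search_inv c nxt rel q qt (Suc h) 0"
  using assms unfolding search_inv_def by (auto simp: less_Suc_eq)

text \<open>Nothing is queued, for one of three reasons: the star of \<open>j\<close> is not a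
  \<open>k\<close>-star, \<open>j\<close> is its center, or its center already has a satellite to
  release.\<close>

lemma search_inv_mark:
  assumes inv: "search_inv c nxt rel q qt h j" and "h < qt" "{j, q h} \<in> E" "nxt j = j"
    and "\<not> (card (fib c (c j)) = k \<and> c j \<noteq> j \<and> \<not> rel (c j) < n)"
  shows "search_inv c (nxt(j := q h)) rel q qt h (Suc j)"
proof -
  note D = search_invD[OF inv]
  have j: "j < n" "q h \<noteq> j" using edgeD[OF assms(3)] by auto
  show ?thesis
    unfolding search_inv_def
  proof (intro conjI allI impI)
    fix y assume y: "y < n" "(nxt(j := q h)) y \<noteq> y"
    show "\<exists>p<qt. (nxt(j := q h)) y = q p \<and> {y, q p} \<in> E"
    proof (cases "y = j")
      case True then show ?thesis using assms(2,3) by auto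
    next
      case False then show ?thesis using D(3)[OF y(1)] y(2) by simp
    qed
  next
    fix r assume r: "r < n" "rel r < n"
    have "rel r \<noteq> j" using D(4)[OF r] assms(4) by auto
    then show "card (fib c r) = k" "c (rel r) = r" "rel r \<noteq> r" "(nxt(j := q h)) (rel r) \<noteq> rel r"
      "\<exists>p p'. p < p' \<and> p' < qt \<and> r = q p' \<and> (nxt(j := q h)) (rel r) = q p"
      using D(4)[OF r] by auto
  next
    fix p y assume "p < qt" "y < n" "p < h \<or> p = h \<and> y < Suc j" "{y, q p} \<in> E"
    then show "(nxt(j := q h)) y \<noteq> y" using D(5)[of p y] j by (auto simp: less_Suc_eq)
  next
    fix y assume "y < n" "(nxt(j := q h)) y \<noteq> y" "c y \<noteq> y" "card (fib c (c y)) = k"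
    then show "rel (c y) < n" using D(6)[of y] assms(5) by (cases "y = j") auto
  qed (use D(1,2) in auto)
qed

text \<open>The center \<open>c j\<close> enters at position \<open>qt\<close>, behind position
  \<open>h\<close> of the vertex that its released satellite \<open>j\<close> would join. So
  positions decrease along a chain, which bounds its length.\<close>

lemma search_inv_push:
  assumes inv: "search_inv c nxt rel q qt h j" and "valid c" "h < qt" "{j, q h} \<in> E" "nxt j = j"
    and cj: "card (fib c (c j)) = k" "c j \<noteq> j" "\<not> rel (c j) < n"
  shows "search_inv c (nxt(j := q h)) (rel(c j := j)) (q(qt := c j)) (Suc qt) h (Suc j)"
proof -
  note D = search_invD[OF inv]
  have j: "j < n" "q h \<noteq> j" using edgeD[OF assms(4)] by auto
  have cjn: "c j < n" using validD(1)[OF assms(2), of j] j by simp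
  have new: "c j \<notin> q ` {..<qt}" unfolding D(2) using cj by simp
  let ?q = "q(qt := c j)" and ?nxt = "nxt(j := q h)" and ?rel = "rel(c j := j)"
  have q: "?q p = q p" if "p < qt" for p using that by simp
  show ?thesis
    unfolding search_inv_def
  proof (intro conjI allI impI)
    show "inj_on ?q {..<Suc qt}"
      by (rule inj_on_push[OF D(1) new])
    have "?q ` {..<Suc qt} = insert (c j) (q ` {..<qt})" by (auto simp: lessThan_Suc)
    then show "?q ` {..<Suc qt} = {v. v < n \<and> (card (fib c v) < k \<or> ?rel v < n)}"
      unfolding D(2) using cjn j by auto
  next
    fix y assume y: "y < n" "?nxt y \<noteq> y"
    have "\<exists>p<qt. ?nxt y = q p \<and> {y, q p} \<in> E"
    proof (cases "y = j")
      case True then show ?thesis using assms(3,4) by auto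
    next
      case False then show ?thesis using D(3)[OF y(1)] y(2) by simp
    qed
    then show "\<exists>p<Suc qt. ?nxt y = ?q p \<and> {y, ?q p} \<in> E" using q by (metis less_Suc_eq)
  next
    fix r assume r: "r < n" "?rel r < n"
    have "card (fib c r) = k \<and> c (?rel r) = r \<and> ?rel r \<noteq> r \<and> ?nxt (?rel r) \<noteq> ?rel r \<and>
      (\<exists>p p'. p < p' \<and> p' < Suc qt \<and> r = ?q p' \<and> ?nxt (?rel r) = ?q p)"
    proof (cases "r = c j")
      case True
      have "h < qt \<and> qt < Suc qt \<and> r = ?q qt \<and> ?nxt (?rel r) = ?q h" using True assms(3) by simp
      moreover have "card (fib c r) = k \<and> c (?rel r) = r \<and> ?rel r \<noteq> r \<and> ?nxt (?rel r) \<noteq> ?rel r"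
        using True cj j by auto
      ultimately show ?thesis by blast
    next
      case False
      then have r': "rel r < n" using r by simp
      obtain p p' where p: "p < p'" "p' < qt" "r = q p'" "nxt (rel r) = q p" using D(4)[OF r(1) r'] by blast
      have "rel r \<noteq> j" using D(4)[OF r(1) r'] assms(5) by auto
      moreover from this have "p < p' \<and> p' < Suc qt \<and> r = ?q p' \<and> ?nxt (?rel r) = ?q p"
        using p False by simp
      ultimately show ?thesis using D(4)[OF r(1) r'] False by (intro conjI exI[of _ p] exI[of _ p']) auto
    qed
    then show "card (fib c r) = k" "c (?rel r) = r" "?rel r \<noteq> r" "?nxt (?rel r) \<noteq> ?rel r"
      "\<exists>p p'. p < p' \<and> p' < Suc qt \<and> r = ?q p' \<and> ?nxt (?rel r) = ?q p" by blast+
  next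
    fix p y assume "p < Suc qt" "y < n" "p < h \<or> p = h \<and> y < Suc j" "{y, ?q p} \<in> E"
    moreover from this have "p < qt" using assms(3) by auto
    ultimately show "?nxt y \<noteq> y" using D(5)[of p y] j by (auto simp: less_Suc_eq)
  next
    fix y assume "y < n" "?nxt y \<noteq> y" "c y \<noteq> y" "card (fib c (c y)) = k"
    then show "?rel (c y) < n" using D(6)[of y] j by (cases "y = j") auto
  qed
qed

text \<open>No vertex is queued twice, so \<open>n\<close> rounds of scanning exhaust the
  queue.\<close>

lemma queue_length:
  assumes "search_inv c nxt rel q qt h j" shows "qt \<le> n"
proof -
  have "card (q ` {..<qt}) \<le> card {..<n}"
    using search_invD(2)[OF assms] by (intro card_mono) auto
  then show ?thesis using search_invD(1)[OF assms] by (simp add: card_image)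
qed

text \<open>All entries have been scanned by now: had a neighbor of \<open>y\<close> been queued,
  then \<open>y\<close> would have been marked.\<close>

lemma search_complete:
  assumes "search_inv c nxt rel q qt n 0" "valid c" "y < n" "nxt y = y" "{y, v} \<in> E"
  shows "card (fib c v) = k \<and> \<not> rel v < n"
proof (rule ccontr)
  assume neg: "\<not> (card (fib c v) = k \<and> \<not> rel v < n)"
  have "v < n" using edgeD[OF assms(5)] by simp
  then have "v \<in> q ` {..<qt}"
    using neg card_fiber_le[OF assms(2), of v] unfolding search_invD(2)[OF assms(1)] by auto
  then obtain p where p: "p < qt" "v = q p" by auto
  then have "p < n" using queue_length[OF assms(1)] by simp
  then show False using search_invD(5)[OF assms(1) p(1) assms(3)] assms(4,5) p by simp
qed

lemma search_fails_minimal: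
  assumes "search_inv c nxt rel q qt n 0" "valid c" "\<And>d. d \<in> singles {..<n} c \<Longrightarrow> nxt d = d" "valid q'"
  shows "card (singles {..<n} c) \<le> card (singles {..<n} q')"
\<comment> \<open>\<open>S\<close> consists of the centers of \<open>k\<close>-stars that were not
  reached. A marked satellite would have caused its center to be queued, so satellites of
  \<open>S\<close> are unmarked, like the 1-stars.\<close>
proof (rule singles_minimal[where S = "{r. r < n \<and> card (fib c r) = k \<and> \<not> rel r < n}"])
  fix d v
  assume d: "d \<in> singles {..<n} c \<union> {x \<in> {..<n}. c x \<in> {r. r < n \<and> card (fib c r) = k \<and> \<not> rel r < n} \<and> c x \<noteq> x}"
    and e: "{d, v} \<in> E"
  then have "nxt d = d" using assms(3) search_invD(6)[OF assms(1), of d] by auto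
  then show "v \<in> {r. r < n \<and> card (fib c r) = k \<and> \<not> rel r < n}"
    using search_complete[OF assms(1,2) _ _ e] edgeD[OF e] by auto
qed (use assms in auto)

end

section \<open>Programs for one round of augmentation\<close>

definition prepare :: prog where
  "prepare = PWrite ''qt'' (Lit 0) (Lit 0) ;; PFor ''i'' (
     PWrite ''nxt'' (Var ''i'') (Var ''i'') ;;
     PWrite ''rel'' (Var ''i'') (Var ''n'') ;;
     PIf (Lt (Read ''sz'' (Var ''i'')) (Var ''k''))
       (PWrite ''q'' (Var ''qt'') (Var ''i'') ;; PWrite ''qt'' (Lit 0) (Add (Var ''qt'') (Lit 1)))
       PSkip)"

definition scan_edge :: prog where
  "scan_edge = PIf (Conj (Adj (Var ''j'') (Read ''q'' (Var ''h''))) (Eq (Read ''nxt'' (Var ''j'')) (Var ''j'')))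
     (PWrite ''nxt'' (Var ''j'') (Read ''q'' (Var ''h'')) ;;
      PIf (Conj (Neg (Lt (Read ''sz'' (Read ''ctr'' (Var ''j''))) (Var ''k'')))
             (Conj (Neg (Eq (Read ''ctr'' (Var ''j'')) (Var ''j'')))
                (Neg (Lt (Read ''rel'' (Read ''ctr'' (Var ''j''))) (Var ''n'')))))
        (PWrite ''rel'' (Read ''ctr'' (Var ''j'')) (Var ''j'') ;;
         PWrite ''q'' (Var ''qt'') (Read ''ctr'' (Var ''j'')) ;;
         PWrite ''qt'' (Lit 0) (Add (Var ''qt'') (Lit 1)))
        PSkip)
     PSkip"

definition scan :: prog where
  "scan = PFor ''h'' (PIf (Lt (Var ''h'') (Var ''qt'')) (PFor ''j'' scan_edge) PSkip)"

definition pick :: prog where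
  "pick = PWrite ''d'' (Lit 0) (Var ''n'') ;;
     PFor ''i'' (PIf (Conj (Eq (Read ''sz'' (Var ''i'')) (Lit 1)) (Neg (Eq (Read ''nxt'' (Var ''i'')) (Var ''i''))))
       (PWrite ''d'' (Lit 0) (Var ''i'')) PSkip)"

text \<open>After the last replacement the test fails and nothing changes any more, so the walk can
  be given \<open>n\<close> rounds whatever the length of the chain.\<close>

definition walk_step :: prog where
  "walk_step = PIf (Lt (Read ''rel'' (Read ''nxt'' (Var ''d''))) (Var ''n''))
     (PWrite ''x'' (Lit 0) (Read ''rel'' (Read ''nxt'' (Var ''d''))) ;;
      PWrite ''ctr'' (Var ''d'') (Read ''nxt'' (Var ''d'')) ;;
      PWrite ''ctr'' (Var ''x'') (Var ''x'') ;;
      PWrite ''d'' (Lit 0) (Var ''x'')) PSkip"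

definition attach_prog :: "aexp \<Rightarrow> aexp \<Rightarrow> prog" where
  "attach_prog v w = PWrite ''ctr'' (Read ''ctr'' w) w ;; PWrite ''ctr'' w w ;; PWrite ''ctr'' v w"

text \<open>The walk has changed \<open>ctr\<close>, so the sizes that decide between the two
  attachments are computed anew.\<close>

definition join :: prog where
  "join = PWrite ''x'' (Lit 0) (Read ''nxt'' (Var ''d'')) ;; sizes ;;
     PIf (Conj (Neg (Eq (Read ''ctr'' (Var ''x'')) (Var ''x''))) (Lt (Lit 2) (Read ''sz'' (Read ''ctr'' (Var ''x'')))))
       (attach_prog (Var ''x'') (Var ''d'')) (attach_prog (Var ''d'') (Var ''x''))"

definition improve :: prog where
  "improve = sizes ;; prepare ;; scan ;; pick ;;
     PIf (Lt (Var ''d'') (Var ''n'')) (PFor ''h'' walk_step ;; join) PSkip"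

lemmas prog_defs = sizes_def prepare_def scan_edge_def scan_def pick_def walk_step_def attach_prog_def
  join_def improve_def initialize_def

text \<open>The expressions are evaluated again after each write to \<open>ctr\<close>; the
  hypothesis says that their values do not depend on that array.\<close>

lemma run_attach_prog:
  assumes "\<And>t. (\<And>x. x \<noteq> ''ctr'' \<Longrightarrow> t x = s x) \<Longrightarrow> aval v t = aval v s \<and> aval w t = aval w s"
  shows "run n (attach_prog v w) s ''ctr'' = attach (aval v s, aval w s) (s ''ctr'')"
proof -
  have "aval v (upd ''ctr'' i a t) = aval v s \<and> aval w (upd ''ctr'' i a t) = aval w s"
    if "\<And>x. x \<noteq> ''ctr'' \<Longrightarrow> t x = s x" for i a t
    using that by (intro assms) (simp add: upd_apply)
  then show ?thesis
    using assms[of s] by (simp add: attach_prog_def upd_apply attach.simps)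
qed

section \<open>Correctness of one round\<close>

context nat_graph
begin

definition sized :: "(nat \<Rightarrow> nat) \<Rightarrow> mem \<Rightarrow> bool" where
  "sized c s \<longleftrightarrow> s ''ctr'' = c \<and> (\<forall>r<n. s ''sz'' r = card (fib c r))"

lemma sized_same: "sized c s \<Longrightarrow> same X s t \<Longrightarrow> X \<inter> {''ctr'', ''sz''} = {} \<Longrightarrow> sized c t"
  unfolding sized_def same_def by (metis disjoint_iff insertI1 insertI2)

lemma run_prepare:
  assumes "input_stored k n E s" "sized c s"
  defines "t \<equiv> run n prepare s"
  shows "search_inv c (t ''nxt'') (t ''rel'') (t ''q'') (t ''qt'' 0) 0 0"
proof -
  let ?X = "{''i'', ''qt'', ''nxt'', ''rel'', ''q''}"
  define I where "I i t \<longleftrightarrow> same ?X s t \<and> inj_on (t ''q'') {..<t ''qt'' 0} \<and>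
     t ''q'' ` {..<t ''qt'' 0} = {v. v < i \<and> card (fib c v) < k} \<and>
     (\<forall>y<i. t ''nxt'' y = y \<and> t ''rel'' y = n)" for i t
  have "I n t"
    unfolding t_def prepare_def run.simps(3)[of n "PWrite ''qt'' (Lit 0) (Lit 0)"]
  proof (rule run_PFor)
    show "I 0 (upd ''i'' 0 0 (run n (PWrite ''qt'' (Lit 0) (Lit 0)) s))"
      by (auto simp: I_def upd_apply intro!: same_upd same_refl)
    fix i t assume t: "i < n" "I i t" "t ''i'' 0 = i"
    then have same: "same ?X s t" by (simp add: I_def)
    have in_t: "t ''n'' 0 = n" "t ''k'' 0 = k"
      using input_stored_same[OF assms(1) same] by (auto simp: input_stored_def)
    have sz: "t ''sz'' i = card (fib c i)"
      using sized_same[OF assms(2) same] t(1) by (auto simp: sized_def)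
    have inj: "inj_on (t ''q'') {..<t ''qt'' 0}"
      and img: "t ''q'' ` {..<t ''qt'' 0} = {v. v < i \<and> card (fib c v) < k}"
      and unset: "\<forall>y<i. t ''nxt'' y = y \<and> t ''rel'' y = n" using t(2) by (auto simp: I_def)
    have 1: "inj_on ((t ''q'')(t ''qt'' 0 := i)) {..<Suc (t ''qt'' 0)}"
      by (rule inj_on_push[OF inj]) (simp add: img)
    have 2: "(t ''q'')(t ''qt'' 0 := i) ` {..<Suc (t ''qt'' 0)} = insert i (t ''q'' ` {..<t ''qt'' 0})"
      by (auto simp: lessThan_Suc)
    let ?body = "PWrite ''nxt'' (Var ''i'') (Var ''i'') ;; PWrite ''rel'' (Var ''i'') (Var ''n'') ;;
     PIf (Lt (Read ''sz'' (Var ''i'')) (Var ''k''))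
       (PWrite ''q'' (Var ''qt'') (Var ''i'') ;; PWrite ''qt'' (Lit 0) (Add (Var ''qt'') (Lit 1))) PSkip"
    have "same ?X s (upd ''i'' 0 (Suc i) (run n ?body t))"
      by (intro same_upd same_run[OF same]) auto
    moreover have "inj_on (run n ?body t ''q'') {..<run n ?body t ''qt'' 0}"
      "run n ?body t ''q'' ` {..<run n ?body t ''qt'' 0} = {v. v < Suc i \<and> card (fib c v) < k}"
      "\<forall>y<Suc i. run n ?body t ''nxt'' y = y \<and> run n ?body t ''rel'' y = n"
      using inj 1 2 img unset in_t sz t by (auto simp: upd_apply less_Suc_eq)
    ultimately show "I (Suc i) (upd ''i'' 0 (Suc i) (run n ?body t))"
      by (simp add: I_def upd_apply)
  qed
  then show ?thesis
    unfolding I_def search_inv_def by auto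
qed

lemma run_scan:
  assumes "input_stored k n E s" "sized c s" "valid c"
    and "search_inv c (s ''nxt'') (s ''rel'') (s ''q'') (s ''qt'' 0) 0 0"
  defines "t \<equiv> run n scan s"
  shows "search_inv c (t ''nxt'') (t ''rel'') (t ''q'') (t ''qt'' 0) n 0"
proof -
  let ?X = "{''h'', ''j'', ''qt'', ''nxt'', ''rel'', ''q''}"
  let ?inv = "\<lambda>h j t. search_inv c (t ''nxt'') (t ''rel'') (t ''q'') (t ''qt'' 0) h j"
  define I where "I h t \<longleftrightarrow> same ?X s t \<and> ?inv h 0 t" for h t
  have "I n t"
    unfolding t_def scan_def
  proof (rule run_PFor)
    show "I 0 (upd ''h'' 0 0 s)"
      using assms(4) by (auto simp: I_def upd_apply intro!: same_upd same_refl)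
    fix h t assume t: "h < n" "I h t" "t ''h'' 0 = h"
    show "I (Suc h) (upd ''h'' 0 (Suc h) (run n (PIf (Lt (Var ''h'') (Var ''qt'')) (PFor ''j'' scan_edge) PSkip) t))"
    proof (cases "h < t ''qt'' 0")
      case False
      then show ?thesis
        using t search_inv_end[of c _ _ _ _ h] by (auto simp: I_def upd_apply intro!: same_upd)
    next
      case True
      define J where "J j t \<longleftrightarrow> same ?X s t \<and> t ''h'' 0 = h \<and> h < t ''qt'' 0 \<and> ?inv h j t" for j t
      have "J n (run n (PFor ''j'' scan_edge) t)"
      proof (rule run_PFor)
        show "J 0 (upd ''j'' 0 0 t)"
          using t True by (auto simp: I_def J_def upd_apply intro!: same_upd)
        fix j u assume u: "j < n" "J j u" "u ''j'' 0 = j"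
        then have same: "same ?X s u" and h: "u ''h'' 0 = h" "h < u ''qt'' 0" and inv: "?inv h j u"
          by (auto simp: J_def)
        have inp: "input_stored k n E u" using input_stored_same[OF assms(1) same] by simp
        then have nk: "u ''n'' 0 = n" "u ''k'' 0 = k" by (auto simp: input_stored_def)
        have sized: "sized c u" using sized_same[OF assms(2) same] by simp
        have ctr: "u ''ctr'' = c" using sized by (simp add: sized_def)
        have "c j < n" using validD(1)[OF assms(3), of j] u(1) by simp
        then have sz: "u ''sz'' (c j) = card (fib c (c j))" using sized by (simp add: sized_def)
        have full: "\<not> card (fib c (c j)) < k \<longleftrightarrow> card (fib c (c j)) = k"
          using card_fiber_le[OF assms(3), of "c j"] by auto
        have "u ''q'' h \<in> u ''q'' ` {..<u ''qt'' 0}" using h by simp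
        then have "u ''q'' h < n" unfolding search_invD(2)[OF inv] by simp
        then have adj: "bval (Adj (Var ''j'') (Read ''q'' (Var ''h''))) u \<longleftrightarrow> {j, u ''q'' h} \<in> E"
          using bval_Adj[OF inp, of "Var ''j''" "Read ''q'' (Var ''h'')"] u h by simp
        have "same ?X s (upd ''j'' 0 (Suc j) (run n scan_edge u))"
          by (intro same_upd same_run[OF same]) (auto simp: scan_edge_def)
        moreover have "run n scan_edge u ''h'' 0 = h" using h by (subst run_frame) (auto simp: scan_edge_def)
        moreover have "h < run n scan_edge u ''qt'' 0 \<and> ?inv h (Suc j) (run n scan_edge u)"
        proof (cases "{j, u ''q'' h} \<in> E \<and> u ''nxt'' j = j")
          case False
          then have "run n scan_edge u = u" using adj u by (auto simp: scan_edge_def)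
          then show ?thesis using search_inv_skip[OF inv False] h by simp
        next
          case mark: True
          show ?thesis
          proof (cases "card (fib c (c j)) = k \<and> c j \<noteq> j \<and> \<not> u ''rel'' (c j) < n")
            case False
            then have "run n scan_edge u = upd ''nxt'' j (u ''q'' h) u"
              using adj mark u ctr sz full nk h by (auto simp: scan_edge_def upd_apply)
            then show ?thesis using search_inv_mark[OF inv h(2) _ _ False] mark h by (simp add: upd_apply)
          next
            case True
            then have "run n scan_edge u = upd ''qt'' 0 (Suc (u ''qt'' 0)) (upd ''q'' (u ''qt'' 0) (c j)
                (upd ''rel'' (c j) j (upd ''nxt'' j (u ''q'' h) u)))"
              using adj mark u ctr sz full nk h by (auto simp: scan_edge_def upd_apply)
            then show ?thesis using search_inv_push[OF inv assms(3) h(2)] True mark h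
              by (simp add: upd_apply)
          qed
        qed
        ultimately show "J (Suc j) (upd ''j'' 0 (Suc j) (run n scan_edge u))"
          by (simp add: J_def upd_apply)
      qed
      then have "I (Suc h) (upd ''h'' 0 (Suc h) (run n (PFor ''j'' scan_edge) t))"
        unfolding J_def I_def using search_inv_row[of c _ _ _ _ h] by (auto simp: upd_apply intro!: same_upd)
      then show ?thesis using True t by simp
    qed
  qed
  then show ?thesis by (simp add: I_def)
qed

lemma singles_iff_fiber: "valid c \<Longrightarrow> d < n \<Longrightarrow> d \<in> singles {..<n} c \<longleftrightarrow> card (fib c d) = 1"
proof
  assume c: "valid c" "d < n" "card (fib c d) = 1"
  have "fib c d \<noteq> {}" using c(3) by force
  then have "c d = d" by (rule fiber_nonempty_center[OF c(1)])
  then have "star {..<n} c d = fib c d" "d \<in> fib c d" using c(2) fiber_center[of c d]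
    by (auto simp: fiber_def)
  then show "d \<in> singles {..<n} c" using c by (auto simp: singles_def card_1_singleton_iff)
next
  assume "valid c" "d \<in> singles {..<n} c"
  then show "card (fib c d) = 1" using singlesD[of c d] fiber_center[of c d] by simp
qed

lemma run_pick:
  assumes "input_stored k n E s" "sized c s" "valid c"
  defines "d \<equiv> run n pick s ''d'' 0"
  shows "d < n \<Longrightarrow> d \<in> singles {..<n} c \<and> s ''nxt'' d \<noteq> d"
    and "\<not> d < n \<Longrightarrow> y \<in> singles {..<n} c \<Longrightarrow> s ''nxt'' y = y"
proof -
  let ?X = "{''i'', ''d''}"
  let ?P = "\<lambda>d. d \<in> singles {..<n} c \<and> s ''nxt'' d \<noteq> d"
  define I where "I i t \<longleftrightarrow> same ?X s t \<and>
     (if t ''d'' 0 < n then ?P (t ''d'' 0) else \<forall>y<i. \<not> ?P y)" for i t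
  have "I n (run n pick s)"
    unfolding pick_def run.simps(3)
  proof (rule run_PFor)
    have "s ''n'' 0 = n" using assms(1) by (simp add: input_stored_def)
    then show "I 0 (upd ''i'' 0 0 (run n (PWrite ''d'' (Lit 0) (Var ''n'')) s))"
      by (auto simp: I_def upd_apply intro!: same_upd same_refl)
    fix i t assume t: "i < n" "I i t" "t ''i'' 0 = i"
    then have same: "same ?X s t" by (simp add: I_def)
    have sz: "t ''sz'' i = card (fib c i)"
      using sized_same[OF assms(2) same] t(1) by (auto simp: sized_def)
    have nxt: "t ''nxt'' = s ''nxt''" by (rule sameD[OF same]) simp
    let ?body = "PIf (Conj (Eq (Read ''sz'' (Var ''i'')) (Lit 1)) (Neg (Eq (Read ''nxt'' (Var ''i'')) (Var ''i''))))
       (PWrite ''d'' (Lit 0) (Var ''i'')) PSkip"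
    have "same ?X s (upd ''i'' 0 (Suc i) (run n ?body t))"
      by (intro same_upd same_run[OF same]) auto
    moreover have "run n ?body t ''d'' 0 = (if ?P i then i else t ''d'' 0)"
      using t sz nxt singles_iff_fiber[OF assms(3) t(1)] by (simp add: upd_apply)
    ultimately show "I (Suc i) (upd ''i'' 0 (Suc i) (run n ?body t))"
      using t unfolding I_def by (auto simp: upd_apply less_Suc_eq split: if_splits)
  qed
  then have *: "if d < n then ?P d else \<forall>y<n. \<not> ?P y" by (simp add: I_def d_def)
  show "d < n \<Longrightarrow> ?P d" using * by simp
  assume "\<not> d < n" "y \<in> singles {..<n} c"
  then show "s ''nxt'' y = y" using * by (auto simp: singles_def)
qed

text \<open>\<open>p\<close> is the queue position of the vertex that the current 1-star
  \<open>d\<close> would join. It sinks with every replacement, so \<open>p + m < n\<close> rules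
  out a replacement after \<open>n\<close> steps. The last clause says that the part of the chain
  still ahead has not been disturbed.\<close>

definition walk_inv where
  "walk_inv c nxt rel q qt m c' d \<longleftrightarrow> valid c' \<and> d \<in> singles {..<n} c' \<and>
     card (singles {..<n} c') = card (singles {..<n} c) \<and>
     (\<forall>r. card (fib c' r) = k \<longleftrightarrow> card (fib c r) = k) \<and> nxt d \<noteq> d \<and>
     (\<exists>p<qt. nxt d = q p \<and> (rel (q p) < n \<longrightarrow> p + m < n) \<and>
        (\<forall>p'\<le>p. rel (q p') < n \<longrightarrow> c' (rel (q p')) = q p'))"

lemma walk_inv_init:
  assumes inv: "search_inv c nxt rel q qt n 0" and "valid c" "d \<in> singles {..<n} c" "nxt d \<noteq> d"
  shows "walk_inv c nxt rel q qt 0 c d"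
proof -
  note D = search_invD[OF inv]
  have "d < n" using assms(3) by (simp add: singles_def)
  then obtain p where p: "p < qt" "nxt d = q p" using D(3) assms(4) by blast
  have "q p' < n" if "p' < qt" for p'
    using D(2) that by (metis (mono_tags, lifting) imageI lessThan_iff mem_Collect_eq)
  then have "c (rel (q p')) = q p'" if "p' \<le> p" "rel (q p') < n" for p'
    using D(4)[of "q p'"] that p by simp
  moreover have "p < n" using p queue_length[OF inv] by simp
  ultimately show ?thesis
    unfolding walk_inv_def using assms p by (intro conjI exI[of _ p]) auto
qed

lemma walk_inv_step:
  assumes inv: "search_inv c nxt rel q qt n 0" and w: "walk_inv c nxt rel q qt m c' d"
    and rel: "rel (nxt d) < n"
  defines "x \<equiv> rel (nxt d)"
  shows "walk_inv c nxt rel q qt (Suc m) (c'(d := nxt d, x := x)) x"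
proof -
  note D = search_invD[OF inv]
  obtain p where p: "p < qt" "nxt d = q p" "p + m < n"
    "\<And>p'. p' \<le> p \<Longrightarrow> rel (q p') < n \<Longrightarrow> c' (rel (q p')) = q p'"
    and v: "valid c'" and d: "d \<in> singles {..<n} c'" and
    card: "card (singles {..<n} c') = card (singles {..<n} c)" and
    full: "\<And>r. card (fib c' r) = k \<longleftrightarrow> card (fib c r) = k" and nd: "nxt d \<noteq> d"
    using w rel unfolding walk_inv_def by auto
  have q_lt: "q p' < n" if "p' < qt" for p'
    using D(2) that by (metis (mono_tags, lifting) imageI lessThan_iff mem_Collect_eq)
  have dn: "d < n" using d by (simp add: singles_def)
  have edge: "{d, nxt d} \<in> E" using D(3)[OF dn nd] by auto
  note R = D(4)[OF q_lt[OF p(1)]]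
  have rp: "rel (q p) < n" using rel p(2) by simp
  obtain p0 p1 where p0: "p0 < p1" "p1 < qt" "q p = q p1" "nxt (rel (q p)) = q p0" using R[OF rp] by blast
  \<comment> \<open>The queue has no repetitions, so \<open>nxt d\<close> has a single position, and
    the vertex that \<open>x\<close> would join stands strictly before it.\<close>
  have "p1 = p" using D(1) p0(2,3) p(1) by (metis inj_onD lessThan_iff)
  then have "p0 < p" using p0(1) by simp
  have x: "x = rel (q p)" "x < n" "c' x = q p" "x \<noteq> q p" "nxt x \<noteq> x" "nxt x = q p0"
    using R[OF rp] rel p(2) p(4)[of p] rp p0(4) by (auto simp: x_def)
  have fk: "card (fib c' (nxt d)) = k" using full R[OF rp] p(2) by simp
  have xn: "x \<in> {..<n}" "c' x = nxt d" "x \<noteq> nxt d" using x p(2) by auto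
  note S = shift[OF v d edge fk xn]
  have cd: "c' d = d" using singlesD(2)[OF v d] .
  \<comment> \<open>Only \<open>d\<close> and \<open>x\<close> change their center. A satellite
    released later is not \<open>d\<close>, which is its own center, and not \<open>x\<close>, which
    belongs to \<open>q p\<close>.\<close>
  have keep: "(c'(d := nxt d, x := x)) (rel (q p')) = q p'" if "p' \<le> p0" "rel (q p') < n" for p'
  proof -
    have p': "p' < qt" "p' \<noteq> p" "p' \<le> p" using that \<open>p0 < p\<close> p(1) by auto
    have c: "c' (rel (q p')) = q p'" using p(4)[OF p'(3) that(2)] .
    have "rel (q p') \<noteq> q p'" using D(4)[OF q_lt[OF p'(1)] that(2)] by blast
    then have "rel (q p') \<noteq> d" using c cd by auto
    moreover have "q p' \<noteq> q p" using D(1) p' p(1) by (meson inj_onD lessThan_iff)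
    then have "rel (q p') \<noteq> x" using c x by auto
    ultimately show ?thesis using c by simp
  qed
  have "p0 < qt" "p0 + Suc m < n" using \<open>p0 < p\<close> p by auto
  then show ?thesis
    unfolding walk_inv_def using S card full x(5,6) keep by (intro conjI exI[of _ p0] allI impI) auto
qed

lemma walk_inv_stop:
  assumes "walk_inv c nxt rel q qt m c' d" "\<not> rel (nxt d) < n"
  shows "walk_inv c nxt rel q qt (Suc m) c' d"
  using assms unfolding walk_inv_def by auto

lemma run_walk:
  assumes "s ''n'' 0 = n" and inv: "search_inv c (s ''nxt'') (s ''rel'') q qt n 0"
    and "walk_inv c (s ''nxt'') (s ''rel'') q qt 0 (s ''ctr'') (s ''d'' 0)"
  defines "t \<equiv> run n (PFor ''h'' walk_step) s"
  shows "walk_inv c (s ''nxt'') (s ''rel'') q qt n (t ''ctr'') (t ''d'' 0)"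
proof -
  let ?X = "{''h'', ''x'', ''ctr'', ''d''}"
  define I where "I m t \<longleftrightarrow> same ?X s t \<and>
    walk_inv c (s ''nxt'') (s ''rel'') q qt m (t ''ctr'') (t ''d'' 0)" for m t
  have "I n t"
    unfolding t_def
  proof (rule run_PFor)
    show "I 0 (upd ''h'' 0 0 s)"
      using assms(3) by (auto simp: I_def upd_apply intro!: same_upd same_refl)
    fix m t assume t: "m < n" "I m t" "t ''h'' 0 = m"
    then have same: "same ?X s t" and w: "walk_inv c (s ''nxt'') (s ''rel'') q qt m (t ''ctr'') (t ''d'' 0)"
      by (auto simp: I_def)
    have eqs: "t ''nxt'' = s ''nxt''" "t ''rel'' = s ''rel''" "t ''n'' = s ''n''"
      by (rule sameD[OF same], simp)+
    have "same ?X s (upd ''h'' 0 (Suc m) (run n walk_step t))"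
      by (intro same_upd same_run[OF same]) (auto simp: walk_step_def)
    moreover have "walk_inv c (s ''nxt'') (s ''rel'') q qt (Suc m) (run n walk_step t ''ctr'') (run n walk_step t ''d'' 0)"
    proof (cases "s ''rel'' (s ''nxt'' (t ''d'' 0)) < n")
      case True
      then show ?thesis
        using walk_inv_step[OF inv w True] eqs assms(1) by (simp add: walk_step_def upd_apply)
    next
      case False
      then show ?thesis
        using walk_inv_stop[OF w False] eqs assms(1) by (simp add: walk_step_def)
    qed
    ultimately show "I (Suc m) (upd ''h'' 0 (Suc m) (run n walk_step t))" by (simp add: I_def upd_apply)
  qed
  then show ?thesis by (simp add: I_def)
qed

lemma run_join:
  assumes inv: "search_inv c (s ''nxt'') (s ''rel'') q qt n 0" and "valid c"
    and w: "walk_inv c (s ''nxt'') (s ''rel'') q qt n (s ''ctr'') (s ''d'' 0)"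
  defines "c' \<equiv> run n join s ''ctr''"
  shows "valid c'" "card (singles {..<n} c') < card (singles {..<n} c)"
proof -
  note D = search_invD[OF inv]
  let ?d = "s ''d'' 0" and ?c = "s ''ctr''"
  let ?v = "s ''nxt'' ?d"
  \<comment> \<open>A further replacement would need \<open>p + n < n\<close>. So the walk has ended
    at a queued vertex with nothing to release, that is, not at the center of a
    \<open>k\<close>-star.\<close>
  obtain p where p: "p < qt" "?v = q p" "\<not> s ''rel'' (q p) < n"
    and v: "valid ?c" and d: "?d \<in> singles {..<n} ?c" and
    card: "card (singles {..<n} ?c) = card (singles {..<n} c)" and
    full: "\<And>r. card (fib ?c r) = k \<longleftrightarrow> card (fib c r) = k" and nd: "?v \<noteq> ?d"
    using w unfolding walk_inv_def by auto
  have dn: "?d < n" using d by (simp add: singles_def)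
  have edge: "{?d, ?v} \<in> E" using D(3)[OF dn nd] by auto
  have vn: "?v < n" using edgeD[OF edge] by simp
  have "?v \<in> q ` {..<qt}" using p by simp
  then have "card (fib c ?v) < k" unfolding D(2) using p by simp
  then have nfull: "card (fib ?c ?v) \<noteq> k" using full[of ?v] by auto
  let ?s = "run n sizes (upd ''x'' 0 ?v s)"
  have eqs: "?s ''ctr'' = ?c" "?s ''x'' 0 = ?v" "?s ''d'' 0 = ?d"
    by (simp_all add: run_frame writes_sizes upd_apply)
  have cv: "?c ?v < n" using validD(1)[OF v, of ?v] vn by simp
  have sz: "?s ''sz'' (?c ?v) = card (fib ?c (?c ?v))"
    using run_sizes[OF cv, of "upd ''x'' 0 ?v s"] by (simp add: upd_apply)
  have att: "run n (attach_prog (Var a) (Var b)) ?s ''ctr'' = attach (?s a 0, ?s b 0) ?c"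
    if "a \<noteq> ''ctr''" "b \<noteq> ''ctr''" for a b
    using run_attach_prog[of ?s "Var a" "Var b" n] that eqs by simp
  have "c' = (if ?c ?v \<noteq> ?v \<and> 2 < card (fib ?c (?c ?v)) then attach (?v, ?d) ?c else attach (?d, ?v) ?c)"
    unfolding c'_def join_def using eqs sz att[of "''x''" "''d''"] att[of "''d''" "''x''"] by simp
  then show "valid c'" "card (singles {..<n} c') < card (singles {..<n} c)"
    using augment[OF v d edge nfull] card by simp_all
qed

lemma run_improve:
  assumes "input_stored k n E s" "valid (s ''ctr'')"
  defines "c \<equiv> s ''ctr''" and "c' \<equiv> run n improve s ''ctr''"
  shows "valid c'" "card (singles {..<n} c') < card (singles {..<n} c) \<or>
    c' = c \<and> (\<forall>q. valid q \<longrightarrow> card (singles {..<n} c) \<le> card (singles {..<n} q))"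
proof -
  let ?s1 = "run n sizes s" let ?s2 = "run n prepare ?s1" let ?s3 = "run n scan ?s2"
  let ?s4 = "run n pick ?s3"
  have v: "valid c" using assms by simp
  have w: "writes sizes = {''i'', ''sz''}" "writes prepare = {''i'', ''qt'', ''nxt'', ''rel'', ''q''}"
    "writes scan = {''h'', ''j'', ''qt'', ''nxt'', ''rel'', ''q''}" "writes pick = {''i'', ''d''}"
    by (auto simp: writes_sizes prepare_def scan_def scan_edge_def pick_def)
  have inp1: "input_stored k n E ?s1"
    by (rule input_stored_same[OF assms(1) same_run[OF same_refl order_refl]]) (simp add: w)
  have sized1: "sized c ?s1" using run_sizes[of _ n s] by (simp add: sized_def c_def run_frame w)
  have inp2: "input_stored k n E ?s2"
    by (rule input_stored_same[OF inp1 same_run[OF same_refl order_refl]]) (simp add: w)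
  have sized2: "sized c ?s2" by (rule sized_same[OF sized1 same_run[OF same_refl order_refl]]) (simp add: w)
  have inp3: "input_stored k n E ?s3"
    by (rule input_stored_same[OF inp2 same_run[OF same_refl order_refl]]) (simp add: w)
  have sized3: "sized c ?s3" by (rule sized_same[OF sized2 same_run[OF same_refl order_refl]]) (simp add: w)
  have inv: "search_inv c (?s3 ''nxt'') (?s3 ''rel'') (?s3 ''q'') (?s3 ''qt'' 0) n 0"
    by (rule run_scan[OF inp2 sized2 v run_prepare[OF inp1 sized1]])
  note pick = run_pick[OF inp3 sized3 v]
  have eqs: "?s4 ''ctr'' = c" "?s4 ''nxt'' = ?s3 ''nxt''" "?s4 ''rel'' = ?s3 ''rel''" "?s4 ''n'' 0 = n"
    using sized3 inp3 by (auto simp: run_frame w sized_def input_stored_def)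
  have "valid c' \<and> (card (singles {..<n} c') < card (singles {..<n} c) \<or>
    c' = c \<and> (\<forall>q. valid q \<longrightarrow> card (singles {..<n} c) \<le> card (singles {..<n} q)))"
  proof (cases "?s4 ''d'' 0 < n")
    case False
    then have "c' = c" using eqs by (simp add: c'_def improve_def)
    then show ?thesis
      using v search_fails_minimal[OF inv v pick(2)[OF False]] by blast
  next
    case True
    let ?s5 = "run n (PFor ''h'' walk_step) ?s4"
    have c': "c' = run n join ?s5 ''ctr''" using True eqs(4) by (simp add: c'_def improve_def)
    have inv4: "search_inv c (?s4 ''nxt'') (?s4 ''rel'') (?s3 ''q'') (?s3 ''qt'' 0) n 0" using inv eqs by simp
    have "walk_inv c (?s4 ''nxt'') (?s4 ''rel'') (?s3 ''q'') (?s3 ''qt'' 0) 0 (?s4 ''ctr'') (?s4 ''d'' 0)"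
      using walk_inv_init[OF inv v] pick(1)[OF True] eqs by simp
    note walk = run_walk[OF eqs(4) inv4 this]
    have eqs5: "?s5 ''nxt'' = ?s4 ''nxt''" "?s5 ''rel'' = ?s4 ''rel''"
      by (simp_all add: run_frame walk_step_def del: run.simps)
    show ?thesis
      unfolding c' using run_join[of c ?s5 "?s3 ''q''" "?s3 ''qt'' 0"] inv4 v walk
      unfolding eqs5 by blast
  qed
  then show "valid c'" "card (singles {..<n} c') < card (singles {..<n} c) \<or>
    c' = c \<and> (\<forall>q. valid q \<longrightarrow> card (singles {..<n} c) \<le> card (singles {..<n} q))" by blast+
qed

lemma run_improve_rounds:
  assumes "input_stored k n E s" "valid (s ''ctr'')"
  defines "t \<equiv> run n (PFor ''r'' improve) s"
  shows "input_stored k n E t" "valid (t ''ctr'')"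
    "valid q \<Longrightarrow> card (singles {..<n} (t ''ctr'')) \<le> card (singles {..<n} q)"
proof -
  have w: "writes improve \<inter> {''n'', ''k'', ''row'', ''adj''} = {}"
    by (simp add: prog_defs)
  \<comment> \<open>A round removes a 1-star unless the minimum is reached, and a minimal map stays
    minimal. After \<open>n\<close> rounds the first alternative leaves no 1-star, which is minimal
    too.\<close>
  define I where "I i t \<longleftrightarrow> input_stored k n E t \<and> valid (t ''ctr'') \<and>
     (card (singles {..<n} (t ''ctr'')) + i \<le> n \<or>
      (\<forall>q. valid q \<longrightarrow> card (singles {..<n} (t ''ctr'')) \<le> card (singles {..<n} q)))" for i t
  have "I n t"
    unfolding t_def
  proof (rule run_PFor)
    have "card (singles {..<n} (s ''ctr'')) \<le> card {..<n}"
      by (intro card_mono) (auto simp: singles_def)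
    moreover have "input_stored k n E (upd ''r'' 0 0 s)"
      by (rule input_stored_same[OF assms(1) same_upd[OF same_refl]]) auto
    ultimately show "I 0 (upd ''r'' 0 0 s)" using assms(2) by (simp add: I_def upd_apply)
    fix i t assume t: "i < n" "I i t" "t ''r'' 0 = i"
    then have inp: "input_stored k n E t" and v: "valid (t ''ctr'')" by (auto simp: I_def)
    note R = run_improve[OF inp v]
    have "input_stored k n E (run n improve t)"
      by (rule input_stored_same[OF inp same_run[OF same_refl order_refl]]) (rule w)
    then have "input_stored k n E (upd ''r'' 0 (Suc i) (run n improve t))"
      by (rule input_stored_same[OF _ same_upd[OF same_refl]]) auto
    then show "I (Suc i) (upd ''r'' 0 (Suc i) (run n improve t))"
      using R t(2) by (fastforce simp: I_def upd_apply)
  qed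
  then show "input_stored k n E t" "valid (t ''ctr'')"
    "valid q \<Longrightarrow> card (singles {..<n} (t ''ctr'')) \<le> card (singles {..<n} q)"
    by (auto simp: I_def)
qed

end

section \<open>Searching for an applicable operation\<close>

fun conj_list :: "bexp list \<Rightarrow> bexp" where
  "conj_list [] = Neg (Lt (Lit 0) (Lit 0))"
| "conj_list (b # bs) = Conj b (conj_list bs)"

lemma bval_conj_list [simp]: "bval (conj_list bs) s \<longleftrightarrow> (\<forall>b\<in>set bs. bval b s)"
  by (induction bs) auto

definition Or :: "bexp \<Rightarrow> bexp \<Rightarrow> bexp" where
  "Or p q = Neg (Conj (Neg p) (Neg q))"

lemma bval_Or [simp]: "bval (Or p q) s \<longleftrightarrow> bval p s \<or> bval q s"
  by (auto simp: Or_def)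

primrec avars :: "aexp \<Rightarrow> string set" where
  "avars (Lit m) = {}"
| "avars (Read x i) = insert x (avars i)"
| "avars (Add a b) = avars a \<union> avars b"
| "avars (Sub a b) = avars a \<union> avars b"

primrec bvars :: "bexp \<Rightarrow> string set" where
  "bvars (Lt a b) = avars a \<union> avars b"
| "bvars (Neg p) = bvars p"
| "bvars (Conj p q) = bvars p \<union> bvars q"

lemma aval_cong: "(\<And>x. x \<in> avars a \<Longrightarrow> s x = t x) \<Longrightarrow> aval a s = aval a t"
  by (induction a) auto

lemma bval_cong: "(\<And>x. x \<in> bvars b \<Longrightarrow> s x = t x) \<Longrightarrow> bval b s = bval b t"
proof (induction b)
  case (Lt a b)
  then show ?case using aval_cong[of a s t] aval_cong[of b s t] by simp
qed auto

lemma bvars_conj_list [simp]: "bvars (conj_list bs) = (\<Union>b\<in>set bs. bvars b)"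
  by (induction bs) auto

lemma bvars_Or [simp]: "bvars (Or p q) = bvars p \<union> bvars q"
  by (simp add: Or_def)

lemma bvars_Eq [simp]: "bvars (Eq a b) = avars a \<union> avars b"
  by (auto simp: Eq_def)

lemma bvars_Adj [simp]: "bvars (Adj a b) = {''adj'', ''row''} \<union> avars a \<union> avars b"
  by (auto simp: Adj_def)

section \<open>Tests that record a move\<close>

type_synonym guard = "bexp \<times> (aexp \<times> aexp) list"

fun record_from :: "nat \<Rightarrow> (aexp \<times> aexp) list \<Rightarrow> prog" where
  "record_from t [] = PSkip"
| "record_from t ((a, b) # r) = PWrite ''pv'' (Lit t) a ;; PWrite ''pw'' (Lit t) b ;; record_from (Suc t) r"

text \<open>All guards are tested, even after a success; a later success supersedes the earlier
  record, since ''found'' is set to its own length.\<close>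

fun guard_prog :: "guard list \<Rightarrow> prog" where
  "guard_prog [] = PSkip"
| "guard_prog ((b, r) # gs) =
     PIf b (record_from 0 r ;; PWrite ''found'' (Lit 0) (Lit (length r))) PSkip ;; guard_prog gs"

definition recorded :: "mem \<Rightarrow> (nat \<times> nat) list" where
  "recorded s = map (\<lambda>t. (s ''pv'' t, s ''pw'' t)) [0..<s ''found'' 0]"

definition eval_pairs :: "(aexp \<times> aexp) list \<Rightarrow> mem \<Rightarrow> (nat \<times> nat) list" where
  "eval_pairs r s = map (\<lambda>(a, b). (aval a s, aval b s)) r"

definition rec_vars :: "string set" where
  "rec_vars = {''pv'', ''pw'', ''found''}"

text \<open>A record is non-empty so that ''found'' being 0 means that no guard holds. It has at
  most four pairs, as many as Operation 2 can need, and its length is then a literal that grows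
  slowly.\<close>

definition guard_ok :: "string set \<Rightarrow> guard \<Rightarrow> bool" where
  "guard_ok X g \<longleftrightarrow> bvars (fst g) \<subseteq> X \<and> (\<forall>(a, b)\<in>set (snd g). avars a \<subseteq> X \<and> avars b \<subseteq> X \<and>
      grows_slowly a \<and> grows_slowly b) \<and> snd g \<noteq> [] \<and> length (snd g) \<le> 4"

lemma writes_record_from: "writes (record_from t r) \<subseteq> {''pv'', ''pw''}"
  by (induction t r rule: record_from.induct) auto

lemma writes_guard_prog: "writes (guard_prog gs) \<subseteq> rec_vars"
  by (induction gs rule: guard_prog.induct) (use writes_record_from in \<open>fastforce simp: rec_vars_def\<close>)+

lemma depth_record_from: "depth (record_from t r) = 0"
  by (induction t r rule: record_from.induct) auto

lemma depth_guard_prog: "depth (guard_prog gs) = 0"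
  by (induction gs rule: guard_prog.induct) (auto simp: depth_record_from)

lemma wf_record_from:
  "(\<forall>(a, b)\<in>set r. grows_slowly a \<and> grows_slowly b) \<Longrightarrow> wf (record_from t r)"
  by (induction t r rule: record_from.induct) auto

lemma wf_guard_prog: "list_all (guard_ok X) gs \<Longrightarrow> wf (guard_prog gs)"
  by (induction gs rule: guard_prog.induct) (auto simp: guard_ok_def intro!: wf_record_from)

lemma run_record_from:
  assumes "\<forall>(a, b)\<in>set r. avars a \<inter> rec_vars = {} \<and> avars b \<inter> rec_vars = {}"
  shows "(\<forall>u<t. run n (record_from t r) s ''pv'' u = s ''pv'' u \<and> run n (record_from t r) s ''pw'' u = s ''pw'' u) \<and>
    (\<forall>u<length r. run n (record_from t r) s ''pv'' (t + u) = aval (fst (r ! u)) s \<and>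
       run n (record_from t r) s ''pw'' (t + u) = aval (snd (r ! u)) s)"
  using assms
proof (induction t r arbitrary: s rule: record_from.induct)
  case (2 t a b r)
  define s1 where "s1 = upd ''pw'' t (aval b (upd ''pv'' t (aval a s) s)) (upd ''pv'' t (aval a s) s)"
  have run: "run n (record_from t ((a, b) # r)) s = run n (record_from (Suc t) r) s1"
    by (simp add: s1_def)
  have ev: "aval e s1 = aval e s \<and> aval e (upd ''pv'' t (aval a s) s) = aval e s" if "avars e \<inter> rec_vars = {}" for e
    using that by (auto simp: s1_def upd_apply rec_vars_def intro!: aval_cong)
  have ab: "avars a \<inter> rec_vars = {}" "avars b \<inter> rec_vars = {}" using "2.prems" by auto
  have s1: "s1 ''pv'' t = aval a s" "s1 ''pw'' t = aval b s"
    "\<forall>u<t. s1 ''pv'' u = s ''pv'' u \<and> s1 ''pw'' u = s ''pw'' u"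
    using ev[OF ab(2)] by (auto simp: s1_def upd_apply)
  have IH: "(\<forall>u<Suc t. run n (record_from (Suc t) r) s1 ''pv'' u = s1 ''pv'' u \<and>
        run n (record_from (Suc t) r) s1 ''pw'' u = s1 ''pw'' u)"
    "(\<forall>u<length r. run n (record_from (Suc t) r) s1 ''pv'' (Suc t + u) = aval (fst (r ! u)) s1 \<and>
       run n (record_from (Suc t) r) s1 ''pw'' (Suc t + u) = aval (snd (r ! u)) s1)"
    using "2.IH"[of s1] "2.prems" by auto
  have ev_r: "aval (fst (r ! u)) s1 = aval (fst (r ! u)) s \<and> aval (snd (r ! u)) s1 = aval (snd (r ! u)) s"
    if "u < length r" for u
  proof -
    have "r ! u \<in> set ((a, b) # r)" using that by simp
    with "2.prems" have "avars (fst (r ! u)) \<inter> rec_vars = {}" "avars (snd (r ! u)) \<inter> rec_vars = {}"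
      by (auto simp: case_prod_beta)
    then show ?thesis using ev by blast
  qed
  show ?case
    unfolding run
  proof (intro conjI allI impI)
    fix u assume "u < t"
    then show "run n (record_from (Suc t) r) s1 ''pv'' u = s ''pv'' u"
      "run n (record_from (Suc t) r) s1 ''pw'' u = s ''pw'' u" using IH(1) s1(3) by auto
  next
    fix u assume u: "u < length ((a, b) # r)"
    show "run n (record_from (Suc t) r) s1 ''pv'' (t + u) = aval (fst (((a, b) # r) ! u)) s"
      "run n (record_from (Suc t) r) s1 ''pw'' (t + u) = aval (snd (((a, b) # r) ! u)) s"
      using u IH s1 ev_r by (cases u; simp)+
  qed
qed simp

lemma guard_cong:
  assumes "guard_ok X g" "\<And>x. x \<in> X \<Longrightarrow> s x = t x"
  shows "bval (fst g) s = bval (fst g) t" "eval_pairs (snd g) s = eval_pairs (snd g) t"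
proof -
  show "bval (fst g) s = bval (fst g) t"
    using assms by (intro bval_cong) (auto simp: guard_ok_def)
  have "aval (fst p) s = aval (fst p) t \<and> aval (snd p) s = aval (snd p) t" if "p \<in> set (snd g)" for p
  proof -
    have "avars (fst p) \<subseteq> X" "avars (snd p) \<subseteq> X"
      using assms(1) that by (auto simp: guard_ok_def case_prod_beta)
    then show ?thesis using assms(2) by (metis aval_cong subsetD)
  qed
  then show "eval_pairs (snd g) s = eval_pairs (snd g) t"
    by (auto simp: eval_pairs_def case_prod_beta)
qed

lemma run_guard_prog:
  fixes n :: nat and s :: mem
  assumes "list_all (guard_ok X) gs" "X \<inter> rec_vars = {}"
  defines "t \<equiv> run n (guard_prog gs) s"
  shows "same rec_vars s t"
    and "(\<nexists>g. g \<in> set gs \<and> bval (fst g) s) \<and> recorded t = recorded s \<or>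
      (\<exists>g\<in>set gs. bval (fst g) s \<and> recorded t = eval_pairs (snd g) s)"
proof -
  show "same rec_vars s t"
    unfolding t_def by (rule same_run[OF same_refl writes_guard_prog])
  show "(\<nexists>g. g \<in> set gs \<and> bval (fst g) s) \<and> recorded t = recorded s \<or>
      (\<exists>g\<in>set gs. bval (fst g) s \<and> recorded t = eval_pairs (snd g) s)"
    unfolding t_def using assms(1)
  proof (induction gs arbitrary: s rule: guard_prog.induct)
    case (2 b r gs)
    let ?rec = "record_from 0 r ;; PWrite ''found'' (Lit 0) (Lit (length r))"
    define s1 where "s1 = (if bval b s then run n ?rec s else s)"
    have run: "run n (guard_prog ((b, r) # gs)) s = run n (guard_prog gs) s1" by (simp add: s1_def)
    have vars: "\<forall>(a, b)\<in>set r. avars a \<inter> rec_vars = {} \<and> avars b \<inter> rec_vars = {}"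
      using "2.prems" assms(2) by (fastforce simp: guard_ok_def)
    have same1: "same rec_vars s s1"
      unfolding s1_def using writes_record_from[of 0 r]
      by (auto intro!: same_run same_refl same_upd simp: rec_vars_def)
    have eq: "bval (fst g) s1 = bval (fst g) s \<and> eval_pairs (snd g) s1 = eval_pairs (snd g) s"
      if "g \<in> set gs" for g
    proof -
      have ok: "guard_ok X g" using "2.prems" that by (simp add: list_all_iff)
      have X: "s1 x = s x" if "x \<in> X" for x using sameD[OF same1] that assms(2) by blast
      show ?thesis using guard_cong[OF ok, of s1 s] X by blast
    qed
    have rec1: "recorded s1 = (if bval b s then eval_pairs r s else recorded s)"
    proof (cases "bval b s")
      case True
      then have s1: "s1 = upd ''found'' 0 (length r) (run n (record_from 0 r) s)" by (simp add: s1_def)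
      note R = run_record_from[OF vars, of 0 n s]
      have "recorded s1 = map (\<lambda>u. (aval (fst (r ! u)) s, aval (snd (r ! u)) s)) [0..<length r]"
        using R by (auto simp: recorded_def s1 upd_apply)
      also have "\<dots> = eval_pairs r s"
        unfolding eval_pairs_def by (rule nth_equalityI) (auto simp: case_prod_beta)
      finally show ?thesis using True by simp
    qed (simp add: s1_def)
    define u where "u = run n (guard_prog gs) s1"
    have "(\<nexists>g. g \<in> set gs \<and> bval (fst g) s1) \<and> recorded u = recorded s1 \<or>
      (\<exists>g\<in>set gs. bval (fst g) s1 \<and> recorded u = eval_pairs (snd g) s1)"
      unfolding u_def using "2.IH"[of s1] "2.prems" by simp
    then have "(\<nexists>g. g \<in> set ((b, r) # gs) \<and> bval (fst g) s) \<and> recorded u = recorded s \<or>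
      (\<exists>g\<in>set ((b, r) # gs). bval (fst g) s \<and> recorded u = eval_pairs (snd g) s)"
    proof (elim disjE bexE conjE)
      assume none: "\<nexists>g. g \<in> set gs \<and> bval (fst g) s1" and u: "recorded u = recorded s1"
      have none': "\<not> bval (fst g) s" if "g \<in> set gs" for g using none eq[OF that] that by metis
      show ?thesis
      proof (cases "bval b s")
        case True
        then show ?thesis using u rec1 by (intro disjI2 bexI[of _ "(b, r)"]) simp_all
      next
        case False
        then show ?thesis using u rec1 none' by (intro disjI1) auto
      qed
    next
      fix g assume "g \<in> set gs" "bval (fst g) s1" "recorded u = eval_pairs (snd g) s1"
      then show ?thesis using eq by (intro disjI2 bexI[of _ g]) simp_all
    qed
    then show ?case unfolding run u_def .
  qed simp
qed

definition env :: "nat \<Rightarrow> nat \<Rightarrow> mem \<Rightarrow> mem" where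
  "env i j s = upd ''j'' 0 j (upd ''i'' 0 i s)"

definition find_move :: "guard list \<Rightarrow> prog" where
  "find_move gs = PWrite ''found'' (Lit 0) (Lit 0) ;; PFor ''i'' (PFor ''j'' (guard_prog gs))"

lemma run_find_move:
  fixes n :: nat and s :: mem
  assumes ok: "list_all (guard_ok X) gs" "X \<inter> rec_vars = {}"
  defines "t \<equiv> run n (find_move gs) s"
  shows "same (rec_vars \<union> {''i'', ''j''}) s t"
    and "recorded t = [] \<Longrightarrow> i < n \<Longrightarrow> j < n \<Longrightarrow> g \<in> set gs \<Longrightarrow> \<not> bval (fst g) (env i j s)"
    and "recorded t \<noteq> [] \<Longrightarrow> \<exists>i<n. \<exists>j<n. \<exists>g\<in>set gs. bval (fst g) (env i j s) \<and> recorded t = eval_pairs (snd g) (env i j s)"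
proof -
  let ?X = "rec_vars \<union> {''i'', ''j''}"
  define hit where "hit i j \<longleftrightarrow> (\<exists>g\<in>set gs. bval (fst g) (env i j s))" for i j
  define result where "result L \<longleftrightarrow> (\<exists>i<n. \<exists>j<n. \<exists>g\<in>set gs. bval (fst g) (env i j s) \<and> L = eval_pairs (snd g) (env i j s))" for L
  \<comment> \<open>\<open>Z\<close> is the set of pairs tested so far. The counters are entries 0
    of arrays; equality with entry 0 masked lets a loop state agree with \<open>env i j s\<close> on
    all of ''i'' and ''j''.\<close>
  define I where "I Z t \<longleftrightarrow> same ?X s t \<and> (\<forall>x\<in>{''i'', ''j''}. (t x)(0 := 0) = (s x)(0 := 0)) \<and> (recorded t = [] \<longrightarrow> (\<forall>(i, j)\<in>Z. \<not> hit i j)) \<and>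
     (recorded t \<noteq> [] \<longrightarrow> result (recorded t))" for Z t
  have rec_upd: "recorded (upd x i v t) = recorded t" if "x \<in> {''i'', ''j''}" for x i v t
    using that by (auto simp: recorded_def upd_apply)
  have I_upd: "I Z (upd x 0 v t)" if "I Z t" "x \<in> {''i'', ''j''}" for Z x v t
    using that rec_upd[of x 0 v t] by (auto simp: I_def upd_apply intro!: same_upd)
  have "I ({..<n} \<times> {..<n}) t"
    unfolding t_def find_move_def run.simps(3)
  proof (rule run_PFor[where I = "\<lambda>i. I ({..<i} \<times> {..<n})"])
    have "I {} (run n (PWrite ''found'' (Lit 0) (Lit 0)) s)"
      by (auto simp: I_def recorded_def rec_vars_def upd_apply intro!: same_upd same_refl)
    then show "I ({..<0} \<times> {..<n}) (upd ''i'' 0 0 (run n (PWrite ''found'' (Lit 0) (Lit 0)) s))"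
      by (simp add: I_upd)
    fix i t assume t: "i < n" "I ({..<i} \<times> {..<n}) t" "t ''i'' 0 = i"
    define J where "J j u \<longleftrightarrow> I ({..<i} \<times> {..<n} \<union> {i} \<times> {..<j}) u \<and> u ''i'' 0 = i" for j u
    have "J n (run n (PFor ''j'' (guard_prog gs)) t)"
    proof (rule run_PFor)
      show "J 0 (upd ''j'' 0 0 t)" using t by (simp add: J_def I_upd) (simp add: upd_apply)
      fix j u assume u: "j < n" "J j u" "u ''j'' 0 = j"
      let ?u = "run n (guard_prog gs) u"
      note G = run_guard_prog[OF ok, where n = n and s = u]
      have Iu: "I ({..<i} \<times> {..<n} \<union> {i} \<times> {..<j}) u" and ui: "u ''i'' 0 = i" using u by (auto simp: J_def)
      have same: "same ?X s u" using Iu by (simp add: I_def)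
      have loop_vars: "u x = env i j s x" if "x \<in> {''i'', ''j''}" for x
      proof -
        have eq: "(u x)(0 := 0) = (s x)(0 := 0)" using Iu that by (auto simp: I_def)
        have "u x z = env i j s x z" for z
          using fun_cong[OF eq, of z] that ui u(3) by (cases "z = 0") (auto simp: env_def upd_apply)
        then show ?thesis by blast
      qed
      have X: "u x = env i j s x" if "x \<in> X" for x
      proof (cases "x \<in> {''i'', ''j''}")
        case False
        then have "u x = s x" using sameD[OF same] that ok(2) by blast
        then show ?thesis using False by (simp add: env_def upd_apply)
      qed (rule loop_vars)
      have eq: "bval (fst g) u = bval (fst g) (env i j s) \<and> eval_pairs (snd g) u = eval_pairs (snd g) (env i j s)"
        if g: "g \<in> set gs" for g
      proof -
        have gok: "guard_ok X g" using ok(1) g by (simp add: list_all_iff)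
        show ?thesis using guard_cong[OF gok, of u "env i j s"] X by blast
      qed
      have same': "same ?X s ?u"
        by (rule same_run[OF same]) (use writes_guard_prog in auto)
      have ij: "?u ''i'' = u ''i''" "?u ''j'' = u ''j''"
        by (rule sameD[OF G(1)], simp add: rec_vars_def)+
      have ne: "eval_pairs (snd g) u \<noteq> []" if "g \<in> set gs" for g
        using ok that by (auto simp: eval_pairs_def list_all_iff guard_ok_def)
      have "I ({..<i} \<times> {..<n} \<union> {i} \<times> {..<Suc j}) ?u"
        using G(2)
      proof (elim disjE conjE bexE)
        assume none: "\<nexists>g. g \<in> set gs \<and> bval (fst g) u" and same_rec: "recorded ?u = recorded u"
        have "\<not> hit i j" using none eq unfolding hit_def by blast
        then show ?thesis
          using Iu same' ij same_rec unfolding I_def by (auto simp: less_Suc_eq)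
      next
        fix g assume g: "g \<in> set gs" "bval (fst g) u" "recorded ?u = eval_pairs (snd g) u"
        then have "result (recorded ?u)"
          unfolding result_def
          by (intro exI[of _ i] exI[of _ j] conjI bexI[of _ g]) (use t(1) u(1) g eq[OF g(1)] in simp_all)
        then show ?thesis
          using Iu same' ij g ne[OF g(1)] unfolding I_def by auto
      qed
      then show "J (Suc j) (upd ''j'' 0 (Suc j) ?u)"
        using ij ui by (simp add: J_def I_upd) (simp add: upd_apply)
    qed
    then have "I ({..<Suc i} \<times> {..<n}) (run n (PFor ''j'' (guard_prog gs)) t)"
    proof -
      have "{..<Suc i} \<times> {..<n} = {..<i} \<times> {..<n} \<union> {i} \<times> {..<n}" by (auto simp: less_Suc_eq)
      then show ?thesis using \<open>J n _\<close> by (simp add: J_def)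
    qed
    then show "I ({..<Suc i} \<times> {..<n}) (upd ''i'' 0 (Suc i) (run n (PFor ''j'' (guard_prog gs)) t))"
      by (rule I_upd) simp
  qed
  then show "same ?X s t"
    and "recorded t = [] \<Longrightarrow> i < n \<Longrightarrow> j < n \<Longrightarrow> g \<in> set gs \<Longrightarrow> \<not> bval (fst g) (env i j s)"
    and "recorded t \<noteq> [] \<Longrightarrow> \<exists>i<n. \<exists>j<n. \<exists>g\<in>set gs. bval (fst g) (env i j s) \<and> recorded t = eval_pairs (snd g) (env i j s)"
    by (auto simp: I_def hit_def result_def)
qed

section \<open>Registers for satellites and critical neighbors\<close>

abbreviation (input) I :: aexp where "I \<equiv> Var ''i''"
abbreviation (input) J :: aexp where "J \<equiv> Var ''j''"
abbreviation (input) Ctr :: "aexp \<Rightarrow> aexp" where "Ctr \<equiv> Read ''ctr''"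
abbreviation (input) Size :: "aexp \<Rightarrow> aexp" where "Size a \<equiv> Read ''sz'' (Ctr a)"

text \<open>Star sizes are looked up at the center, so \<open>Size a\<close> is the size of the star of \<open>a\<close>. The shift
  registers \<open>m\<close> collect the last three satellites of \<open>i\<close>, the shift registers \<open>c\<close> the last four
  critical neighbors of \<open>i\<close> in pairwise different stars. Four candidates suffice for each of the
  at most four vertices of the star in Operation 2, because the other three vertices block at
  most three stars. Unused entries hold \<open>i\<close> itself.\<close>

definition Crit :: "aexp \<Rightarrow> bexp" where
  "Crit a = Or (Eq (Size a) (Lit 2)) (Conj (Eq (Size a) (Lit 3)) (Eq (Ctr a) a))"

definition member_exprs :: "aexp \<Rightarrow> aexp list" where
  "member_exprs a = [Read ''m0'' a, Read ''m1'' a, Read ''m2'' a]"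

definition cand_exprs :: "aexp \<Rightarrow> aexp list" where
  "cand_exprs a = [Read ''c0'' a, Read ''c1'' a, Read ''c2'' a, Read ''c3'' a]"

definition collect_member :: prog where
  "collect_member = PIf (Conj (Eq (Ctr J) I) (Neg (Eq J I)))
     (PWrite ''m2'' I (Read ''m1'' I) ;; PWrite ''m1'' I (Read ''m0'' I) ;; PWrite ''m0'' I J) PSkip"

definition collect_cand :: prog where
  "collect_cand = PIf (conj_list ([Adj I J, Crit J, Neg (Eq (Ctr J) (Ctr I))] @
       map (\<lambda>a. Neg (Eq (Ctr J) (Ctr a))) (cand_exprs I)))
     (PWrite ''c3'' I (Read ''c2'' I) ;; PWrite ''c2'' I (Read ''c1'' I) ;;
      PWrite ''c1'' I (Read ''c0'' I) ;; PWrite ''c0'' I J) PSkip"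

definition reset_registers :: prog where
  "reset_registers = PWrite ''m0'' I I ;; PWrite ''m1'' I I ;; PWrite ''m2'' I I ;;
     PWrite ''c0'' I I ;; PWrite ''c1'' I I ;; PWrite ''c2'' I I ;; PWrite ''c3'' I I"

definition collect :: prog where
  "collect = PFor ''i'' (reset_registers ;; PFor ''j'' (collect_member ;; collect_cand))"

definition members :: "mem \<Rightarrow> nat \<Rightarrow> nat list" where
  "members s v = [s ''m0'' v, s ''m1'' v, s ''m2'' v]"

definition cands :: "mem \<Rightarrow> nat \<Rightarrow> nat list" where
  "cands s v = [s ''c0'' v, s ''c1'' v, s ''c2'' v, s ''c3'' v]"

lemma aval_member_exprs: "map (\<lambda>e. aval e s) (member_exprs a) = members s (aval a s)"
  by (simp add: member_exprs_def members_def)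

lemma aval_cand_exprs: "map (\<lambda>e. aval e s) (cand_exprs a) = cands s (aval a s)"
  by (simp add: cand_exprs_def cands_def)

context nat_graph
begin

abbreviation st :: "(nat \<Rightarrow> nat) \<Rightarrow> nat \<Rightarrow> nat set" where
  "st c v \<equiv> star {..<n} c v"

lemma bval_Crit:
  assumes "sized c s" "valid c" "aval a s < n"
  shows "bval (Crit a) s \<longleftrightarrow> crit c (aval a s)"
proof -
  have "c (aval a s) < n" using validD(1)[OF assms(2), of "aval a s"] assms(3) by simp
  then have "s ''sz'' (c (aval a s)) = card (st c (aval a s))"
    using assms(1) by (simp add: sized_def fiber_eq_star)
  then show ?thesis using assms(1) by (auto simp: Crit_def crit_def sized_def)
qed

definition nbr :: "(nat \<Rightarrow> nat) \<Rightarrow> nat \<Rightarrow> nat \<Rightarrow> bool" where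
  "nbr c v w \<longleftrightarrow> w < n \<and> {v, w} \<in> E \<and> crit c w \<and> c w \<noteq> c v"

definition member_inv :: "(nat \<Rightarrow> nat) \<Rightarrow> nat \<Rightarrow> nat \<Rightarrow> nat list \<Rightarrow> bool" where
  "member_inv c i j xs \<longleftrightarrow> xs = take 3 (rev (filter (\<lambda>y. c y = i \<and> y \<noteq> i) [0..<j]) @ [i, i, i])"

definition cand_inv :: "(nat \<Rightarrow> nat) \<Rightarrow> nat \<Rightarrow> nat \<Rightarrow> nat list \<Rightarrow> bool" where
  "cand_inv c i j xs \<longleftrightarrow> (\<exists>ys. length ys \<le> 4 \<and> xs = ys @ replicate (4 - length ys) i \<and>
     set ys \<subseteq> {w. w < j \<and> nbr c i w} \<and> distinct (map c ys) \<and>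
     (length ys = 4 \<or> c ` {w. w < j \<and> nbr c i w} \<subseteq> c ` set ys))"

lemma take_3_shift: "take 3 xs = [a, b, d] \<Longrightarrow> take 3 (j # xs) = [j, a, b]"
proof -
  assume "take 3 xs = [a, b, d]"
  then have "take 2 (take 3 xs) = [a, b]" by simp
  then show ?thesis by (simp add: min_def)
qed

lemma member_inv_step:
  assumes "member_inv c i j [a, b, d]"
  shows "member_inv c i (Suc j) (if c j = i \<and> j \<noteq> i then [j, a, b] else [a, b, d])"
proof -
  let ?xs = "rev (filter (\<lambda>y. c y = i \<and> y \<noteq> i) [0..<j]) @ [i, i, i]"
  have xs: "take 3 ?xs = [a, b, d]" using assms by (simp add: member_inv_def)
  have eq: "rev (filter (\<lambda>y. c y = i \<and> y \<noteq> i) [0..<Suc j]) @ [i, i, i] = (if c j = i \<and> j \<noteq> i then j # ?xs else ?xs)"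
    by simp
  show ?thesis
    unfolding member_inv_def eq
    by (simp only: if_distrib[of "take 3"] xs take_3_shift[OF xs, of j])
qed

text \<open>A full register loses its oldest entry but still represents four different stars. Before
  it is full nothing is lost, so every star with a critical neighbor seen so far has a
  representative.\<close>

lemma cand_inv_step:
  assumes inv: "cand_inv c i j [a0, a1, a2, a3]" and push: "P \<longleftrightarrow> nbr c i j \<and> c j \<notin> c ` set [a0, a1, a2, a3]"
  shows "cand_inv c i (Suc j) (if P then [j, a0, a1, a2] else [a0, a1, a2, a3])"
proof -
  obtain ys where ys: "length ys \<le> 4" "[a0, a1, a2, a3] = ys @ replicate (4 - length ys) i"
    "set ys \<subseteq> {w. w < j \<and> nbr c i w}" "distinct (map c ys)"
    "length ys = 4 \<or> c ` {w. w < j \<and> nbr c i w} \<subseteq> c ` set ys"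
    using inv unfolding cand_inv_def by blast
  have set_ys: "set ys \<subseteq> set [a0, a1, a2, a3]" "set [a0, a1, a2, a3] \<subseteq> insert i (set ys)"
    using arg_cong[OF ys(2), of set] by (auto split: if_splits)
  show ?thesis
  proof (cases P)
    case True
    then have j: "nbr c i j" "c j \<notin> c ` set ys" using push set_ys by auto
    show ?thesis
    proof (cases "length ys = 4")
      case False
      have "[j, a0, a1, a2] = j # butlast [a0, a1, a2, a3]" by simp
      also have "\<dots> = j # butlast (ys @ replicate (4 - length ys) i)" using ys(2) by simp
      also have "\<dots> = (j # ys) @ replicate (4 - length (j # ys)) i"
      proof -
        obtain m where m: "4 - length ys = Suc m" using False ys(1) by (cases "4 - length ys") auto
        then have "replicate (4 - length ys) i = replicate m i @ [i]" by (simp add: replicate_append_same)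
        moreover have "4 - length (j # ys) = m" using m by simp
        ultimately show ?thesis by (simp add: butlast_append)
      qed
      finally have eq: "[j, a0, a1, a2] = (j # ys) @ replicate (4 - length (j # ys)) i" .
      have "c ` {w. w < Suc j \<and> nbr c i w} \<subseteq> c ` set (j # ys)"
        using ys(5) False by (auto simp: less_Suc_eq)
      then show ?thesis
        unfolding cand_inv_def using True eq ys(1,3,4) j False
        by (intro exI[of _ "j # ys"]) (auto simp: less_Suc_eq)
    next
      case True
      then have "ys = [a0, a1, a2, a3]" using ys(2) by simp
      then show ?thesis
        unfolding cand_inv_def using \<open>P\<close> ys(3,4) j
        by (intro exI[of _ "[j, a0, a1, a2]"]) (auto simp: less_Suc_eq)
    qed
  next
    case False
    have "c ` {w. w < Suc j \<and> nbr c i w} \<subseteq> c ` set ys" if "length ys \<noteq> 4"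
    proof -
      have "c j \<in> c ` set ys" if "nbr c i j"
      proof -
        have "c j \<in> c ` set [a0, a1, a2, a3]" using False push that by blast
        then have "c j \<in> c ` insert i (set ys)" using set_ys(2) by blast
        moreover have "c j \<noteq> c i" using that by (simp add: nbr_def)
        ultimately show ?thesis by auto
      qed
      then show ?thesis using ys(5) that by (auto simp: less_Suc_eq)
    qed
    then show ?thesis
      unfolding cand_inv_def using False ys(1-4)
      by (intro exI[of _ ys]) (auto simp: less_Suc_eq)
  qed
qed

lemma cand_inv_init: "cand_inv c i 0 [i, i, i, i]"
  unfolding cand_inv_def by (intro exI[of _ "[]"]) (simp add: numeral_eq_Suc)

lemma member_inv_init: "member_inv c i 0 [i, i, i]"
  by (simp add: member_inv_def)

lemma run_collect:
  assumes "input_stored k n E s" "sized c s" "valid c"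
  defines "t \<equiv> run n collect s"
  shows "\<forall>v<n. member_inv c v n (members t v) \<and> cand_inv c v n (cands t v)"
proof -
  let ?X = "{''i'', ''j'', ''m0'', ''m1'', ''m2'', ''c0'', ''c1'', ''c2'', ''c3''}"
  define Q where "Q j v t \<longleftrightarrow> member_inv c v j (members t v) \<and> cand_inv c v j (cands t v)" for j v t
  have Q_upd: "Q j v (upd x y z t) \<longleftrightarrow> Q j v t" if "x \<in> {''i'', ''j''}" for j v x y z t
    using that by (auto simp: Q_def members_def cands_def upd_apply)
  define K where "K i t \<longleftrightarrow> same ?X s t \<and> (\<forall>v<i. Q n v t)" for i t
  have "K n t"
    unfolding t_def collect_def
  proof (rule run_PFor)
    show "K 0 (upd ''i'' 0 0 s)" by (auto simp: K_def intro!: same_upd same_refl)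
    fix i t assume t: "i < n" "K i t" "t ''i'' 0 = i"
    define L where "L j u \<longleftrightarrow> same ?X s u \<and> u ''i'' 0 = i \<and> (\<forall>v<i. Q n v u) \<and> Q j i u" for j u
    let ?t = "run n reset_registers t"
    have "same ?X s ?t"
      using t by (intro same_run) (auto simp: K_def reset_registers_def)
    moreover have "Q 0 i ?t" "?t ''i'' 0 = i" "\<forall>v<i. Q n v ?t"
      using t cand_inv_init member_inv_init
      by (auto simp: K_def Q_def reset_registers_def members_def cands_def upd_apply)
    ultimately have init: "L 0 (upd ''j'' 0 0 ?t)"
      using Q_upd by (auto simp: L_def upd_apply intro!: same_upd)
    have "L n (run n (PFor ''j'' (collect_member ;; collect_cand)) ?t)"
    proof (rule run_PFor)
      show "L 0 (upd ''j'' 0 0 ?t)" by (rule init)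
      fix j u assume u: "j < n" "L j u" "u ''j'' 0 = j"
      define u1 where "u1 = run n collect_member u"
      define u2 where "u2 = run n collect_cand u1"
      have same: "same ?X s u" and ui: "u ''i'' 0 = i" and Qu: "\<forall>v<i. Q n v u" "Q j i u"
        using u(2) by (auto simp: L_def)
      have ctr: "u ''ctr'' = c" using sized_same[OF assms(2) same] by (simp add: sized_def)
      have u1_same: "same ?X s u1" unfolding u1_def by (rule same_run[OF same]) (auto simp: collect_member_def)
      have u1_ij: "u1 ''i'' 0 = i" "u1 ''j'' 0 = j" "u1 ''ctr'' = c"
        using ui u(3) ctr by (auto simp: u1_def collect_member_def upd_apply)
      have u1_m: "members u1 i = (if c j = i \<and> j \<noteq> i then [j, u ''m0'' i, u ''m1'' i] else members u i)"
        "\<forall>v. v \<noteq> i \<longrightarrow> members u1 v = members u v" "\<forall>v. cands u1 v = cands u v"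
        using ui u(3) ctr by (auto simp: u1_def collect_member_def members_def cands_def upd_apply)
      have inp1: "input_stored k n E u1" using input_stored_same[OF assms(1) u1_same] by simp
      have sized1: "sized c u1" using sized_same[OF assms(2) u1_same] by simp
      have adj: "bval (Adj I J) u1 \<longleftrightarrow> {i, j} \<in> E"
        using bval_Adj[OF inp1, of I J] u1_ij t(1) u(1) by simp
      have crit: "bval (Crit J) u1 \<longleftrightarrow> crit c j"
        using bval_Crit[OF sized1 assms(3), of J] u1_ij u(1) by simp
      let ?P = "nbr c i j \<and> c j \<notin> c ` set (cands u i)"
      have guard: "bval (conj_list ([Adj I J, Crit J, Neg (Eq (Ctr J) (Ctr I))] @
         map (\<lambda>a. Neg (Eq (Ctr J) (Ctr a))) (cand_exprs I))) u1 \<longleftrightarrow> ?P"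
        using adj crit u1_ij u(1) u1_m(3)
        by (auto simp: nbr_def cand_exprs_def cands_def)
      have u2_same: "same ?X s u2" unfolding u2_def by (rule same_run[OF u1_same]) (auto simp: collect_cand_def)
      have u2_ij: "u2 ''i'' 0 = i" "\<forall>v. members u2 v = members u1 v"
        using u1_ij by (auto simp: u2_def collect_cand_def members_def upd_apply)
      have u2_c: "cands u2 i = (if ?P then [j, u ''c0'' i, u ''c1'' i, u ''c2'' i] else cands u i)"
        "\<forall>v. v \<noteq> i \<longrightarrow> cands u2 v = cands u v"
        using u1_ij u1_m(3) guard
        by (auto simp: u2_def collect_cand_def cands_def upd_apply simp del: bval_conj_list)
      have "member_inv c i (Suc j) (members u2 i)"
      proof -
        have mi: "member_inv c i j [u ''m0'' i, u ''m1'' i, u ''m2'' i]" using Qu(2) by (simp add: Q_def members_def)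
        have "members u2 i = (if c j = i \<and> j \<noteq> i then [j, u ''m0'' i, u ''m1'' i] else [u ''m0'' i, u ''m1'' i, u ''m2'' i])"
          using u1_m(1) u2_ij(2) by (simp add: members_def[of u])
        then show ?thesis using member_inv_step[OF mi] by (simp only:)
      qed
      moreover have "cand_inv c i (Suc j) (cands u2 i)"
        using cand_inv_step[of c i j "u ''c0'' i" "u ''c1'' i" "u ''c2'' i" "u ''c3'' i" ?P] Qu(2) u2_c(1)
        unfolding Q_def cands_def by simp
      moreover have "\<forall>v<i. Q n v u2" using Qu(1) u1_m u2_c u2_ij by (auto simp: Q_def)
      ultimately have "L (Suc j) u2" using u2_same u2_ij by (simp add: L_def Q_def)
      then show "L (Suc j) (upd ''j'' 0 (Suc j) (run n (collect_member ;; collect_cand) u))"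
        using Q_upd by (auto simp: L_def u1_def u2_def upd_apply intro!: same_upd)
    qed
    then show "K (Suc i) (upd ''i'' 0 (Suc i) (run n (reset_registers ;; PFor ''j'' (collect_member ;; collect_cand)) t))"
      using Q_upd by (auto simp: L_def K_def less_Suc_eq intro!: same_upd)
  qed
  then show ?thesis by (simp add: K_def Q_def)
qed

definition ready :: "(nat \<Rightarrow> nat) \<Rightarrow> mem \<Rightarrow> bool" where
  "ready c s \<longleftrightarrow> input_stored k n E s \<and> sized c s \<and>
     (\<forall>v<n. member_inv c v n (members s v) \<and> cand_inv c v n (cands s v))"

lemma set_members: "member_inv c i n xs \<Longrightarrow> i < n \<Longrightarrow> x \<in> set xs \<Longrightarrow> x < n"
  unfolding member_inv_def by (auto dest!: in_set_takeD)

text \<open>The padding stands behind the satellites, and \<open>take m\<close> cuts it off; three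
  entries are enough for stars with at most four vertices.\<close>

lemma take_members:
  assumes "member_inv c i n xs" "i < n" "c i = i" "card (st c i) = Suc m" "m \<le> 3"
  shows "distinct (take m xs)" "set (take m xs) = st c i - {i}" "length (take m xs) = m"
proof -
  let ?ys = "filter (\<lambda>y. c y = i \<and> y \<noteq> i) [0..<n]"
  have set_ys: "set ?ys = st c i - {i}" using assms(3) by (auto simp: star_def)
  have "i \<in> st c i" using assms(2) by (simp add: star_def)
  then have "card (st c i - {i}) = m" using assms(4) finite_star by simp
  then have len: "length ?ys = m" using set_ys distinct_card[of ?ys] by simp
  have "take m xs = rev ?ys" using assms(1,5) len by (simp add: member_inv_def min_def)
  then show "distinct (take m xs)" "set (take m xs) = st c i - {i}" "length (take m xs) = m"
    using set_ys len by simp_all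
qed

lemma set_cands: "cand_inv c i n xs \<Longrightarrow> x \<in> set xs \<Longrightarrow> x = i \<or> nbr c i x"
  unfolding cand_inv_def by (auto split: if_splits)

text \<open>Four different stars cannot all be in \<open>B\<close>; with fewer entries every
  available star is represented, in particular that of \<open>w\<close>.\<close>

lemma cands_avoid:
  assumes "cand_inv c i n xs" "nbr c i w" "c w \<notin> B" "card B \<le> 3" "finite B"
  shows "\<exists>x\<in>set xs. nbr c i x \<and> c x \<notin> B"
proof -
  obtain ys where ys: "xs = ys @ replicate (4 - length ys) i"
    "set ys \<subseteq> {w. w < n \<and> nbr c i w}" "distinct (map c ys)"
    "length ys = 4 \<or> c ` {w. w < n \<and> nbr c i w} \<subseteq> c ` set ys"
    using assms(1) unfolding cand_inv_def by blast
  have "\<exists>x\<in>set ys. c x \<notin> B"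
  proof (cases "length ys = 4")
    case True
    then have "card (c ` set ys) = 4" using distinct_card[OF ys(3)] by simp
    then have "\<not> c ` set ys \<subseteq> B" using card_mono[OF assms(5), of "c ` set ys"] assms(4) by auto
    then show ?thesis by auto
  next
    case False
    have "w < n" using assms(2) by (simp add: nbr_def)
    then have "c w \<in> c ` set ys" using ys(4) False assms(2) by blast
    then show ?thesis using assms(3) by auto
  qed
  then show ?thesis using ys(1,2) by auto
qed

text \<open>Greedy replacement of the partners \<open>f v\<close> by register entries. A choice must
  avoid the stars chosen already and those of the partners still to be replaced, so that the
  induction can continue; together these are at most three.\<close>

lemma candidate_representatives:
  assumes "\<forall>v\<in>set vs. v < n \<and> nbr c v (f v)" "\<forall>v<n. cand_inv c v n (C v)"
    and "distinct (map c ws @ map (c \<circ> f) vs)" "length ws + length vs \<le> 4"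
  shows "\<exists>us. list_all2 (\<lambda>u v. u \<in> set (C v)) us vs \<and> distinct (map c (ws @ us)) \<and> list_all2 (\<lambda>u v. nbr c v u) us vs"
  using assms
proof (induction vs arbitrary: ws)
  case (Cons v vs)
  let ?B = "set (map c ws @ map (c \<circ> f) vs)"
  have "card ?B \<le> length (map c ws @ map (c \<circ> f) vs)" by (rule card_length)
  then have "card ?B \<le> 3" using Cons.prems(4) by simp
  moreover have "c (f v) \<notin> ?B" using Cons.prems(3) by auto
  ultimately obtain x where x: "x \<in> set (C v)" "nbr c v x" "c x \<notin> ?B"
    using cands_avoid[of c v "C v" "f v" ?B] Cons.prems(1,2) by auto
  have "distinct (map c (ws @ [x]) @ map (c \<circ> f) vs)" using Cons.prems(3) x(3) by (auto simp: comp_def)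
  then obtain us where "list_all2 (\<lambda>u v. u \<in> set (C v)) us vs" "distinct (map c ((ws @ [x]) @ us))"
    "list_all2 (\<lambda>u v. nbr c v u) us vs"
    using Cons.IH[of "ws @ [x]"] Cons.prems by auto
  then show ?case using x by (intro exI[of _ "x # us"]) auto
qed auto

end

section \<open>The guards\<close>

text \<open>\<open>I\<close> is the center of the absorbing star and \<open>J\<close> the center of
  the 2-star, whose satellite is the newest register entry \<open>Read ''m0'' J\<close>.\<close>

definition Absorbs :: bexp where
  "Absorbs = conj_list [Eq (Ctr I) I, Eq (Ctr J) J, Neg (Eq I J), Eq (Size J) (Lit 2),
     Adj (Read ''m0'' J) I, Adj J I]"

definition guards1 :: "guard list" where
  "guards1 = [(conj_list [Adj J I, Eq (Size I) (Lit 2), Neg (Lt (Size J) (Lit 4)), Neg (Eq (Ctr J) J)],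
     [(J, I)])]"

definition guards3 :: "guard list" where
  "guards3 = [(conj_list [Absorbs, Or (Eq (Size I) (Lit 2)) (Conj (Eq (Size I) (Lit 3)) (Lt (Lit 4) (Var ''k'')))],
     [(Read ''m0'' J, I), (J, I)])]"

definition guards3' :: "guard list" where
  "guards3' = concat (map (\<lambda>y. map (\<lambda>w.
     (conj_list [Absorbs, Eq (Size I) (Lit 3), Neg (Lt (Lit 4) (Var ''k'')), Neg (Eq (Ctr w) I), Neg (Eq (Ctr w) J)],
      [(y, w), (Read ''m0'' J, I), (J, I)])) (cand_exprs y)) (take 2 (member_exprs I)))"

fun differ :: "aexp list \<Rightarrow> bexp list" where
  "differ [] = []"
| "differ (w # ws) = map (\<lambda>u. Neg (Eq (Ctr w) (Ctr u))) ws @ differ ws"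

text \<open>One guard for each choice of partners from the registers: at most 256, whatever the
  input. Adjacency and criticality are built into the registers: an entry of
  \<open>cands s v\<close> is a \<open>nbr\<close> or \<open>v\<close> itself, and the latter is
  ruled out because its center is \<open>I\<close>.\<close>

definition guards2_for :: "nat \<Rightarrow> guard list" where
  "guards2_for m = (let vs = take m (member_exprs I) @ [I] in
     map (\<lambda>ws. (conj_list ([Eq (Ctr I) I, Eq (Size I) (Lit (Suc m))] @
         map (\<lambda>w. Neg (Eq (Ctr w) I)) ws @ differ ws), zip vs ws))
       (product_lists (map cand_exprs vs)))"

definition guards :: "guard list" where
  "guards = guards1 @ guards3 @ guards3' @ guards2_for 1 @ guards2_for 2 @ guards2_for 3"

definition guard_vars :: "string set" where
  "guard_vars = {''i'', ''j'', ''k'', ''adj'', ''row'', ''ctr'', ''sz'', ''m0'', ''m1'', ''m2'',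
     ''c0'', ''c1'', ''c2'', ''c3''}"

lemma bval_differ: "(\<forall>b\<in>set (differ ws). bval b s) \<longleftrightarrow> distinct (map (\<lambda>w. s ''ctr'' (aval w s)) ws)"
proof (induction ws)
  case (Cons w ws)
  have "(\<forall>b\<in>set (differ (w # ws)). bval b s) \<longleftrightarrow>
      (\<forall>u\<in>set ws. s ''ctr'' (aval w s) \<noteq> s ''ctr'' (aval u s)) \<and> (\<forall>b\<in>set (differ ws). bval b s)"
    by (simp add: ball_Un)
  then show ?case unfolding Cons.IH by (simp add: image_iff)
qed simp

lemma list_all2_in_set: "list_all2 P xs ys \<Longrightarrow> x \<in> set xs \<Longrightarrow> \<exists>y\<in>set ys. P x y"
  by (metis in_set_conv_nth list_all2_conv_all_nth)

lemma in_product_lists_map: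
  "ws \<in> set (product_lists (map f vs)) \<longleftrightarrow> list_all2 (\<lambda>w v. w \<in> set (f v)) ws vs"
  by (simp add: product_lists_set list.rel_map)

lemma eval_pairs_zip:
  "eval_pairs (zip as bs) s = zip (map (\<lambda>e. aval e s) as) (map (\<lambda>e. aval e s) bs)"
  by (simp add: eval_pairs_def zip_map_map)

lemma bvars_differ: "b \<in> set (differ ws) \<Longrightarrow> bvars b \<subseteq> insert ''ctr'' (\<Union>w\<in>set ws. avars w)"
  by (induction ws) auto

lemma member_exprs_ok: "a \<in> set (member_exprs b) \<Longrightarrow> avars b \<subseteq> guard_vars \<Longrightarrow> avars a \<subseteq> guard_vars \<and> grows_slowly a"
  by (auto simp: member_exprs_def guard_vars_def)

lemma cand_exprs_ok: "a \<in> set (cand_exprs b) \<Longrightarrow> avars b \<subseteq> guard_vars \<Longrightarrow> avars a \<subseteq> guard_vars \<and> grows_slowly a"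
  by (auto simp: cand_exprs_def guard_vars_def)

lemma loop_vars_ok: "avars I \<subseteq> guard_vars" "avars J \<subseteq> guard_vars" "bvars Absorbs \<subseteq> guard_vars"
  by (auto simp: guard_vars_def Absorbs_def)

lemma guards2_for_ok:
  assumes "m \<le> 3" "g \<in> set (guards2_for m)"
  shows "guard_ok guard_vars g"
proof -
  let ?vs = "take m (member_exprs I) @ [I]"
  obtain ws where ws: "ws \<in> set (product_lists (map cand_exprs ?vs))"
    and g: "g = (conj_list ([Eq (Ctr I) I, Eq (Size I) (Lit (Suc m))] @
         map (\<lambda>w. Neg (Eq (Ctr w) I)) ws @ differ ws), zip ?vs ws)"
    using assms(2) unfolding guards2_for_def by (auto simp: Let_def)
  have L: "list_all2 (\<lambda>w v. w \<in> set (cand_exprs v)) ws ?vs"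
    using ws in_product_lists_map by blast
  have vs: "avars v \<subseteq> guard_vars \<and> grows_slowly v" if "v \<in> set ?vs" for v
    using that member_exprs_ok[of v I] loop_vars_ok by (auto dest: in_set_takeD)
  have wok: "avars w \<subseteq> guard_vars \<and> grows_slowly w" if w: "w \<in> set ws" for w
  proof -
    obtain v where "w \<in> set (cand_exprs v)" "v \<in> set ?vs" using list_all2_in_set[OF L w] by blast
    then show ?thesis using vs cand_exprs_ok by blast
  qed
  have vars_in: "''ctr'' \<in> guard_vars" "''i'' \<in> guard_vars" "''sz'' \<in> guard_vars" by (simp_all add: guard_vars_def)
  have bd: "bvars b \<subseteq> guard_vars" if "b \<in> set (differ ws)" for b
    using bvars_differ[OF that] wok vars_in by blast
  have bm: "bvars b \<subseteq> guard_vars" if b: "b \<in> set (map (\<lambda>w. Neg (Eq (Ctr w) I)) ws)" for b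
  proof -
    obtain w where "w \<in> set ws" "b = Neg (Eq (Ctr w) I)" using b by auto
    then show ?thesis using wok[of w] vars_in by auto
  qed
  have "bvars (fst g) \<subseteq> guard_vars"
    unfolding g fst_conv bvars_conj_list set_append UN_Un
    by (intro Un_least UN_least; (erule bd bm)?) (use vars_in in auto)
  moreover have len: "length (snd g) = Suc m"
    using list_all2_lengthD[OF L] assms(1) by (simp add: g member_exprs_def)
  moreover have all: "avars a \<subseteq> guard_vars \<and> avars b \<subseteq> guard_vars \<and> grows_slowly a \<and> grows_slowly b"
    if ab: "(a, b) \<in> set (snd g)" for a b
    using vs[of a] wok[of b] set_zip_leftD[of a b ?vs ws] set_zip_rightD[of a b ?vs ws] ab unfolding g by simp
  ultimately show ?thesis
    unfolding guard_ok_def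
  proof (intro conjI ballI case_prodI2)
    fix p a b assume "p \<in> set (snd g)" "p = (a, b)"
    then show "avars a \<subseteq> guard_vars" "avars b \<subseteq> guard_vars" "grows_slowly a" "grows_slowly b"
      using all[of a b] by simp_all
  qed (use assms(1) len in auto)
qed

lemma guards_ok: "list_all (guard_ok guard_vars) guards"
proof -
  have ok1: "guard_ok guard_vars g" if "g \<in> set guards1" for g
    using that by (auto simp: guards1_def guard_ok_def guard_vars_def)
  have ok3: "guard_ok guard_vars g" if "g \<in> set guards3" for g
    using that by (auto simp: guards3_def guard_ok_def guard_vars_def Absorbs_def)
  have ok4: "guard_ok guard_vars g" if g: "g \<in> set guards3'" for g
  proof -
    obtain y w where yw: "y \<in> set (take 2 (member_exprs I))" "w \<in> set (cand_exprs y)"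
      and g': "g = (conj_list [Absorbs, Eq (Size I) (Lit 3), Neg (Lt (Lit 4) (Var ''k'')), Neg (Eq (Ctr w) I), Neg (Eq (Ctr w) J)],
      [(y, w), (Read ''m0'' J, I), (J, I)])"
      using g unfolding guards3'_def by auto
    have y: "avars y \<subseteq> guard_vars \<and> grows_slowly y"
      using yw(1) member_exprs_ok loop_vars_ok by (blast dest: in_set_takeD)
    then have "avars w \<subseteq> guard_vars \<and> grows_slowly w" using yw(2) cand_exprs_ok by blast
    then show ?thesis
      using y loop_vars_ok unfolding g' guard_ok_def by (auto simp: guard_vars_def)
  qed
  show ?thesis
    unfolding list_all_iff
  proof
    fix g assume "g \<in> set guards"
    then show "guard_ok guard_vars g"
      unfolding guards_def set_append
      by (elim UnE)
        (use ok1 ok3 ok4 guards2_for_ok[of 1 g] guards2_for_ok[of 2 g] guards2_for_ok[of 3 g] in simp_all)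
  qed
qed

context nat_graph
begin

lemma ready_env:
  assumes "ready c s" shows "ready c (env i j s)"
proof -
  have same: "same {''i'', ''j''} s (env i j s)"
    by (auto simp: env_def intro!: same_upd same_refl)
  have "members (env i j s) v = members s v" "cands (env i j s) v = cands s v" for v
    by (simp_all add: members_def cands_def env_def upd_apply)
  then show ?thesis
    using assms input_stored_same[OF _ same] sized_same[OF _ same] unfolding ready_def by simp
qed

section \<open>A guard that holds records a move\<close>

context
  fixes c :: "nat \<Rightarrow> nat" and s :: mem and i j :: nat
  assumes valid: "valid c" and ready: "ready c s" and ij: "i < n" "j < n" "s ''i'' 0 = i" "s ''j'' 0 = j"
begin

lemma input: "input_stored k n E s" and ctr: "s ''ctr'' = c" and kn: "s ''k'' 0 = k"
  using ready by (auto simp: ready_def sized_def input_stored_def)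

lemma size_eq: "v < n \<Longrightarrow> s ''sz'' (c v) = card (st c v)"
  using ready validD(1)[OF valid, of v] by (simp add: ready_def sized_def fiber_eq_star)

lemma mems: "v < n \<Longrightarrow> member_inv c v n (members s v)" and cnds: "v < n \<Longrightarrow> cand_inv c v n (cands s v)"
  using ready by (auto simp: ready_def)

text \<open>The register entry is the satellite if \<open>j\<close> is the center of a 2-star; if
  \<open>j\<close> is not, both sides are false for that reason.\<close>

lemma bval_Absorbs: "bval Absorbs s \<longleftrightarrow> absorbs c i (s ''m0'' j) j"
proof -
  have m0: "s ''m0'' j < n" by (rule set_members[OF mems[OF ij(2)] ij(2)]) (simp add: members_def)
  have adj: "bval (Adj (Read ''m0'' J) I) s \<longleftrightarrow> {s ''m0'' j, i} \<in> E" "bval (Adj J I) s \<longleftrightarrow> {j, i} \<in> E"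
    using bval_Adj[OF input] m0 ij by simp_all
  have sat: "c (s ''m0'' j) = j \<and> s ''m0'' j \<noteq> j" if "c j = j" "card (st c j) = 2"
  proof -
    have "card (st c j) = Suc 1" using that by simp
    from take_members(2)[OF mems[OF ij(2)] ij(2) that(1) this] have "{s ''m0'' j} = st c j - {j}"
      by (simp add: members_def)
    then show ?thesis using that(1) by (auto simp: star_def)
  qed
  show ?thesis
    unfolding absorbs_def Absorbs_def
    using sat adj m0 ij ctr size_eq[OF ij(2)] by auto
qed

text \<open>The filler is \<open>v\<close> itself, so lying in a different star already identifies a
  genuine candidate.\<close>

lemma nbr_of_cand: "v < n \<Longrightarrow> w \<in> set (cands s v) \<Longrightarrow> c w \<noteq> c v \<Longrightarrow> nbr c v w"
  using set_cands[OF cnds] by auto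

lemma guards1_sound: "g \<in> set guards1 \<Longrightarrow> bval (fst g) s \<Longrightarrow> move c (eval_pairs (snd g) s)"
  using ij ctr size_eq[OF ij(1)] size_eq[OF ij(2)] bval_Adj[OF input, of J I]
  by (auto simp: guards1_def eval_pairs_def intro!: move1)

lemma guards3_sound:
  assumes "g \<in> set guards3" "bval (fst g) s"
  shows "move c (eval_pairs (snd g) s)"
proof -
  have b: "absorbs c i (s ''m0'' j) j" "s ''sz'' (c i) = 2 \<or> s ''sz'' (c i) = 3 \<and> 4 < k"
    using assms bval_Absorbs ij ctr kn unfolding guards3_def by auto
  have "card (st c i) = 2 \<or> card (st c i) = 3 \<and> 5 \<le> k" using b(2) size_eq[OF ij(1)] by auto
  then have "move c [(s ''m0'' j, i), (j, i)]" by (rule move3[OF b(1)])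
  then show ?thesis using assms(1) by (simp add: guards3_def eval_pairs_def ij)
qed

lemma guards3'_sound:
  assumes "g \<in> set guards3'" "bval (fst g) s"
  shows "move c (eval_pairs (snd g) s)"
proof -
  obtain y w where yw: "y \<in> set (take 2 (member_exprs I))" "w \<in> set (cand_exprs y)"
    and g: "g = (conj_list [Absorbs, Eq (Size I) (Lit 3), Neg (Lt (Lit 4) (Var ''k'')), Neg (Eq (Ctr w) I), Neg (Eq (Ctr w) J)],
      [(y, w), (Read ''m0'' J, I), (J, I)])"
    using assms(1) unfolding guards3'_def by auto
  define y' w' where "y' = aval y s" and "w' = aval w s"
  have b: "absorbs c i (s ''m0'' j) j" "s ''sz'' (c i) = 3" "\<not> 5 \<le> k" "c w' \<noteq> i" "c w' \<noteq> j"
    using assms(2) bval_Absorbs ij ctr kn unfolding g w'_def by auto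
  have ci: "c i = i" using b(1) by (simp add: absorbs_def)
  have 3: "card (st c i) = 3" using b(2) size_eq[OF ij(1)] ci by simp
  then have "card (st c i) = Suc 2" by simp
  note tm = take_members[OF mems[OF ij(1)] ij(1) ci this]
  have "y' \<in> set (take 2 (members s i))"
    using imageI[OF yw(1), of "\<lambda>e. aval e s"] aval_member_exprs[of s I] ij
    unfolding y'_def by (metis aval.simps(1,2) list.set_map take_map)
  then have y: "y' \<in> st c i" "y' \<noteq> i" using tm(2) by auto
  then have y': "y' < n" "c y' = i" using ci by (auto simp: star_def)
  have "w' \<in> set (cands s y')"
    using imageI[OF yw(2), of "\<lambda>e. aval e s"] aval_cand_exprs[of s y]
    unfolding y'_def w'_def by (metis list.set_map)
  then have "nbr c y' w'" using nbr_of_cand[of y' w'] y' b(4) by simp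
  then have "move c [(y', w'), (s ''m0'' j, i), (j, i)]"
    using b 3 y by (intro move3') (auto simp: nbr_def)
  then show ?thesis by (simp add: g eval_pairs_def y'_def w'_def ij)
qed

lemma guards2_sound:
  assumes "g \<in> set (guards2_for m)" "bval (fst g) s" "1 \<le> m" "m \<le> 3"
  shows "move c (eval_pairs (snd g) s)"
proof -
  let ?vs = "take m (member_exprs I) @ [I]"
  obtain ws where ws: "ws \<in> set (product_lists (map cand_exprs ?vs))"
    and g: "g = (conj_list ([Eq (Ctr I) I, Eq (Size I) (Lit (Suc m))] @
         map (\<lambda>w. Neg (Eq (Ctr w) I)) ws @ differ ws), zip ?vs ws)"
    using assms(1) unfolding guards2_for_def by (auto simp: Let_def)
  let ?ev = "\<lambda>e. aval e s"
  define vs us where "vs = map ?ev ?vs" and "us = map ?ev ws"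
  have vs_eq: "vs = take m (members s i) @ [i]"
    unfolding vs_def using aval_member_exprs[of s I] ij by (simp add: take_map[symmetric])
  have L: "list_all2 (\<lambda>w v. w \<in> set (cand_exprs v)) ws ?vs"
    using ws in_product_lists_map by blast
  then have L': "list_all2 (\<lambda>u v. u \<in> set (cands s v)) us vs"
    unfolding us_def vs_def list.rel_map
    by (rule list.rel_mono_strong) (simp only: aval_cand_exprs[symmetric] list.set_map, rule imageI)
  have b: "c i = i" "s ''sz'' (c i) = Suc m" "\<forall>u\<in>set us. c u \<noteq> i" "distinct (map c us)"
  proof -
    have "\<forall>b\<in>set (differ ws). bval b s" "c i = i" "s ''sz'' (c i) = Suc m" "\<forall>w\<in>set ws. c (aval w s) \<noteq> i"
      using assms(2) ij ctr unfolding g by (auto simp: ball_Un)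
    then show "c i = i" "s ''sz'' (c i) = Suc m" "\<forall>u\<in>set us. c u \<noteq> i" "distinct (map c us)"
      using bval_differ[of ws s] ctr by (auto simp: us_def comp_def)
  qed
  have card: "card (st c i) = Suc m" using b(1,2) size_eq[OF ij(1)] by simp
  note tm = take_members[OF mems[OF ij(1)] ij(1) b(1) card assms(4)]
  have i_in: "i \<in> st c i" using ij by (simp add: star_def)
  have dist: "distinct vs" and set_vs: "set vs = st c i" using tm i_in by (auto simp: vs_eq)
  have len: "length us = length vs" "length vs = Suc m" using list_all2_lengthD[OF L'] tm(3) by (auto simp: vs_eq)
  then obtain us' u where us: "us = us' @ [u]" by (metis Suc_length_conv length_0_conv list.distinct(1) rev_exhaust)
  have ev: "eval_pairs (snd g) s = zip vs us"
    unfolding g vs_def us_def snd_conv by (rule eval_pairs_zip)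
  have "length us' = m" using len us by simp
  then have split: "zip vs us = zip (take m (members s i)) us' @ [(i, u)]"
    using tm(3) by (simp add: vs_eq us)
  have "move c (zip vs us)"
  proof (rule move2[where r = i and Ls = "zip (take m (members s i)) us'" and w = u])
    show "c i = i" "zip vs us = zip (take m (members s i)) us' @ [(i, u)]" by (rule b(1), rule split)
    show "i \<in> {..<n}" "card (st c i) \<in> {2, 3, 4}" using ij card assms(3,4) by auto
    show "distinct (map fst (zip vs us))" "set (map fst (zip vs us)) = st c i"
      "distinct (map (c \<circ> snd) (zip vs us))"
      using dist set_vs len b(4) by (simp_all flip: map_map)
    fix v w assume vw: "(v, w) \<in> set (zip vs us)"
    then have v: "v \<in> st c i" and w: "w \<in> set us" using set_vs by (auto dest: set_zip_leftD set_zip_rightD)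
    obtain p where "p < length us" "v = vs ! p" "w = us ! p" using vw len by (auto simp: set_zip)
    then have "w \<in> set (cands s v)" using list_all2_nthD[OF L', of p] by simp
    moreover have cv: "c v = i" "v < n" using v b(1) by (auto simp: star_def)
    moreover have "c w \<noteq> i" using w b(3) by simp
    ultimately have "nbr c v w" using nbr_of_cand[of v w] by simp
    then show "w \<in> {..<n} \<and> crit c w \<and> c w \<noteq> i \<and> {v, w} \<in> E" using cv by (auto simp: nbr_def)
  qed
  then show ?thesis using ev by simp
qed

lemma guards_sound:
  assumes "g \<in> set guards" "bval (fst g) s" shows "move c (eval_pairs (snd g) s)"
  using assms(1) unfolding guards_def set_append
  by (elim UnE) (use assms(2) guards1_sound[of g] guards3_sound[of g] guards3'_sound[of g]
    guards2_sound[of g 1] guards2_sound[of g 2] guards2_sound[of g 3] in simp_all)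

section \<open>Every move makes some guard true\<close>

lemma move1_found:
  assumes "{j, i} \<in> E" "card (st c i) = 2" "4 \<le> card (st c j)" "c j \<noteq> j"
  shows "\<exists>g\<in>set guards. bval (fst g) s"
  unfolding guards_def guards1_def
  using assms ij ctr size_eq bval_Adj[OF input, of J I] by (simp add: not_less)

lemma absorbs_m0:
  assumes "absorbs c i x j" shows "s ''m0'' j = x"
proof -
  have cj: "c j = j" "x \<noteq> j" and "card (st c j) = 2" using assms by (auto simp: absorbs_def)
  then have card: "card (st c j) = Suc 1" by simp
  have "{s ''m0'' j} = st c j - {j}"
    using take_members(2)[OF mems[OF ij(2)] ij(2) cj(1) card] by (simp add: members_def)
  also have "\<dots> = {x}" using absorbs_star[OF assms] cj by auto
  finally show ?thesis by simp
qed

lemma move3_found: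
  assumes "absorbs c i x j" "card (st c i) = 2 \<or> card (st c i) = 3 \<and> 5 \<le> k"
  shows "\<exists>g\<in>set guards. bval (fst g) s"
proof -
  have "bval Absorbs s" using bval_Absorbs absorbs_m0[OF assms(1)] assms(1) by simp
  moreover have "s ''sz'' (c i) = 2 \<or> s ''sz'' (c i) = 3 \<and> 4 < k" using assms(2) size_eq[OF ij(1)] by auto
  ultimately have "\<exists>g\<in>set guards3. bval (fst g) s"
    using ij ctr kn unfolding guards3_def by simp
  then show ?thesis unfolding guards_def by auto
qed

text \<open>The partner \<open>w\<close> may be missing from the register, but only the star of
  \<open>j\<close> has to be avoided, and \<open>cands_avoid\<close> supplies an entry outside
  it.\<close>

lemma move3'_found:
  assumes "absorbs c i x j" "card (st c i) = 3" "\<not> 5 \<le> k" "y \<in> st c i" "y \<noteq> i"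
    "nbr c y w" "c w \<noteq> j"
  shows "\<exists>g\<in>set guards. bval (fst g) s"
proof -
  have ci: "c i = i" using assms(1) by (simp add: absorbs_def)
  have card: "card (st c i) = Suc 2" using assms(2) by simp
  have "y \<in> set (take 2 (members s i))"
    using take_members(2)[OF mems[OF ij(1)] ij(1) ci card] assms(4,5) by simp
  then have "y \<in> (\<lambda>e. aval e s) ` set (take 2 (member_exprs I))"
    using aval_member_exprs[of s I] ij by (metis aval.simps(1,2) list.set_map take_map)
  then obtain y' where y': "y' \<in> set (take 2 (member_exprs I))" "aval y' s = y" by auto
  have yn: "y < n" "c y = i" using assms(4) ci by (auto simp: star_def)
  obtain x where x: "x \<in> set (cands s y)" "nbr c y x" "c x \<noteq> j"
    using cands_avoid[OF cnds[OF yn(1)] assms(6), of "{j}"] assms(7) by auto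
  then have "x \<in> (\<lambda>e. aval e s) ` set (cand_exprs y')"
    using aval_cand_exprs[of s y'] y'(2) by (metis list.set_map)
  then obtain w' where w': "w' \<in> set (cand_exprs y')" "aval w' s = x" by auto
  let ?g = "(conj_list [Absorbs, Eq (Size I) (Lit 3), Neg (Lt (Lit 4) (Var ''k'')), Neg (Eq (Ctr w') I), Neg (Eq (Ctr w') J)],
      [(y', w'), (Read ''m0'' J, I), (J, I)])"
  have "?g \<in> set guards3'" unfolding guards3'_def using y'(1) w'(1) by auto
  moreover have "c x \<noteq> i" using x(2) yn by (simp add: nbr_def)
  moreover have "bval Absorbs s" using bval_Absorbs absorbs_m0[OF assms(1)] assms(1) by simp
  moreover have "s ''sz'' (c i) = 3" using assms(2) size_eq[OF ij(1)] by simp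
  ultimately have "?g \<in> set guards" "bval (fst ?g) s"
    using ij ctr kn x(3) w'(2) assms(3) unfolding guards_def by auto
  then show ?thesis by blast
qed

lemma move2_found:
  assumes "c i = i" "card (st c i) = Suc m" "1 \<le> m" "m \<le> 3"
    and "\<forall>v\<in>st c i. nbr c v (f v)" "inj_on (c \<circ> f) (st c i)"
  shows "\<exists>g\<in>set guards. bval (fst g) s"
proof -
  let ?vs = "take m (member_exprs I) @ [I]" and ?ev = "\<lambda>e. aval e s"
  define vs where "vs = take m (members s i) @ [i]"
  have ev_vs: "map ?ev ?vs = vs"
    unfolding vs_def using aval_member_exprs[of s I] ij by (simp add: take_map[symmetric])
  note tm = take_members[OF mems[OF ij(1)] ij(1) assms(1,2,4)]
  have set_vs: "set vs = st c i" and dist: "distinct vs" and len: "length vs = Suc m"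
    using tm ij by (auto simp: vs_def star_def)
  have pre: "\<forall>v\<in>set vs. v < n \<and> nbr c v (f v)" "\<forall>v<n. cand_inv c v n (cands s v)"
    "distinct (map c [] @ map (c \<circ> f) vs)" "length [] + length vs \<le> 4"
    using assms set_vs dist len cnds by (auto simp: star_def distinct_map)
  obtain us where us: "list_all2 (\<lambda>u v. u \<in> set (cands s v)) us vs" "distinct (map c us)"
    "list_all2 (\<lambda>u v. nbr c v u) us vs"
    using candidate_representatives[OF pre] by auto
  \<comment> \<open>Guards consist of expressions: for every chosen register value, an expression
    that yields it is selected.\<close>
  have "\<exists>ws. list_all2 (\<lambda>w v. w \<in> set (cand_exprs v)) ws es \<and> map ?ev ws = us"
    if "list_all2 (\<lambda>u v. u \<in> set (cands s v)) us (map ?ev es)" for us es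
    using that
  proof (induction es arbitrary: us)
    case (Cons e es)
    then obtain u us' where u: "us = u # us'" "u \<in> set (cands s (?ev e))"
      "list_all2 (\<lambda>u v. u \<in> set (cands s v)) us' (map ?ev es)" by (auto simp: list_all2_Cons2)
    then obtain ws where ws: "list_all2 (\<lambda>w v. w \<in> set (cand_exprs v)) ws es" "map ?ev ws = us'"
      using Cons.IH by blast
    have "u \<in> ?ev ` set (cand_exprs e)" using u(2) aval_cand_exprs[of s e] by (metis list.set_map)
    then obtain w where "w \<in> set (cand_exprs e)" "?ev w = u" by auto
    then show ?case using ws u(1) by (intro exI[of _ "w # ws"]) simp
  qed simp
  then obtain ws where ws: "list_all2 (\<lambda>w v. w \<in> set (cand_exprs v)) ws ?vs" "map ?ev ws = us"
    using us(1) ev_vs by metis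
  let ?g = "(conj_list ([Eq (Ctr I) I, Eq (Size I) (Lit (Suc m))] @
         map (\<lambda>w. Neg (Eq (Ctr w) I)) ws @ differ ws), zip ?vs ws)"
  have in_lists: "ws \<in> set (product_lists (map cand_exprs ?vs))" using ws(1) in_product_lists_map by blast
  have "?g \<in> set (guards2_for m)"
    unfolding guards2_for_def Let_def set_map by (rule image_eqI[OF refl in_lists])
  moreover have "set (guards2_for m) \<subseteq> set guards"
  proof -
    have "m = 1 \<or> m = 2 \<or> m = 3" using assms(3,4) by auto
    then show ?thesis unfolding guards_def by auto
  qed
  moreover have "c u \<noteq> i" if u: "u \<in> set us" for u
  proof -
    obtain v where "nbr c v u" "v \<in> st c i" using list_all2_in_set[OF us(3) u] set_vs by blast
    then show ?thesis using assms(1) by (auto simp: nbr_def star_def)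
  qed
  then have "c u \<noteq> i" if "u \<in> set (map ?ev ws)" for u using that unfolding ws(2) by blast
  then have "\<forall>w\<in>set ws. c (aval w s) \<noteq> i" by simp
  moreover have "distinct (map (\<lambda>w. s ''ctr'' (aval w s)) ws)"
    using us(2) unfolding ws(2)[symmetric] by (simp add: ctr comp_def)
  then have "\<forall>b\<in>set (differ ws). bval b s" using bval_differ by blast
  moreover have "s ''sz'' (c i) = Suc m" using assms(2) size_eq[OF ij(1)] by simp
  ultimately have "?g \<in> set guards" "bval (fst ?g) s"
    using ij ctr assms(1) by (auto simp: ball_Un)
  then show ?thesis by blast
qed

end

lemma guards_complete:
  assumes "valid c" "ready c s" "move c L"
  shows "\<exists>i<n. \<exists>j<n. \<exists>g\<in>set guards. bval (fst g) (env i j s)"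
proof -
  have env: "env i j s ''i'' 0 = i" "env i j s ''j'' 0 = j" for i j
    by (simp_all add: env_def upd_apply)
  note R = ready_env[OF assms(2)]
  show ?thesis
    using assms(3)
  proof cases
    case (move1 u v)
    then show ?thesis
      using move1_found[OF assms(1) R[of u v] _ _ env] by auto
  next
    case (move2 r Ls w)
    define f where "f v = the (map_of L v)" for v
    have f: "(v, f v) \<in> set L" if "v \<in> st c r" for v
    proof -
      have "v \<in> fst ` set L" using that move2(6) by simp
      then show ?thesis unfolding f_def by (metis domIff dom_map_of_conv_image_fst map_of_SomeD option.collapse)
    qed
    have rn: "r < n" using move2(1) by simp
    obtain m where m: "card (st c r) = Suc m" "1 \<le> m" "m \<le> 3"
      using move2(3) by (intro that[of "card (st c r) - 1"]) auto
    have nbr: "\<forall>v\<in>st c r. nbr c v (f v)"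
    proof
      fix v assume v: "v \<in> st c r"
      then have "c v = r" using move2(2) by (simp add: star_def)
      then show "nbr c v (f v)" using move2(8)[OF f[OF v]] by (simp add: nbr_def)
    qed
    have "inj_on (c \<circ> f) (st c r)"
    proof (rule inj_onI)
      fix v v' assume v: "v \<in> st c r" "v' \<in> st c r" "(c \<circ> f) v = (c \<circ> f) v'"
      have "inj_on (c \<circ> snd) (set L)" using move2(7) by (simp add: distinct_map)
      then have "(v, f v) = (v', f v')" using f v by (intro inj_onD[of "c \<circ> snd" "set L"]) auto
      then show "v = v'" by simp
    qed
    \<comment> \<open>The guards for Operation 2 refer to \<open>i\<close> only, so \<open>j\<close>
      may be any vertex; \<open>r\<close> is taken for both.\<close>
    then show ?thesis
      using move2_found[OF assms(1) R[of r r] rn rn env move2(2) m nbr] rn by blast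
  next
    case (move3 v x r)
    have vr: "v < n" "r < n" using move3(2) by (auto simp: absorbs_def)
    show ?thesis
      using move3_found[OF assms(1) R[of v r] vr env move3(2,3)] vr by blast
  next
    case (move3' v x r y w)
    have vr: "v < n" "r < n" "c v = v" using move3'(2) by (auto simp: absorbs_def)
    have "c y = v" using move3'(5) vr by (simp add: star_def)
    then have "nbr c y w" using move3' by (simp add: nbr_def)
    then show ?thesis
      using move3'_found[OF assms(1) R[of v r] vr(1,2) env move3'(2-6) _ move3'(10)] vr by blast
  qed
qed

end

section \<open>The main loop\<close>

definition apply_pair :: "nat \<Rightarrow> prog" where
  "apply_pair t = PIf (Lt (Lit t) (Var ''found''))
     (attach_prog (Read ''pv'' (Lit t)) (Read ''pw'' (Lit t))) PSkip"

definition apply_pairs :: prog where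
  "apply_pairs = apply_pair 0 ;; apply_pair 1 ;; apply_pair 2 ;; apply_pair 3"

definition search :: prog where
  "search = sizes ;; collect ;; find_move guards"

definition start_prog :: prog where
  "start_prog = initialize ;; PFor ''r'' improve ;; search"

text \<open>The body performs the move recorded before and then looks for the next one. So ''found''
  tells the loop condition whether an operation is applicable, and each round performs exactly
  one.\<close>

definition body_prog :: prog where
  "body_prog = apply_pairs ;; search"

lemmas search_prog_defs = search_def collect_def reset_registers_def collect_member_def
  collect_cand_def find_move_def

lemma wf_progs: "wf start_prog" "wf body_prog"
  using wf_guard_prog[OF guards_ok] writes_guard_prog[of guards]
  by (auto simp: start_prog_def body_prog_def prog_defs search_prog_defs apply_pairs_def apply_pair_def
      rec_vars_def)

lemma depth_progs: "depth start_prog = 3" "depth body_prog = 2"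
  by (simp_all add: start_prog_def body_prog_def prog_defs search_prog_defs apply_pairs_def apply_pair_def
      depth_guard_prog)

lemma run_apply_pair:
  "run n (apply_pair t) s ''ctr'' =
     (if t < s ''found'' 0 then attach (s ''pv'' t, s ''pw'' t) (s ''ctr'') else s ''ctr'')"
  "x \<noteq> ''ctr'' \<Longrightarrow> run n (apply_pair t) s x = s x"
proof -
  show "run n (apply_pair t) s ''ctr'' =
     (if t < s ''found'' 0 then attach (s ''pv'' t, s ''pw'' t) (s ''ctr'') else s ''ctr'')"
    using run_attach_prog[of s "Read ''pv'' (Lit t)" "Read ''pw'' (Lit t)" n] by (simp add: apply_pair_def)
  show "x \<noteq> ''ctr'' \<Longrightarrow> run n (apply_pair t) s x = s x"
    by (rule run_frame) (simp add: apply_pair_def attach_prog_def)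
qed

lemma run_apply_pairs:
  assumes "length (recorded s) \<le> 4"
  shows "run n apply_pairs s ''ctr'' = fold attach (recorded s) (s ''ctr'')"
proof -
  have "s ''found'' 0 \<le> 4" using assms by (simp add: recorded_def)
  then have "s ''found'' 0 \<in> {0, 1, 2, 3, 4}" by auto
  moreover have "[0..<1] = [0::nat]" "[0..<2] = [0, 1::nat]" "[0..<3] = [0, 1, 2::nat]"
    "[0..<4] = [0, 1, 2, 3::nat]" by (simp_all add: numeral_eq_Suc)
  ultimately show ?thesis
    by (elim insertE emptyE) (simp_all add: apply_pairs_def run_apply_pair recorded_def)
qed

lemma writes_search: "writes search \<inter> {''n'', ''k'', ''row'', ''adj'', ''ctr''} = {}"
  using writes_guard_prog[of guards]
  by (auto simp: search_prog_defs sizes_def rec_vars_def)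

definition loop_cond :: bexp where
  "loop_cond = Lt (Lit 0) (Var ''found'')"

text \<open>5 is the cost of evaluating the loop condition once, and \<open>2 * n\<close> bounds the
  initial potential.\<close>

definition time_bound :: "nat \<Rightarrow> nat" where
  "time_bound n = cost n start_prog + (5 + 2 * n * (5 + cost n body_prog))"

context nat_graph
begin

lemma run_search:
  assumes "input_stored k n E s" "valid (s ''ctr'')"
  defines "c \<equiv> s ''ctr''" and "t \<equiv> run n search s"
  shows "input_stored k n E t" "t ''ctr'' = c" "length (recorded t) \<le> 4"
    "recorded t \<noteq> [] \<Longrightarrow> move c (recorded t)" "recorded t = [] \<Longrightarrow> \<not> move c L"
proof -
  let ?s1 = "run n sizes s" and ?s2 = "run n collect (run n sizes s)"
  have w: "writes collect \<inter> {''n'', ''k'', ''row'', ''adj'', ''ctr'', ''sz''} = {}"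
    by (simp add: search_prog_defs)
  have v: "valid c" using assms by simp
  have inp1: "input_stored k n E ?s1"
    by (rule input_stored_same[OF assms(1) same_run[OF same_refl order_refl]]) (simp add: writes_sizes)
  have sized1: "sized c ?s1" using run_sizes[of _ n s] by (simp add: sized_def c_def run_frame writes_sizes)
  have "input_stored k n E ?s2"
    by (rule input_stored_same[OF inp1 same_run[OF same_refl order_refl]]) (use w in blast)
  moreover have "sized c ?s2"
    by (rule sized_same[OF sized1 same_run[OF same_refl order_refl]]) (use w in blast)
  ultimately have ready: "ready c ?s2"
    using run_collect[OF inp1 sized1 v] by (simp add: ready_def)
  have t: "t = run n (find_move guards) ?s2" by (simp add: t_def search_def)
  have disj: "guard_vars \<inter> rec_vars = {}" by (auto simp: guard_vars_def rec_vars_def)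
  note F = run_find_move[OF guards_ok disj, where n = n and s = ?s2, folded t]
  show "input_stored k n E t"
    unfolding t_def by (rule input_stored_same[OF assms(1) same_run[OF same_refl order_refl]])
      (use writes_search in blast)
  have "''ctr'' \<notin> writes search" using writes_search by blast
  then show "t ''ctr'' = c" by (simp add: t_def c_def run_frame)
  have hit: "move c (recorded t) \<and> length (recorded t) \<le> 4" if ne: "recorded t \<noteq> []"
  proof -
    obtain i j g where g: "i < n" "j < n" "g \<in> set guards" "bval (fst g) (env i j ?s2)"
      "recorded t = eval_pairs (snd g) (env i j ?s2)" using F(3)[OF ne] by blast
    have "env i j ?s2 ''i'' 0 = i" "env i j ?s2 ''j'' 0 = j" by (simp_all add: env_def upd_apply)
    from guards_sound[OF v ready_env[OF ready] g(1,2) this g(3,4)] g(5)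
    have "move c (recorded t)" by simp
    moreover have "guard_ok guard_vars g" using guards_ok g(3) by (simp add: list_all_iff)
    then have "length (recorded t) \<le> 4" using g(5) by (simp add: guard_ok_def eval_pairs_def)
    ultimately show ?thesis by simp
  qed
  then show "recorded t \<noteq> [] \<Longrightarrow> move c (recorded t)" by blast
  show "length (recorded t) \<le> 4" using hit by (cases "recorded t = []") auto
  show "\<not> move c L" if "recorded t = []"
    using guards_complete[OF v ready, of L] F(2)[OF that] by blast
qed

lemma stored_partition_part:
  assumes "valid (s ''ctr'')" shows "stored_partition n s = part {..<n} (s ''ctr'')"
proof -
  have "{{v, s ''ctr'' v} | v. v < n \<and> s ''ctr'' v < n \<and> s ''ctr'' v \<noteq> v} = links {..<n} (s ''ctr'')"
    using validD(1)[OF assms] by (auto simp: links_def)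
  then show ?thesis by (simp add: stored_partition_def)
qed

lemma recorded_empty: "recorded s = [] \<longleftrightarrow> \<not> 0 < s ''found'' 0"
  by (auto simp: recorded_def)

text \<open>Induction on a bound \<open>m\<close> for the potential: every recorded move lowers it,
  and every round uses up \<open>(n + 4) * cost n body_prog\<close> of the reserve in word
  size.\<close>

lemma run_loop:
  assumes "input_stored k n E s" "valid (s ''ctr'')" "designated \<delta> (s ''ctr'')"
    "length (recorded s) \<le> 4" "recorded s \<noteq> [] \<Longrightarrow> move (s ''ctr'') (recorded s)"
    "recorded s = [] \<Longrightarrow> \<nexists>L. move (s ''ctr'') L"
    and "card (centers (s ''ctr'')) + card (pairs (s ''ctr'')) \<le> m"
    and "bounded B s" "B + (n + 4) * (m * cost n body_prog) \<le> W"
  shows "\<exists>t s'. approx1_loop W k n E \<delta> loop_cond (compile body_prog) s t s' \<and>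
     t \<le> 5 + m * (5 + cost n body_prog) \<and> valid (s' ''ctr'')"
  using assms
proof (induction m arbitrary: s B)
  case (0 s B)
  \<comment> \<open>At potential 0 nothing can be recorded, since a move would lower it
    further.\<close>
  have "recorded s = []"
  proof (rule ccontr)
    assume "recorded s \<noteq> []"
    from move_progress(3)[OF "0.prems"(2) "0.prems"(5)[OF this]] "0.prems"(7) show False by simp
  qed
  then have "approx1_loop W k n E \<delta> loop_cond (compile body_prog) s (1 + bcost loop_cond) s"
    using "0.prems" terminal_iff by (intro approx1_loop.stop)
      (auto simp: loop_cond_def recorded_empty stored_partition_part)
  then show ?case using "0.prems"(2) by (intro exI[of _ "1 + bcost loop_cond"] exI[of _ s]) (simp add: loop_cond_def)
next
  case (Suc m s B)
  let ?c = "s ''ctr''"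
  have n: "s ''n'' 0 = n" using Suc.prems(1) by (simp add: input_stored_def)
  show ?case
  proof (cases "recorded s = []")
    case True
    then have "approx1_loop W k n E \<delta> loop_cond (compile body_prog) s (1 + bcost loop_cond) s"
      using Suc.prems terminal_iff by (intro approx1_loop.stop)
        (auto simp: loop_cond_def recorded_empty stored_partition_part)
    then show ?thesis using Suc.prems(2)
      by (intro exI[of _ "1 + bcost loop_cond"] exI[of _ s]) (simp add: loop_cond_def)
  next
    case False
    note mv = Suc.prems(5)[OF False]
    let ?c' = "fold attach (recorded s) ?c"
    note P = move_progress[OF Suc.prems(2) mv]
    define s1 where "s1 = run n apply_pairs s"
    define s2 where "s2 = run n search s1"
    have s2: "run n body_prog s = s2" by (simp add: body_prog_def s1_def s2_def)
    have ctr1: "s1 ''ctr'' = ?c'" unfolding s1_def by (rule run_apply_pairs[OF Suc.prems(4)])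
    have inp1: "input_stored k n E s1"
      unfolding s1_def by (rule input_stored_same[OF Suc.prems(1) same_run[OF same_refl order_refl]])
        (simp add: apply_pairs_def apply_pair_def attach_prog_def)
    have v1: "valid (s1 ''ctr'')" using P(1) ctr1 by simp
    note S = run_search[OF inp1 v1, folded s2_def]
    have W1: "B + (n + 4) * cost n body_prog \<le> W"
      using Suc.prems(9) by (simp add: algebra_simps)
    obtain t where t: "t \<le> cost n body_prog" "exec W (compile body_prog) s t s2"
      "bounded (B + (n + 4) * cost n body_prog) s2"
      using exec_compile[OF wf_progs(2) n Suc.prems(8) W1] s2 by auto
    have v2: "valid (s2 ''ctr'')" using S(2) v1 by simp
    have c2: "s2 ''ctr'' = ?c'" using S(2) ctr1 by simp
    have "\<exists>t s'. approx1_loop W k n E \<delta> loop_cond (compile body_prog) s2 t s' \<and>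
       t \<le> 5 + m * (5 + cost n body_prog) \<and> valid (s' ''ctr'')"
    proof (rule Suc.IH[OF S(1) v2 _ S(3)])
      show "designated \<delta> (s2 ''ctr'')"
        using designated_keeps[OF Suc.prems(3) P(2)] c2 by simp
      show "move (s2 ''ctr'') (recorded s2)" if "recorded s2 \<noteq> []" using S(2) S(4)[OF that] by simp
      show "\<nexists>L. move (s2 ''ctr'') L" if "recorded s2 = []" using S(2) S(5)[OF that] by simp
      show "card (centers (s2 ''ctr'')) + card (pairs (s2 ''ctr'')) \<le> m"
        using P(3) Suc.prems(7) c2 by simp
      show "bounded (B + (n + 4) * cost n body_prog) s2" by (rule t(3))
      show "B + (n + 4) * cost n body_prog + (n + 4) * (m * cost n body_prog) \<le> W"
        using Suc.prems(9) by (simp add: algebra_simps)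
    qed
    then obtain t' s' where t': "approx1_loop W k n E \<delta> loop_cond (compile body_prog) s2 t' s'"
      "t' \<le> 5 + m * (5 + cost n body_prog)" "valid (s' ''ctr'')" by blast
    have "operation k ({..<n}, E) \<delta> (stored_partition n s) (stored_partition n s2)"
      using move_operation[OF Suc.prems(2,3) mv] stored_partition_part[of s, OF Suc.prems(2)]
        stored_partition_part[of s2, OF v2] c2 by simp
    moreover have "bval loop_cond s" using False by (simp add: loop_cond_def recorded_empty)
    ultimately have "approx1_loop W k n E \<delta> loop_cond (compile body_prog) s (1 + bcost loop_cond + t + t') s'"
      using t(2) t'(1) by (intro approx1_loop.iterate)
    then show ?thesis
      using t(1) t'(2,3) by (intro exI[of _ "1 + bcost loop_cond + t + t'"] exI[of _ s']) (simp add: loop_cond_def)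
  qed
qed

section \<open>Choice of the designation and the complete run\<close>

text \<open>The program stores a center for each 2-star without consulting a designation; this one
  is defined to agree with the stored centers and is arbitrary on all other sets.\<close>

lemma designation_for:
  assumes "valid c" shows "\<exists>\<delta>. designation \<delta> \<and> designated \<delta> c"
proof -
  define \<delta> where "\<delta> e = (if \<exists>v<n. st c v = e then c (SOME v. v < n \<and> st c v = e) else (SOME x. x \<in> e))" for e
  have *: "\<delta> e \<in> e \<and> c v = \<delta> e" if "v < n" "st c v = e" for v e
  proof -
    define u where "u = (SOME v. v < n \<and> st c v = e)"
    have u: "u < n \<and> st c u = e" unfolding u_def using that by (intro someI) blast
    have "\<delta> e = c u" unfolding \<delta>_def u_def using that by auto
    \<comment> \<open>Vertices with the same star have the same center, so it does not matter which
      of them is selected.\<close>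
    moreover have "c u = c v" using star_eqD[of u c v] u that by simp
    ultimately show ?thesis using center_in_star[OF assms, of u] u by auto
  qed
  have "\<delta> e \<in> e" if "card e = 2" for e
  proof (cases "\<exists>v<n. st c v = e")
    case False
    have "e \<noteq> {}" using that by auto
    have "\<delta> e = (SOME x. x \<in> e)" unfolding \<delta>_def by (rule if_not_P[OF False])
    then show ?thesis using \<open>e \<noteq> {}\<close> by (simp add: some_in_eq)
  qed (use * in blast)
  then have "designation \<delta>" by (simp add: designation_def)
  moreover have "designated \<delta> c" using * by (simp add: designated_def)
  ultimately show ?thesis by blast
qed

lemma run_start:
  defines "s \<equiv> run n start_prog (input_mem k n E)"
  shows "input_stored k n E s" "valid (s ''ctr'')"
    "initial_partition k ({..<n}, E) (stored_partition n s)"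
    "length (recorded s) \<le> 4" "recorded s \<noteq> [] \<Longrightarrow> move (s ''ctr'') (recorded s)"
    "recorded s = [] \<Longrightarrow> \<not> move (s ''ctr'') L"
proof -
  let ?s1 = "run n initialize (input_mem k n E)"
  let ?s2 = "run n (PFor ''r'' improve) ?s1"
  note init = run_initialize[OF simple, of k]
  have "valid (?s1 ''ctr'')"
  proof -
    have "star {..<n} (?s1 ''ctr'') v = {v}" if "v < n" for v
      using init(2) that by (auto simp: star_def)
    then show ?thesis using init(2) k4 by (auto simp: valid_def)
  qed
  note R = run_improve_rounds[OF init(1) this]
  have s: "s = run n search ?s2" by (simp add: s_def start_prog_def)
  note S = run_search[OF R(1,2), folded s]
  show "input_stored k n E s" "length (recorded s) \<le> 4" by (rule S)+
  show v: "valid (s ''ctr'')" using S(2) R(2) by simp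
  show "recorded s \<noteq> [] \<Longrightarrow> move (s ''ctr'') (recorded s)"
    "recorded s = [] \<Longrightarrow> \<not> move (s ''ctr'') L" using S(2,4,5) by simp_all
  show "initial_partition k ({..<n}, E) (stored_partition n s)"
    unfolding stored_partition_part[of s, OF v] using initial_partition_part[OF v] S(2) R(3) by simp
qed

lemma bounded_input: "bounded (n + k) (input_mem k n E)"
  using k4 by (auto simp: bounded_def input_mem_def)

lemma approx1_exec_start:
  assumes W: "n + k + (n + 4) * time_bound n \<le> W"
  shows "\<exists>\<delta> t s. designation \<delta> \<and> approx1_exec W k n E \<delta> (compile start_prog) loop_cond (compile body_prog) t s \<and>
     star_partition k ({..<n}, E) (stored_partition n s) \<and> t \<le> time_bound n"
proof -
  let ?s = "run n start_prog (input_mem k n E)"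
  let ?B = "n + k + (n + 4) * cost n start_prog"
  note S = run_start
  have "(n + 4) * cost n start_prog + (n + 4) * (2 * n * cost n body_prog) \<le> (n + 4) * time_bound n"
    unfolding time_bound_def add_mult_distrib2[symmetric] by (intro mult_left_mono) (simp_all add: algebra_simps)
  then have WB: "?B + (n + 4) * (2 * n * cost n body_prog) \<le> W" using W by linarith
  then have "?B \<le> W" by linarith
  moreover have "input_mem k n E ''n'' 0 = n" by (simp add: input_mem_def)
  ultimately obtain t0 where t0: "t0 \<le> cost n start_prog" "exec W (compile start_prog) (input_mem k n E) t0 ?s"
    "bounded ?B ?s" using exec_compile[OF wf_progs(1) _ bounded_input] by blast
  obtain \<delta> where \<delta>: "designation \<delta>" "designated \<delta> (?s ''ctr'')" using designation_for[OF S(2)] by blast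
  have "card (centers (?s ''ctr'')) + card (pairs (?s ''ctr'')) \<le> 2 * n"
    using progress_bound[of "?s ''ctr''"] by simp
  then obtain t1 s' where t1: "approx1_loop W k n E \<delta> loop_cond (compile body_prog) ?s t1 s'"
    "t1 \<le> 5 + 2 * n * (5 + cost n body_prog)" "valid (s' ''ctr'')"
    using run_loop[OF S(1,2) \<delta>(2) S(4) _ _ _ t0(3) WB] S(5,6) by blast
  have "approx1_exec W k n E \<delta> (compile start_prog) loop_cond (compile body_prog) (t0 + t1) s'"
    unfolding approx1_exec_def using t0(2) S(3) t1(1) by blast
  moreover have "star_partition k ({..<n}, E) (stored_partition n s')"
    unfolding stored_partition_part[of s', OF t1(3)] by (rule star_partition_part[OF t1(3)])
  moreover have "t0 + t1 \<le> time_bound n" using t0(1) t1(2) by (simp add: time_bound_def)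
  ultimately show ?thesis using \<delta>(1) by blast
qed

end

text \<open>The start program nests three loops; the body nests two and runs at most
  \<open>2 * n\<close> times.\<close>

lemma time_bound_cubic: "\<exists>C. \<forall>n. time_bound n \<le> C * (n + 1) ^ 3"
proof -
  obtain C D where C: "\<And>n. cost n start_prog \<le> C * (n + 1) ^ 3" and D: "\<And>n. cost n body_prog \<le> D * (n + 1) ^ 2"
    using cost_depth[of start_prog] cost_depth[of body_prog] unfolding depth_progs by blast
  \<comment> \<open>The rounds contribute \<open>10 + 2 * D\<close>, and the last test of the loop
    condition contributes 5.\<close>
  have "time_bound n \<le> (C + 15 + 2 * D) * (n + 1) ^ 3" for n
  proof -
    have "2 * n * (5 + cost n body_prog) \<le> 2 * (n + 1) * ((5 + D) * (n + 1) ^ 2)"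
    proof (rule mult_mono)
      have "5 * 1 \<le> 5 * (n + 1) ^ 2" by (intro mult_left_mono one_le_power) simp_all
      then show "5 + cost n body_prog \<le> (5 + D) * (n + 1) ^ 2"
        using D[of n] unfolding add_mult_distrib by linarith
    qed simp_all
    also have "\<dots> = (10 + 2 * D) * (n + 1) ^ 3" by (simp add: power3_eq_cube power2_eq_square algebra_simps)
    finally have "2 * n * (5 + cost n body_prog) \<le> (10 + 2 * D) * (n + 1) ^ 3" .
    moreover have "5 * 1 \<le> 5 * (n + 1) ^ 3" by (intro mult_left_mono one_le_power) simp_all
    ultimately show ?thesis
      using C[of n] unfolding time_bound_def add_mult_distrib by linarith
  qed
  then show ?thesis by blast
qed

theorem theorem1:
  shows "(\<forall>(k::nat) (G::'a ugraph) \<delta>. 4 \<le> k \<longrightarrow> simple_graph G \<longrightarrow> designation \<delta> \<longrightarrow>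
            \<not> approx1_diverges k G \<delta> \<and>
            (\<forall>P. approx1_output k G \<delta> P \<longrightarrow> star_partition k G P)) \<and>
         (\<exists>start b body (c::nat) (T::nat \<Rightarrow> nat).
            (\<lambda>n. real (T n)) \<in> O(\<lambda>n. real n ^ 3) \<and>
            (\<forall>(k::nat) (n::nat) (E::nat set set). 4 \<le> k \<longrightarrow> simple_graph ({..<n}, E) \<longrightarrow>
               (\<exists>\<delta> t s. designation \<delta> \<and>
                  approx1_exec ((n + k) ^ c) k n E \<delta> start b body t s \<and>
                  star_partition k ({..<n}, E) (stored_partition n s) \<and>
                  t \<le> T n)))"
proof (intro conjI allI impI)
  fix k :: nat and G :: "'a ugraph" and \<delta> :: "'a set \<Rightarrow> 'a" and P
  assume "4 \<le> k" "simple_graph G" "designation \<delta>"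
  then interpret bounded_graph k "verts G" "edges G" by unfold_locales simp_all
  show "\<not> approx1_diverges k G \<delta>"
    using operations_terminate_correctly(1)[OF \<open>designation \<delta>\<close>] by simp
  show "star_partition k G P" if "approx1_output k G \<delta> P"
    using operations_terminate_correctly(2)[OF \<open>designation \<delta>\<close>, of P] that by simp
next
  obtain C where C: "\<And>n. time_bound n \<le> C * (n + 1) ^ 3" using time_bound_cubic by blast
  have "(\<lambda>n. real (time_bound n)) \<in> O(\<lambda>n. real n ^ 3)"
  proof (rule bigoI[where c = "8 * real C"], rule eventually_mono[OF eventually_ge_at_top[of 1]])
    fix n :: nat assume n: "1 \<le> n"
    \<comment> \<open>From \<open>n \<ge> 1\<close> on, \<open>n + 1\<close> is at most
      \<open>2 * n\<close>, whence the factor 8.\<close>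
    have "C * (n + 1) ^ 3 \<le> C * (2 * n) ^ 3" using n by (intro mult_left_mono power_mono) simp_all
    then have "time_bound n \<le> C * (2 * n) ^ 3" by (rule order_trans[OF C])
    then have "real (time_bound n) \<le> real (C * (2 * n) ^ 3)" by (rule of_nat_mono)
    then show "norm (real (time_bound n)) \<le> 8 * real C * norm (real n ^ 3)"
      by (simp add: power_mult_distrib)
  qed
  moreover have "\<exists>\<delta> t s. designation \<delta> \<and>
      approx1_exec ((n + k) ^ (C + 5)) k n E \<delta> (compile start_prog) loop_cond (compile body_prog) t s \<and>
      star_partition k ({..<n}, E) (stored_partition n s) \<and> t \<le> time_bound n"
    if "4 \<le> k" "simple_graph ({..<n}, E)" for k n E
  proof -
    interpret nat_graph k n E using that by unfold_locales simp_all
    let ?N = "n + k"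
    have "n + k + (n + 4) * time_bound n \<le> ?N * ?N ^ 3 + ?N * (C * ?N ^ 3)"
    proof (intro add_mono mult_mono)
      have "?N * 1 \<le> ?N * ?N ^ 3" using that(1) by (intro mult_left_mono one_le_power) simp_all
      then show "n + k \<le> ?N * ?N ^ 3" by simp
      have "C * (n + 1) ^ 3 \<le> C * ?N ^ 3" using that(1) by (intro mult_left_mono power_mono) simp_all
      then show "time_bound n \<le> C * ?N ^ 3" using C[of n] by (rule order_trans[rotated])
    qed (use that(1) in simp_all)
    also have "\<dots> = (C + 1) * ?N ^ 4" by (simp add: numeral_eq_Suc algebra_simps)
    \<comment> \<open>The exponent must not depend on \<open>n\<close> and \<open>k\<close>, so the
      factor \<open>C + 1\<close> is absorbed by a power of \<open>?N\<close>, which is at least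
      2.\<close>
    also have "\<dots> \<le> ?N ^ (C + 1) * ?N ^ 4"
    proof (rule mult_right_mono)
      have "C + 1 \<le> 2 ^ (C + 1)" using less_exp[of "C + 1"] by linarith
      also have "(2::nat) ^ (C + 1) \<le> ?N ^ (C + 1)" using that(1) by (intro power_mono) simp_all
      finally show "C + 1 \<le> ?N ^ (C + 1)" .
    qed simp
    also have "\<dots> = ?N ^ (C + 5)" by (simp only: power_add[symmetric] add.assoc) simp
    finally show ?thesis by (rule approx1_exec_start)
  qed
  ultimately show "\<exists>start b body (c::nat) (T::nat \<Rightarrow> nat).
            (\<lambda>n. real (T n)) \<in> O(\<lambda>n. real n ^ 3) \<and>
            (\<forall>(k::nat) (n::nat) (E::nat set set). 4 \<le> k \<longrightarrow> simple_graph ({..<n}, E) \<longrightarrow>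
               (\<exists>\<delta> t s. designation \<delta> \<and>
                  approx1_exec ((n + k) ^ c) k n E \<delta> start b body t s \<and>
                  star_partition k ({..<n}, E) (stored_partition n s) \<and>
                  t \<le> T n))"
    by blast
qed

end
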